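(* Let $C: f=0$ be a nodal curve in $\mathbb{P}^2$ (over $\mathbb{C}$) of degree $d\geq 4$. Let $\mathcal{N}$ be the set of nodes of $C$ and, for an integer $m$, let $I_m(C)$ be the linear system of curves of degree $m$ passing through all the nodes in $\mathcal{N}$. Assume that there is an integer $m$ such that the following hold: (i) $2m<d-1$ if $C$ is irreducible, or $2m<d-2$ if $C$ is reducible; (ii) the base locus of the linear system $I_m(C)$ is $0$-dimensional. Then the curve $C$ is Torelli.
   Context: A nodal curve is a reduced plane curve all of whose singularities are nodes ($A_1$). The base locus of $I_m(C)$ is the set of common zeros in $\mathbb{P}^2$ of all homogeneous polynomials of degree $m$ vanishing on $\mathcal{N}$; it is $0$-dimensional if it is a nonempty finite set. For a reduced curve $C: f=0$ of degree $d$ in $\mathbb{P}^2$, with $f\in S=\mathbb{C}[x,y,z]$ homogeneous, the sheaf of logarithmic vector fields $T\langle C\rangle$ is the rank two vector bundle on $\mathbb{P}^2$ which is the kernel of the map $\mathcal{O}_{\mathbb{P}^2}(1)^3 \to \mathcal{J}_f(d)$, $(a,b,c)\mapsto af_x+bf_y+cf_z$, where $\mathcal{J}_f\subset \mathcal{O}_{\mathbb{P}^2}$ is the ideal sheaf generated by the partial derivatives $f_x,f_y,f_z$. The curve $C$ is called Torelli (in the sense of Dolgachev–Kapranov) if it can be reconstructed from $T\langle C\rangle$, i.e. if for every reduced curve $C'\subset\mathbb{P}^2$ with $T\langle C'\rangle\cong T\langle C\rangle$ one has $C'=C$. *)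

theory Defs
  imports
    "HOL-Analysis.Analysis"
    "HOL-Library.Poly_Mapping"
    "HOL-Computational_Algebra.Computational_Algebra"
begin

section \<open>Homogeneous polynomials in three variables\<close>

text \<open>
  The ring S = C[x,y,z] is the monoid ring of exponent vectors; the three variables are
  indexed by the same type as the coordinates of \<^typ>\<open>complex ^ 3\<close>.
\<close>

type_synonym tpoly = "(3 \<Rightarrow>\<^sub>0 nat) \<Rightarrow>\<^sub>0 complex"

definition eval :: "tpoly \<Rightarrow> complex ^ 3 \<Rightarrow> complex" where
  "eval p v = (\<Sum>\<mu>\<in>Poly_Mapping.keys p.
     Poly_Mapping.lookup p \<mu> * (\<Prod>i\<in>UNIV. (v $ i) ^ Poly_Mapping.lookup \<mu> i))"

text \<open>
  The degree is an integer, so that forms of negative degree make sense (only \<open>0\<close> is one).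
  The zero polynomial is homogeneous of every degree.
\<close>

definition homogeneous :: "int \<Rightarrow> tpoly \<Rightarrow> bool" where
  "homogeneous k p \<longleftrightarrow>
     (\<forall>\<mu>\<in>Poly_Mapping.keys p. int (\<Sum>i\<in>UNIV. Poly_Mapping.lookup \<mu> i) = k)"

text \<open>
  In the next definition the subtraction of exponents is truncated, but it is only relevant
  when the exponent of the variable is positive, as the coefficient is zero otherwise.
\<close>

definition pderivative :: "3 \<Rightarrow> tpoly \<Rightarrow> tpoly" where
  "pderivative i p = (\<Sum>\<mu>\<in>Poly_Mapping.keys p.
     Poly_Mapping.single (\<mu> - Poly_Mapping.single i 1)
       (of_nat (Poly_Mapping.lookup \<mu> i) * Poly_Mapping.lookup p \<mu>))"


section \<open>The projective plane\<close>

text \<open>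
  A point of the projective plane is the set of all its homogeneous coordinate vectors. Hence for a
  set \<open>U\<close> of points, \<open>\<Union>U\<close> is the punctured cone over \<open>U\<close> in \<^typ>\<open>complex ^ 3\<close>.
\<close>

type_synonym point = "(complex ^ 3) set"

definition proj_point :: "complex ^ 3 \<Rightarrow> point" where
  "proj_point v = {c *s v | c. c \<noteq> 0}"

definition P2 :: "point set" where
  "P2 = proj_point ` {v. v \<noteq> 0}"

definition common_zeros :: "tpoly set \<Rightarrow> point set" where
  "common_zeros F = {P \<in> P2. \<forall>p\<in>F. \<forall>v\<in>P. eval p v = 0}"

definition zariski_open :: "point set \<Rightarrow> bool" where
  "zariski_open U \<longleftrightarrow>
     (\<exists>F. (\<forall>p\<in>F. \<exists>k. homogeneous k p) \<and> U = P2 - common_zeros F)"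


section \<open>Plane curves and nodes\<close>

definition reduced_curve :: "tpoly \<Rightarrow> nat \<Rightarrow> bool" where
  "reduced_curve f d \<longleftrightarrow> d \<ge> 1 \<and> f \<noteq> 0 \<and> homogeneous (int d) f \<and> squarefree f"

definition curve_points :: "tpoly \<Rightarrow> point set" where
  "curve_points f = common_zeros {f}"

definition singular_points :: "tpoly \<Rightarrow> point set" where
  "singular_points f =
     {P \<in> curve_points f. \<forall>v\<in>P. \<forall>i. eval (pderivative i f) v = 0}"

text \<open>
  Degree two part of the Taylor expansion of \<open>w \<mapsto> f (v + w)\<close>.
\<close>

definition quadratic_part :: "tpoly \<Rightarrow> complex ^ 3 \<Rightarrow> complex ^ 3 \<Rightarrow> complex" where
  "quadratic_part f v w =
     (\<Sum>i\<in>UNIV. \<Sum>j\<in>UNIV. eval (pderivative i (pderivative j f)) v * (w $ i) * (w $ j)) / 2"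

text \<open>
  A node (ordinary double point) is a singular point at which the curve has multiplicity two
  and two distinct tangent lines. In the affine chart \<open>x\<^sub>k = 1\<close>, with \<open>v\<close> the representative of the
  point in this chart, affine coordinates centred at the point are the vectors \<open>w\<close> with
  \<open>w\<^sub>k = 0\<close>. The quadratic part of the local equation \<open>w \<mapsto> f (v + w)\<close> has to be a
  product of two linear forms \<open>a\<close>, \<open>b\<close> that are linearly independent on the plane \<open>w\<^sub>k = 0\<close>,
  which is to say that they have no common zero there except the origin.
\<close>

definition linear_form :: "complex ^ 3 \<Rightarrow> complex ^ 3 \<Rightarrow> complex" where
  "linear_form a w = (\<Sum>i\<in>UNIV. a $ i * w $ i)"

definition is_node :: "tpoly \<Rightarrow> point \<Rightarrow> bool" where
  "is_node f P \<longleftrightarrow> P \<in> singular_points f \<and>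
     (\<exists>v\<in>P. \<exists>k. v $ k = 1 \<and>
       (\<exists>a b. (\<forall>w. w $ k = 0 \<longrightarrow>
                 quadratic_part f v w = linear_form a w * linear_form b w) \<and>
              (\<forall>w. w $ k = 0 \<and> linear_form a w = 0 \<and> linear_form b w = 0 \<longrightarrow> w = 0)))"

definition nodes :: "tpoly \<Rightarrow> point set" where
  "nodes f = {P. is_node f P}"

definition nodal_curve :: "tpoly \<Rightarrow> nat \<Rightarrow> bool" where
  "nodal_curve f d \<longleftrightarrow> reduced_curve f d \<and> (\<forall>P\<in>singular_points f. is_node f P)"


section \<open>Curves of given degree through the nodes\<close>

definition forms_through_nodes :: "int \<Rightarrow> tpoly \<Rightarrow> tpoly set" where
  "forms_through_nodes m f =
     {g. homogeneous m g \<and> (\<forall>P\<in>nodes f. \<forall>v\<in>P. eval g v = 0)}"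

definition base_locus :: "int \<Rightarrow> tpoly \<Rightarrow> point set" where
  "base_locus m f = common_zeros (forms_through_nodes m f)"

definition zero_dimensional :: "point set \<Rightarrow> bool" where
  "zero_dimensional Z \<longleftrightarrow> finite Z \<and> Z \<noteq> {}"


section \<open>The sheaf of logarithmic vector fields\<close>

text \<open>
  Sections of \<open>O(k)\<close> over a Zariski open \<open>U\<close>: functions on the punctured cone over \<open>U\<close> that are
  locally quotients of forms whose degrees differ by \<open>k\<close>. They are extended by \<open>0\<close> outside of
  the cone, so that equality of sections is equality of functions. For \<open>k = 0\<close> these are the
  regular functions on \<open>U\<close>.
\<close>

definition twist_sections :: "int \<Rightarrow> point set \<Rightarrow> (complex ^ 3 \<Rightarrow> complex) set" where
  "twist_sections k U =
     {s. (\<forall>v. v \<notin> \<Union>U \<longrightarrow> s v = 0) \<and>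
         (\<forall>P\<in>U. \<exists>W g h e. zariski_open W \<and> P \<in> W \<and> W \<subseteq> U \<and>
            homogeneous (e + k) g \<and> homogeneous e h \<and>
            (\<forall>v\<in>\<Union>W. eval h v \<noteq> 0 \<and> s v = eval g v / eval h v))}"

text \<open>
  The sheaf \<open>T\<langle>C\<rangle>\<close> of the curve \<open>f = 0\<close>: the kernel of \<open>(a, b, c) \<mapsto> a f\<^sub>x + b f\<^sub>y + c f\<^sub>z\<close> on
  \<open>O(1)\<^sup>3\<close>. The triple \<open>(a, b, c)\<close> is encoded as a single vector-valued function. As the kernel of
  a map of sheaves is computed on sections, it is irrelevant whether the target of the map is
  \<open>J\<^sub>f(d)\<close> or \<open>O(d)\<close>, in which \<open>J\<^sub>f(d)\<close> is contained.
\<close>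

definition log_vector_fields :: "tpoly \<Rightarrow> point set \<Rightarrow> (complex ^ 3 \<Rightarrow> complex ^ 3) set" where
  "log_vector_fields f U =
     {s. (\<forall>i. (\<lambda>v. s v $ i) \<in> twist_sections 1 U) \<and>
         (\<forall>v\<in>\<Union>U. (\<Sum>i\<in>UNIV. s v $ i * eval (pderivative i f) v) = 0)}"

definition restrict_section :: "point set \<Rightarrow> (complex ^ 3 \<Rightarrow> complex ^ 3) \<Rightarrow> complex ^ 3 \<Rightarrow> complex ^ 3" where
  "restrict_section W s = (\<lambda>v. if v \<in> \<Union>W then s v else 0)"

text \<open>
  Isomorphism of sheaves of modules over the structure sheaf \<^term>\<open>twist_sections 0\<close>, for
  sheaves whose sections are vector-valued functions on punctured cones (extended by \<open>0\<close>).
\<close>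

definition sheaf_isomorphic ::
  "(point set \<Rightarrow> (complex ^ 3 \<Rightarrow> complex ^ 3) set) \<Rightarrow>
   (point set \<Rightarrow> (complex ^ 3 \<Rightarrow> complex ^ 3) set) \<Rightarrow> bool" where
  "sheaf_isomorphic F G \<longleftrightarrow>
     (\<exists>\<phi> :: point set \<Rightarrow> (complex ^ 3 \<Rightarrow> complex ^ 3) \<Rightarrow> complex ^ 3 \<Rightarrow> complex ^ 3.
        (\<forall>U. zariski_open U \<longrightarrow>
           bij_betw (\<phi> U) (F U) (G U) \<and>
           (\<forall>s\<in>F U. \<forall>t\<in>F U. \<phi> U (\<lambda>v. s v + t v) = (\<lambda>v. \<phi> U s v + \<phi> U t v)) \<and>
           (\<forall>r\<in>twist_sections 0 U. \<forall>s\<in>F U. \<phi> U (\<lambda>v. r v *s s v) = (\<lambda>v. r v *s \<phi> U s v))) \<and>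
        (\<forall>U W. zariski_open U \<longrightarrow> zariski_open W \<longrightarrow> W \<subseteq> U \<longrightarrow>
           (\<forall>s\<in>F U. \<phi> W (restrict_section W s) = restrict_section W (\<phi> U s))))"

text \<open>
  Equality of reduced curves is equality of their sets of points.
\<close>

definition torelli :: "tpoly \<Rightarrow> bool" where
  "torelli f \<longleftrightarrow>
     (\<forall>f' d'. reduced_curve f' d' \<longrightarrow>
        sheaf_isomorphic (log_vector_fields f') (log_vector_fields f) \<longrightarrow>
        curve_points f' = curve_points f)"

end

theory Submission
  imports Defs "HOL-Computational_Algebra.Field_as_Ring"
begin

text \<open>
  The sheaf determines the graded module of syzygies \<open>s\<close> with \<open>s \<cdot> \<nabla>f = 0\<close>, because the
  sections of its twists are triples of forms. Let \<open>g\<close> be a form of degree \<open>m\<close> through the nodes. As the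
  Jacobian ideal is locally radical at nodes, \<open>g\<close> annihilates the syzygies modulo the Koszul ones, so
  that \<open>g w = N\<^sub>g \<times> \<nabla>f\<close> for every syzygy \<open>w\<close> of degree \<open>d - 1\<close>. Since \<open>2 m < d - 1\<close>, the triple \<open>N\<^sub>g\<close>
  is unique and \<open>h N\<^sub>g = g N\<^sub>h\<close>, and as the base locus is finite, \<open>N\<^sub>g / g\<close> is constant. So all
  syzygies of degree \<open>d - 1\<close> are Koszul syzygies. Hence an isomorphism with the syzygy module of a
  reduced curve \<open>f' = 0\<close> is given by a constant matrix, and \<open>\<nabla>f' = A \<nabla>f\<close> with constant \<open>A\<close>. The
  existence of a node of \<open>f\<close> and \<open>d \<ge> 4\<close> force \<open>A\<close> to be scalar.
\<close>

section \<open>Polynomials and their homogeneous parts\<close>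

text \<open>The matrix is constant for the following reason. Let F be the gradient of f, let K_1,
  K_2, K_3 be its Koszul syzygies and T_1, T_2, T_3 their images among the syzygies of f'. The
  relation F_1 K_1 + F_2 K_2 + F_3 K_3 = 0 is carried over to the T_a. Read in one fixed component
  i, it says that the triple of the T_a i is again a syzygy of f of degree d - 1, hence a constant
  combination of Koszul syzygies. The remaining syzygies follow, because F_l times a syzygy of f is
  a polynomial combination of the K_a.

  The degree of f' is not known beforehand; it is found when the two gradients are compared.

  The triple N_g exists at first only over the three charts, with powers of the coordinates as
  denominators. Gluing needs the first cohomology of line bundles on the plane to vanish, and it
  needs rational functions to have no isolated poles. The former comes from the regularity of the
  powers of the coordinates, the latter from the Nullstellensatz and unique factorization.\<close>

definition Const :: "complex \<Rightarrow> tpoly" where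
  "Const c = Poly_Mapping.single 0 c"

definition Var :: "3 \<Rightarrow> tpoly" where
  "Var i = Poly_Mapping.single (Poly_Mapping.single i 1) 1"

section \<open>Ring homomorphisms out of the polynomial ring\<close>

definition is_ring_hom :: "('a::comm_ring_1 \<Rightarrow> 'b::comm_ring_1) \<Rightarrow> bool" where
  "is_ring_hom h \<longleftrightarrow> h 1 = 1 \<and> (\<forall>x y. h (x + y) = h x + h y) \<and> (\<forall>x y. h (x * y) = h x * h y)"

lemma ring_hom_one: "is_ring_hom h \<Longrightarrow> h 1 = 1"
  and ring_hom_add: "is_ring_hom h \<Longrightarrow> h (x + y) = h x + h y"
  and ring_hom_mult: "is_ring_hom h \<Longrightarrow> h (x * y) = h x * h y"
  by (simp_all add: is_ring_hom_def)

lemma ring_hom_zero: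
  assumes "is_ring_hom h"
  shows "h 0 = 0"
  using ring_hom_add[OF assms, of 0 0] by simp

lemma ring_hom_minus:
  assumes "is_ring_hom h"
  shows "h (- x) = - h x"
  using ring_hom_add[OF assms, of x "- x"] ring_hom_zero[OF assms]
  by (simp add: eq_neg_iff_add_eq_0 add.commute)

lemma ring_hom_diff:
  assumes "is_ring_hom h"
  shows "h (x - y) = h x - h y"
  using ring_hom_add[OF assms, of x "- y"] ring_hom_minus[OF assms, of y] by simp

lemma ring_hom_power: "is_ring_hom h \<Longrightarrow> h (x ^ n) = h x ^ n"
  by (induction n) (simp_all add: ring_hom_one ring_hom_mult)

lemma ring_hom_sum: "is_ring_hom h \<Longrightarrow> h (sum f A) = (\<Sum>x\<in>A. h (f x))"
  by (induction A rule: infinite_finite_induct) (simp_all add: ring_hom_zero ring_hom_add)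

lemma ring_hom_prod: "is_ring_hom h \<Longrightarrow> h (prod f A) = (\<Prod>x\<in>A. h (f x))"
  by (induction A rule: infinite_finite_induct) (simp_all add: ring_hom_one ring_hom_mult)

lemma ring_hom_comp: "is_ring_hom g \<Longrightarrow> is_ring_hom h \<Longrightarrow> is_ring_hom (\<lambda>x. g (h x))"
  by (simp add: is_ring_hom_def)

lemma ring_hom_Const: "is_ring_hom Const"
  by (simp add: is_ring_hom_def Const_def single_add mult_single)

lemmas Const_simps =
  ring_hom_one[OF ring_hom_Const] ring_hom_zero[OF ring_hom_Const]
  ring_hom_add[OF ring_hom_Const] ring_hom_mult[OF ring_hom_Const]
  ring_hom_minus[OF ring_hom_Const] ring_hom_diff[OF ring_hom_Const]
  ring_hom_power[OF ring_hom_Const] ring_hom_sum[OF ring_hom_Const]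

lemma Const_eq_iff [simp]: "Const a = Const b \<longleftrightarrow> a = b"
  by (metis Const_def lookup_single_eq)

lemma Const_eq_0_iff [simp]: "Const a = 0 \<longleftrightarrow> a = 0"
  by (metis Const_eq_iff Const_simps(2))

lemma Const_mult_single: "Const c * Poly_Mapping.single \<mu> a = Poly_Mapping.single \<mu> (c * a)"
  by (simp add: Const_def mult_single)

lemma tpoly_sum_single:
  fixes p :: "'a \<Rightarrow>\<^sub>0 'b::comm_monoid_add"
  shows "p = (\<Sum>\<mu>\<in>Poly_Mapping.keys p. Poly_Mapping.single \<mu> (Poly_Mapping.lookup p \<mu>))"
  by (rule poly_mapping_eqI)
    (auto simp: lookup_sum lookup_single when_def in_keys_iff)

lemma single_induct [case_names zero add single]:
  fixes p :: "'a \<Rightarrow>\<^sub>0 'b::comm_monoid_add"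
  assumes "P 0" "\<And>p q. P p \<Longrightarrow> P q \<Longrightarrow> P (p + q)" "\<And>\<mu> c. P (Poly_Mapping.single \<mu> c)"
  shows "P p"
proof -
  have "P (\<Sum>\<mu>\<in>K. Poly_Mapping.single \<mu> (f \<mu>))" for K :: "'a set" and f
    by (induction K rule: infinite_finite_induct) (auto intro: assms)
  then show ?thesis
    by (subst tpoly_sum_single)
qed

lemma single_Suc_exponent:
  "Poly_Mapping.single (\<mu> + Poly_Mapping.single i 1) c = Var i * Poly_Mapping.single \<mu> c"
  by (simp add: Var_def mult_single add.commute)

lemma exponent_induct [case_names zero step]:
  fixes \<mu> :: "'a::finite \<Rightarrow>\<^sub>0 nat"
  assumes "P 0" "\<And>\<mu> i. P \<mu> \<Longrightarrow> P (\<mu> + Poly_Mapping.single i 1)"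
  shows "P \<mu>"
proof (induction "\<Sum>i\<in>UNIV. Poly_Mapping.lookup \<mu> i" arbitrary: \<mu>)
  case 0
  then have "\<mu> = 0"
    by (intro poly_mapping_eqI) simp
  with assms(1) show ?case by simp
next
  case (Suc n)
  then obtain i where i: "Poly_Mapping.lookup \<mu> i \<noteq> 0"
    by (metis nat.distinct(1) sum.neutral)
  define \<nu> where "\<nu> = \<mu> - Poly_Mapping.single i 1"
  have eq: "\<mu> = \<nu> + Poly_Mapping.single i 1"
    using i by (intro poly_mapping_eqI) (auto simp: \<nu>_def lookup_add lookup_minus lookup_single when_def)
  have "(\<Sum>j\<in>UNIV. Poly_Mapping.lookup \<mu> j) = (\<Sum>j\<in>UNIV. Poly_Mapping.lookup \<nu> j) + 1"
    unfolding eq by (simp add: lookup_add sum.distrib lookup_single when_def)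
  with Suc show ?case
    using assms(2) eq by (metis Suc_eq_plus1 add_right_cancel)
qed

lemma tpoly_induct [case_names Const add Var]:
  assumes "\<And>c. P (Const c)" "\<And>p q. P p \<Longrightarrow> P q \<Longrightarrow> P (p + q)" "\<And>i p. P p \<Longrightarrow> P (Var i * p)"
  shows "P p"
proof (induction p rule: single_induct)
  case zero
  then show ?case using assms(1)[of 0] by (simp add: Const_simps)
next
  case (add p q)
  then show ?case by (rule assms(2))
next
  case (single \<mu> c)
  show ?case
  proof (induction \<mu> rule: exponent_induct)
    case zero
    then show ?case using assms(1)[of c] by (simp add: Const_def)
  next
    case (step \<mu> i)
    then show ?case by (simp only: single_Suc_exponent assms(3))
  qed
qed

text \<open>The universal property of the polynomial ring: constants are mapped by \<open>c\<close>,
  the variable \<open>i\<close> to \<open>y i\<close>. Evaluation, the grading by degree, the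
  iterated polynomial ring and restriction to a line through the origin are instances, so each is a
  homomorphism without a separate computation.\<close>

definition tsubst :: "(complex \<Rightarrow> 'r) \<Rightarrow> (3 \<Rightarrow> 'r) \<Rightarrow> tpoly \<Rightarrow> 'r::comm_ring_1" where
  "tsubst c y p = (\<Sum>\<mu>\<in>Poly_Mapping.keys p.
     c (Poly_Mapping.lookup p \<mu>) * (\<Prod>i\<in>UNIV. y i ^ Poly_Mapping.lookup \<mu> i))"

context
  fixes c :: "complex \<Rightarrow> 'r::comm_ring_1" and y :: "3 \<Rightarrow> 'r"
  assumes c: "is_ring_hom c"
begin

lemma tsubst_superset:
  assumes "finite K" "Poly_Mapping.keys p \<subseteq> K"
  shows "tsubst c y p = (\<Sum>\<mu>\<in>K. c (Poly_Mapping.lookup p \<mu>) * (\<Prod>i\<in>UNIV. y i ^ Poly_Mapping.lookup \<mu> i))"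
  unfolding tsubst_def using assms
  by (intro sum.mono_neutral_left) (auto simp: in_keys_iff ring_hom_zero[OF c])

lemma tsubst_add: "tsubst c y (p + q) = tsubst c y p + tsubst c y q"
proof -
  define K where "K = Poly_Mapping.keys p \<union> Poly_Mapping.keys q"
  have K: "finite K" "Poly_Mapping.keys p \<subseteq> K" "Poly_Mapping.keys q \<subseteq> K" "Poly_Mapping.keys (p + q) \<subseteq> K"
    using keys_add[of p q] by (auto simp: K_def)
  show ?thesis
    using K by (simp add: tsubst_superset[of K] lookup_add ring_hom_add[OF c] distrib_right sum.distrib)
qed

lemma tsubst_zero: "tsubst c y 0 = 0"
  by (simp add: tsubst_def)

lemma tsubst_single:
  "tsubst c y (Poly_Mapping.single \<mu> a) = c a * (\<Prod>i\<in>UNIV. y i ^ Poly_Mapping.lookup \<mu> i)"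
  by (simp add: tsubst_superset[of "{\<mu>}"])

lemma tsubst_mult: "tsubst c y (p * q) = tsubst c y p * tsubst c y q"
proof (induction p rule: single_induct)
  case zero
  then show ?case by (simp add: tsubst_zero)
next
  case (add p p')
  then show ?case by (simp add: tsubst_add distrib_right)
next
  case (single \<mu> a)
  show ?case
  proof (induction q rule: single_induct)
    case zero
    then show ?case by (simp add: tsubst_zero)
  next
    case (add p p')
    then show ?case by (simp add: tsubst_add distrib_left)
  next
    case (single \<nu> b)
    then show ?case
      by (simp add: mult_single tsubst_single lookup_add power_add prod.distrib
          ring_hom_mult[OF c] algebra_simps)
  qed
qed

lemma tsubst_Const [simp]: "tsubst c y (Const a) = c a"
  by (simp add: Const_def tsubst_single)

lemma tsubst_Var [simp]: "tsubst c y (Var j) = y j"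
proof -
  have "(\<Prod>i\<in>UNIV. y i ^ Poly_Mapping.lookup (Poly_Mapping.single j 1) i) = (\<Prod>i\<in>UNIV. if i = j then y j else 1)"
    by (intro prod.cong) (auto simp: lookup_single when_def)
  then show ?thesis
    by (simp add: Var_def tsubst_single ring_hom_one[OF c])
qed

lemma ring_hom_tsubst: "is_ring_hom (tsubst c y)"
  unfolding is_ring_hom_def
  using tsubst_Const[of 1] by (auto simp: tsubst_add tsubst_mult Const_simps ring_hom_one[OF c])

end

lemma ring_hom_tpoly_eqI:
  assumes "is_ring_hom g" "is_ring_hom h" "\<And>c. g (Const c) = h (Const c)" "\<And>i. g (Var i) = h (Var i)"
  shows "g p = h p"
  by (induction p rule: tpoly_induct) (simp_all add: assms ring_hom_add ring_hom_mult)

lemma ring_hom_id: "is_ring_hom (\<lambda>x. x)"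
  by (simp add: is_ring_hom_def)

lemma eval_conv_tsubst: "eval p v = tsubst (\<lambda>x. x) (\<lambda>i. v $ i) p"
  by (simp add: eval_def tsubst_def)

lemma ring_hom_eval: "is_ring_hom (\<lambda>p. eval p v)"
  unfolding eval_conv_tsubst by (rule ring_hom_tsubst[OF ring_hom_id])

lemma eval_Const [simp]: "eval (Const c) v = c"
  and eval_Var [simp]: "eval (Var i) v = v $ i"
  by (simp_all add: eval_conv_tsubst ring_hom_id)

lemmas eval_simps [simp] =
  ring_hom_one[OF ring_hom_eval] ring_hom_zero[OF ring_hom_eval]
  ring_hom_add[OF ring_hom_eval] ring_hom_mult[OF ring_hom_eval]
  ring_hom_minus[OF ring_hom_eval] ring_hom_diff[OF ring_hom_eval]
  ring_hom_power[OF ring_hom_eval] ring_hom_sum[OF ring_hom_eval]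
  ring_hom_prod[OF ring_hom_eval]

text \<open>The substitution of t x_i for x_i with a new variable t: the coefficient of t^n is the
  homogeneous part of degree n. Questions about degrees thus become cancellation and comparison of
  coefficients in a univariate polynomial ring.\<close>

definition hom_parts :: "tpoly \<Rightarrow> tpoly poly" where
  "hom_parts = tsubst (\<lambda>c. [:Const c:]) (\<lambda>i. monom (Var i) 1)"

lemma ring_hom_hom_parts: "is_ring_hom hom_parts"
  unfolding hom_parts_def
  by (intro ring_hom_tsubst) (simp add: is_ring_hom_def Const_simps flip: one_pCons)

lemma hom_parts_Const [simp]: "hom_parts (Const c) = [:Const c:]"
  and hom_parts_Var [simp]: "hom_parts (Var i) = monom (Var i) 1"
proof -
  have "is_ring_hom (\<lambda>c. [:Const c:])"
    by (simp add: is_ring_hom_def Const_simps flip: one_pCons)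
  then show "hom_parts (Const c) = [:Const c:]" "hom_parts (Var i) = monom (Var i) 1"
    by (simp_all add: hom_parts_def)
qed

lemmas hom_parts_simps =
  ring_hom_one[OF ring_hom_hom_parts] ring_hom_zero[OF ring_hom_hom_parts]
  ring_hom_add[OF ring_hom_hom_parts] ring_hom_mult[OF ring_hom_hom_parts]
  ring_hom_minus[OF ring_hom_hom_parts] ring_hom_diff[OF ring_hom_hom_parts]
  ring_hom_power[OF ring_hom_hom_parts] ring_hom_sum[OF ring_hom_hom_parts]

lemma hom_parts_single:
  "hom_parts (Poly_Mapping.single \<mu> c) =
     monom (Poly_Mapping.single \<mu> c) (\<Sum>i\<in>UNIV. Poly_Mapping.lookup \<mu> i)"
proof (induction \<mu> rule: exponent_induct)
  case zero
  show ?case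
    using hom_parts_Const[of c] by (simp add: Const_def monom_0)
next
  case (step \<mu> i)
  have "(\<Sum>j\<in>UNIV. Poly_Mapping.lookup (\<mu> + Poly_Mapping.single i 1) j) =
      Suc (\<Sum>j\<in>UNIV. Poly_Mapping.lookup \<mu> j)"
    by (simp add: lookup_add sum.distrib lookup_single when_def)
  then show ?case
    unfolding single_Suc_exponent hom_parts_simps(4) step
    by (simp add: mult_monom)
qed

lemma homogeneous_iff_hom_parts: "homogeneous (int n) p \<longleftrightarrow> hom_parts p = monom p n"
proof
  assume hom: "homogeneous (int n) p"
  have "hom_parts p = (\<Sum>\<mu>\<in>Poly_Mapping.keys p. hom_parts (Poly_Mapping.single \<mu> (Poly_Mapping.lookup p \<mu>)))"
    by (subst (1) tpoly_sum_single) (simp add: hom_parts_simps)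
  also have "\<dots> = (\<Sum>\<mu>\<in>Poly_Mapping.keys p. monom (Poly_Mapping.single \<mu> (Poly_Mapping.lookup p \<mu>)) n)"
  proof (rule sum.cong[OF refl])
    fix \<mu> assume "\<mu> \<in> Poly_Mapping.keys p"
    then have "(\<Sum>i\<in>UNIV. Poly_Mapping.lookup \<mu> i) = n"
      using hom unfolding homogeneous_def of_nat_eq_iff by blast
    then show "hom_parts (Poly_Mapping.single \<mu> (Poly_Mapping.lookup p \<mu>)) =
        monom (Poly_Mapping.single \<mu> (Poly_Mapping.lookup p \<mu>)) n"
      by (simp add: hom_parts_single)
  qed
  also have "\<dots> = monom p n"
    by (subst (3) tpoly_sum_single) (simp add: monom_sum)
  finally show "hom_parts p = monom p n" .
next
  assume eq: "hom_parts p = monom p n"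
  show "homogeneous (int n) p"
    unfolding homogeneous_def of_nat_eq_iff
  proof
    fix \<mu> assume \<mu>: "\<mu> \<in> Poly_Mapping.keys p"
    define k where "k = (\<Sum>i\<in>UNIV. Poly_Mapping.lookup \<mu> i)"
    have "hom_parts p = (\<Sum>\<nu>\<in>Poly_Mapping.keys p. hom_parts (Poly_Mapping.single \<nu> (Poly_Mapping.lookup p \<nu>)))"
      by (subst (1) tpoly_sum_single) (simp add: hom_parts_simps)
    then have "poly.coeff (hom_parts p) k =
        (\<Sum>\<nu>\<in>Poly_Mapping.keys p. poly.coeff (monom (Poly_Mapping.single \<nu> (Poly_Mapping.lookup p \<nu>)) (\<Sum>i\<in>UNIV. Poly_Mapping.lookup \<nu> i)) k)"
      by (simp only: hom_parts_single coeff_sum)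
    then have "Poly_Mapping.lookup (poly.coeff (hom_parts p) k) \<mu> = (\<Sum>\<nu>\<in>Poly_Mapping.keys p. if \<nu> = \<mu> then Poly_Mapping.lookup p \<mu> else 0)"
      by (simp only: lookup_sum) (rule sum.cong, auto simp: k_def lookup_single when_def)
    also have "\<dots> = Poly_Mapping.lookup p \<mu>"
      using \<mu> by simp
    finally have "Poly_Mapping.lookup (poly.coeff (monom p n) k) \<mu> \<noteq> 0"
      using \<mu> eq by (simp add: in_keys_iff)
    then show "(\<Sum>i\<in>UNIV. Poly_Mapping.lookup \<mu> i) = n"
      by (auto simp: k_def split: if_splits)
  qed
qed

lemma poly_hom_parts_1: "poly (hom_parts p) 1 = p"
proof -
  have "is_ring_hom (\<lambda>p. poly (hom_parts p) 1)"
    by (simp add: is_ring_hom_def hom_parts_simps)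
  then show ?thesis
    by (rule ring_hom_tpoly_eqI) (simp_all add: ring_hom_id poly_monom)
qed

section \<open>Calculus of homogeneous forms\<close>

lemma homogeneous_0 [simp]: "homogeneous k 0"
  by (simp add: homogeneous_def)

lemma homogeneous_nat:
  assumes "homogeneous k p" "p \<noteq> 0"
  obtains n where "k = int n"
  using assms unfolding homogeneous_def
  by (metis keys_eq_empty all_not_in_conv)

lemma homogeneous_negative: "homogeneous k p \<Longrightarrow> k < 0 \<Longrightarrow> p = 0"
  by (metis homogeneous_nat of_nat_less_0_iff)

lemma homogeneous_add: "homogeneous k p \<Longrightarrow> homogeneous k q \<Longrightarrow> homogeneous k (p + q)"
  using keys_add[of p q] by (auto simp: homogeneous_def)

lemma homogeneous_sum: "(\<And>i. i \<in> A \<Longrightarrow> homogeneous k (f i)) \<Longrightarrow> homogeneous k (sum f A)"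
  by (induction A rule: infinite_finite_induct) (simp_all add: homogeneous_add)

lemma homogeneous_mult:
  assumes "homogeneous k p" "homogeneous l q"
  shows "homogeneous (k + l) (p * q)"
proof (cases "p = 0 \<or> q = 0")
  case False
  then obtain m n where "k = int m" "l = int n"
    using assms homogeneous_nat by metis
  moreover from this assms have "homogeneous (int (m + n)) (p * q)"
    by (simp only: homogeneous_iff_hom_parts hom_parts_simps mult_monom)
  ultimately show ?thesis by simp
qed auto

lemma homogeneous_Const [simp]: "homogeneous 0 (Const c)"
  by (auto simp: homogeneous_def Const_def)

lemma homogeneous_Var [simp]: "homogeneous 1 (Var i)"
  using homogeneous_iff_hom_parts[of 1 "Var i"] by simp

lemma homogeneous_Const_mult: "homogeneous k p \<Longrightarrow> homogeneous k (Const c * p)"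
  using homogeneous_mult[OF homogeneous_Const] by fastforce

lemma homogeneous_uminus: "homogeneous k p \<Longrightarrow> homogeneous k (- p)"
  by (simp add: homogeneous_def)

lemma homogeneous_diff: "homogeneous k p \<Longrightarrow> homogeneous k q \<Longrightarrow> homogeneous k (p - q)"
  using homogeneous_add[OF _ homogeneous_uminus] by fastforce

lemma homogeneous_power: "homogeneous k p \<Longrightarrow> homogeneous (int n * k) (p ^ n)"
proof (induction n)
  case 0
  then show ?case using homogeneous_Const[of 1] by (simp add: Const_simps)
next
  case (Suc n)
  from homogeneous_mult[OF Suc.prems Suc.IH[OF Suc.prems]] show ?case
    by (simp add: algebra_simps)
qed

lemma homogeneous_hom_part: "homogeneous (int n) (poly.coeff (hom_parts p) n)"
proof (induction p arbitrary: n rule: tpoly_induct)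
  case (Const c)
  then show ?case by (cases n) auto
next
  case (add p q)
  then show ?case by (simp add: hom_parts_simps homogeneous_add)
next
  case (Var i p)
  show ?case
  proof (cases n)
    case 0
    then show ?thesis by (simp add: hom_parts_simps coeff_monom_mult)
  next
    case (Suc k)
    then show ?thesis
      using homogeneous_mult[OF homogeneous_Var[of i] Var[of k]]
      by (simp add: hom_parts_simps coeff_monom_mult)
  qed
qed

lemma homogeneous_degree_unique:
  assumes "homogeneous k p" "homogeneous l p" "p \<noteq> 0"
  shows "k = l"
  using assms unfolding homogeneous_def by (metis keys_eq_empty all_not_in_conv)

text \<open>Both degrees become exponents of t: \<open>h\<close> t^m divides \<open>h * p\<close>
  t^n and can be cancelled. As \<open>k\<close> is an integer, the inequality m <= n has to be
  derived; if it failed, the coefficient of t^n in a multiple of t^m would vanish, and with it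
  \<open>h * p\<close>.\<close>

lemma homogeneous_cofactor:
  assumes "homogeneous e h" "h \<noteq> 0" "homogeneous (e + k) (h * p)"
  shows "homogeneous k p"
proof (cases "p = 0")
  case False
  obtain m n where m: "e = int m" and n: "e + k = int n"
    using homogeneous_nat assms False by (metis mult_eq_0_iff)
  have eq: "monom h m * hom_parts p = monom (h * p) n"
    using assms m n by (simp add: homogeneous_iff_hom_parts hom_parts_simps flip: homogeneous_iff_hom_parts)
       (metis homogeneous_iff_hom_parts hom_parts_simps(4))
  have "m \<le> n"
  proof (rule ccontr)
    assume "\<not> m \<le> n"
    then have "poly.coeff (monom h m * hom_parts p) n = 0"
      by (simp add: coeff_monom_mult)
    with eq have "h * p = 0" by simp
    with assms False show False by simp
  qed
  then have "monom h m * hom_parts p = monom h m * monom p (n - m)"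
    using eq by (simp add: mult_monom)
  then have "hom_parts p = monom p (n - m)"
    using assms(2) by (simp add: mult_cancel_left)
  moreover have "k = int (n - m)"
    using m n \<open>m \<le> n\<close> by simp
  ultimately show ?thesis
    by (simp add: homogeneous_iff_hom_parts)
qed auto

lemma homogeneous_0_imp_Const:
  assumes "homogeneous 0 p"
  obtains c where "p = Const c"
proof -
  have "Poly_Mapping.keys p \<subseteq> {0}"
  proof
    fix \<mu> assume "\<mu> \<in> Poly_Mapping.keys p"
    then have "(\<Sum>i\<in>UNIV. Poly_Mapping.lookup \<mu> i) = 0"
      using assms unfolding homogeneous_def of_nat_eq_0_iff by blast
    then have "\<mu> = 0"
      by (intro poly_mapping_eqI) simp
    then show "\<mu> \<in> {0}" by simp
  qed
  then have "p = Const (Poly_Mapping.lookup p 0)"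
    by (intro poly_mapping_eqI) (auto simp: Const_def lookup_single when_def in_keys_iff)
  then show ?thesis by (rule that)
qed

lemma homogeneous_scale:
  assumes "homogeneous (int n) p"
  shows "eval p (c *s v) = c ^ n * eval p v"
proof -
  have "eval (Poly_Mapping.single \<mu> a) (c *s v) =
      c ^ (\<Sum>i\<in>UNIV. Poly_Mapping.lookup \<mu> i) * eval (Poly_Mapping.single \<mu> a) v" for \<mu> a
    by (simp add: eval_conv_tsubst tsubst_single[OF ring_hom_id] power_mult_distrib prod.distrib power_sum)
  moreover have "(\<Sum>i\<in>UNIV. Poly_Mapping.lookup \<mu> i) = n" if "\<mu> \<in> Poly_Mapping.keys p" for \<mu>
    using assms that unfolding homogeneous_def of_nat_eq_iff by blast
  ultimately have "(\<Sum>\<mu>\<in>Poly_Mapping.keys p. eval (Poly_Mapping.single \<mu> (Poly_Mapping.lookup p \<mu>)) (c *s v)) =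
      c ^ n * (\<Sum>\<mu>\<in>Poly_Mapping.keys p. eval (Poly_Mapping.single \<mu> (Poly_Mapping.lookup p \<mu>)) v)"
    by (simp add: sum_distrib_left)
  then show ?thesis
    unfolding eval_simps(8)[symmetric] tpoly_sum_single[symmetric] .
qed

section \<open>Derivatives and unique factorization\<close>

lemma pderivative_superset:
  assumes "finite K" "Poly_Mapping.keys p \<subseteq> K"
  shows "pderivative i p = (\<Sum>\<mu>\<in>K. Poly_Mapping.single (\<mu> - Poly_Mapping.single i 1)
    (of_nat (Poly_Mapping.lookup \<mu> i) * Poly_Mapping.lookup p \<mu>))"
  unfolding pderivative_def using assms
  by (intro sum.mono_neutral_left) (auto simp: in_keys_iff)

lemma pderivative_add: "pderivative i (p + q) = pderivative i p + pderivative i q"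
proof -
  define K where "K = Poly_Mapping.keys p \<union> Poly_Mapping.keys q"
  have K: "finite K" "Poly_Mapping.keys p \<subseteq> K" "Poly_Mapping.keys q \<subseteq> K" "Poly_Mapping.keys (p + q) \<subseteq> K"
    using keys_add[of p q] by (auto simp: K_def)
  show ?thesis
    using K by (simp add: pderivative_superset[of K] lookup_add distrib_left single_add sum.distrib)
qed

lemma pderivative_zero [simp]: "pderivative i 0 = 0"
  by (simp add: pderivative_def)

lemma pderivative_single:
  "pderivative i (Poly_Mapping.single \<mu> c) =
     Poly_Mapping.single (\<mu> - Poly_Mapping.single i 1) (of_nat (Poly_Mapping.lookup \<mu> i) * c)"
  by (simp add: pderivative_superset[of "{\<mu>}"])

lemma pderivative_Const [simp]: "pderivative i (Const c) = 0"
  by (simp add: Const_def pderivative_single)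

lemma pderivative_Var_mult:
  "pderivative i (Var j * p) = (if i = j then p else 0) + Var j * pderivative i p"
proof (induction p rule: single_induct)
  case zero
  then show ?case by simp
next
  case (add p q)
  then show ?case by (simp add: distrib_left pderivative_add)
next
  case (single \<mu> c)
  define \<nu> where "\<nu> = \<mu> + Poly_Mapping.single j 1"
  have lhs: "pderivative i (Var j * Poly_Mapping.single \<mu> c) =
      Poly_Mapping.single (\<nu> - Poly_Mapping.single i 1) (of_nat (Poly_Mapping.lookup \<nu> i) * c)"
    by (simp add: \<nu>_def pderivative_single flip: single_Suc_exponent)
  have rhs: "Var j * pderivative i (Poly_Mapping.single \<mu> c) =
      Poly_Mapping.single (\<mu> - Poly_Mapping.single i 1 + Poly_Mapping.single j 1) (of_nat (Poly_Mapping.lookup \<mu> i) * c)"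
    by (simp add: pderivative_single flip: single_Suc_exponent)
  show ?case
  proof (cases "Poly_Mapping.lookup \<mu> i = 0")
    case True
    then have [simp]: "\<nu> - Poly_Mapping.single i 1 = \<mu>" if "i = j"
      using that by (intro poly_mapping_eqI) (auto simp: \<nu>_def lookup_add lookup_minus)
    show ?thesis
      using True unfolding lhs rhs by (auto simp: \<nu>_def lookup_add lookup_single)
  next
    case False
    then have "\<nu> - Poly_Mapping.single i 1 = \<mu> - Poly_Mapping.single i 1 + Poly_Mapping.single j 1"
      by (intro poly_mapping_eqI) (auto simp: \<nu>_def lookup_add lookup_minus lookup_single when_def)
    moreover have "\<nu> - Poly_Mapping.single i 1 = \<mu>" if "i = j"
      using that by (intro poly_mapping_eqI) (auto simp: \<nu>_def lookup_add lookup_minus)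
    ultimately show ?thesis
      unfolding lhs rhs
      by (auto simp: \<nu>_def lookup_add lookup_single algebra_simps simp flip: single_add)
  qed
qed

lemma pderivative_mult: "pderivative i (p * q) = pderivative i p * q + p * pderivative i q"
proof (induction p rule: tpoly_induct)
  case (Const c)
  show ?case
  proof (induction q rule: tpoly_induct)
    case (Const d)
    then show ?case by (simp flip: Const_simps)
  next
    case (add p q)
    then show ?case by (simp add: distrib_left pderivative_add)
  next
    case (Var j p)
    have "pderivative i (Const c * (Var j * p)) = pderivative i (Var j * (Const c * p))"
      by (simp add: ac_simps)
    also have "\<dots> = (if i = j then Const c * p else 0) + Var j * (pderivative i (Const c) * p + Const c * pderivative i p)"
      by (simp only: pderivative_Var_mult Var)
    finally show ?case
      unfolding pderivative_Var_mult pderivative_Const by (auto simp: algebra_simps)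
  qed
next
  case (add p q)
  then show ?case by (simp add: distrib_right pderivative_add)
next
  case (Var j p)
  show ?case
    unfolding mult.assoc pderivative_Var_mult Var by (simp add: algebra_simps)
qed

lemma pderivative_Var: "pderivative i (Var j) = (if i = j then 1 else 0)"
  using pderivative_Var_mult[of i j 1] pderivative_Const[of i 1] by (simp add: Const_simps)

lemma pderivative_Const_mult: "pderivative i (Const c * p) = Const c * pderivative i p"
  by (simp add: pderivative_mult)

lemma pderivative_uminus: "pderivative i (- p) = - pderivative i p"
  using pderivative_Const_mult[of i "- 1" p] by (simp add: Const_simps)

lemma pderivative_diff: "pderivative i (p - q) = pderivative i p - pderivative i q"
  using pderivative_add[of i p "- q"] by (simp add: pderivative_uminus)

lemma pderivative_sum: "pderivative i (sum f A) = (\<Sum>x\<in>A. pderivative i (f x))"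
  by (induction A rule: infinite_finite_induct) (simp_all add: pderivative_add)

lemma pderivative_commute: "pderivative i (pderivative j p) = pderivative j (pderivative i p)"
  by (induction p rule: tpoly_induct)
    (auto simp: pderivative_add pderivative_Var_mult)

lemma hom_part_pderivative:
  "poly.coeff (hom_parts (pderivative i p)) n = pderivative i (poly.coeff (hom_parts p) (Suc n))"
proof (induction p arbitrary: n rule: tpoly_induct)
  case (Const c)
  then show ?case by (simp add: hom_parts_simps)
next
  case (add p q)
  then show ?case by (simp add: hom_parts_simps pderivative_add)
next
  case (Var j p)
  have "n = 0 \<Longrightarrow> pderivative i (poly.coeff (hom_parts p) 0) = 0"
    using homogeneous_hom_part[of 0 p] by (auto elim: homogeneous_0_imp_Const)
  with Var show ?case
    by (cases n) (auto simp: hom_parts_simps pderivative_Var_mult coeff_monom_mult pderivative_add)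
qed

lemma homogeneous_pderivative:
  assumes "homogeneous (int n) p"
  shows "homogeneous (int n - 1) (pderivative i p)"
proof (cases n)
  case 0
  then show ?thesis using assms by (auto elim: homogeneous_0_imp_Const)
next
  case (Suc k)
  have "hom_parts p = monom p (Suc k)"
    using assms unfolding Suc by (simp only: homogeneous_iff_hom_parts)
  then have "poly.coeff (hom_parts (pderivative i p)) j = poly.coeff (monom (pderivative i p) k) j" for j
    by (simp add: hom_part_pderivative)
  then have "hom_parts (pderivative i p) = monom (pderivative i p) k"
    by (intro poly_eqI)
  then show ?thesis using Suc by (simp add: homogeneous_iff_hom_parts[symmetric])
qed

lemma euler:
  assumes "homogeneous (int n) p"
  shows "(\<Sum>i\<in>UNIV. Var i * pderivative i p) = of_nat n * p"
proof -
  have *: "(\<Sum>i\<in>UNIV. Var i * pderivative i (Poly_Mapping.single \<mu> c)) =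
      of_nat (\<Sum>i\<in>UNIV. Poly_Mapping.lookup \<mu> i) * Poly_Mapping.single \<mu> c" for \<mu> c
  proof -
    have "Var i * pderivative i (Poly_Mapping.single \<mu> c) =
        of_nat (Poly_Mapping.lookup \<mu> i) * Poly_Mapping.single \<mu> c" for i
    proof (cases "Poly_Mapping.lookup \<mu> i = 0")
      case False
      then have "\<mu> - Poly_Mapping.single i 1 + Poly_Mapping.single i 1 = \<mu>"
        by (intro poly_mapping_eqI) (auto simp: lookup_add lookup_minus lookup_single when_def)
      then show ?thesis
        by (simp add: pderivative_single mult_single flip: single_Suc_exponent single_of_nat)
    qed (simp add: pderivative_single)
    then show ?thesis by (simp add: sum_distrib_right)
  qed
  have "(\<Sum>i\<in>UNIV. Var i * pderivative i p) =
      (\<Sum>\<mu>\<in>Poly_Mapping.keys p. \<Sum>i\<in>UNIV. Var i * pderivative i (Poly_Mapping.single \<mu> (Poly_Mapping.lookup p \<mu>)))"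
    by (subst (1) tpoly_sum_single, subst sum.swap) (simp add: pderivative_sum sum_distrib_left)
  also have "\<dots> = (\<Sum>\<mu>\<in>Poly_Mapping.keys p. of_nat n * Poly_Mapping.single \<mu> (Poly_Mapping.lookup p \<mu>))"
    using assms unfolding * homogeneous_def of_nat_eq_iff by (intro sum.cong) simp_all
  also have "\<dots> = of_nat n * p"
    by (subst (3) tpoly_sum_single) (simp add: sum_distrib_left)
  finally show ?thesis .
qed

lemma of_nat_eq_Const: "of_nat n = Const (of_nat n)"
  by (induction n) (simp_all add: Const_simps)

lemma eval_of_nat [simp]: "eval (of_nat n) v = of_nat n"
  by (simp add: of_nat_eq_Const)

lemma euler_eval:
  assumes "homogeneous (int n) p"
  shows "(\<Sum>i\<in>UNIV. v $ i * eval (pderivative i p) v) = of_nat n * eval p v"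
  using arg_cong[OF euler[OF assms], of "\<lambda>p. eval p v"] by simp

section \<open>Total degree and units\<close>

definition tdeg :: "tpoly \<Rightarrow> nat" where
  "tdeg p = degree (hom_parts p)"

lemma hom_parts_eq_0_iff [simp]: "hom_parts p = 0 \<longleftrightarrow> p = 0"
  by (metis poly_hom_parts_1 poly_0 hom_parts_simps(2))

lemma tdeg_mult: "p \<noteq> 0 \<Longrightarrow> q \<noteq> 0 \<Longrightarrow> tdeg (p * q) = tdeg p + tdeg q"
  by (simp add: tdeg_def hom_parts_simps degree_mult_eq)

lemma tdeg_homogeneous: "homogeneous (int n) p \<Longrightarrow> p \<noteq> 0 \<Longrightarrow> tdeg p = n"
  by (simp add: tdeg_def homogeneous_iff_hom_parts degree_monom_eq)

lemma tdeg_eq_0_imp_Const: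
  assumes "tdeg p = 0"
  obtains c where "p = Const c"
proof -
  from assms obtain q where "hom_parts p = [:q:]"
    unfolding tdeg_def by (rule degree_eq_zeroE)
  then have "hom_parts p = monom p 0"
    using poly_hom_parts_1[of p] by (simp add: monom_0)
  then have "homogeneous 0 p"
    using homogeneous_iff_hom_parts[of 0 p] by simp
  then show ?thesis by (elim homogeneous_0_imp_Const that)
qed

lemma Const_dvd_1: "c \<noteq> 0 \<Longrightarrow> Const c dvd 1"
  by (metis Const_simps(1,4) dvd_triv_left right_inverse)

lemma is_unit_tpoly_iff: "p dvd 1 \<longleftrightarrow> (\<exists>c. c \<noteq> 0 \<and> p = Const c)" for p :: tpoly
proof
  assume "p dvd 1"
  then obtain q where q: "1 = p * q" ..
  then have "p \<noteq> 0" "q \<noteq> 0" by auto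
  then have "tdeg p + tdeg q = tdeg 1"
    using tdeg_mult q by metis
  also have "\<dots> = 0" by (simp add: tdeg_def hom_parts_simps)
  finally show "\<exists>c. c \<noteq> 0 \<and> p = Const c"
    using \<open>p \<noteq> 0\<close> by (metis add_is_0 tdeg_eq_0_imp_Const Const_eq_0_iff)
qed (auto simp: Const_dvd_1)

text \<open>Euler's identity for the part of degree n + 1 has zero left side, and n + 1 is
  invertible in characteristic zero; only the constant part survives.\<close>

lemma pderivatives_zero_imp_Const:
  assumes "\<And>i. pderivative i p = 0"
  obtains c where "p = Const c"
proof -
  have "poly.coeff (hom_parts p) (Suc n) = 0" for n
  proof -
    have "of_nat (Suc n) * poly.coeff (hom_parts p) (Suc n) = 0"
      using euler[OF homogeneous_hom_part[of "Suc n" p]] assms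
      by (simp flip: hom_part_pderivative add: hom_parts_simps)
    then show ?thesis by (simp only: mult_eq_0_iff of_nat_eq_Const) (simp del: of_nat_Suc)
  qed
  then have "tdeg p = 0"
    unfolding tdeg_def by (metis degree_0 leading_coeff_0_iff not0_implies_Suc)
  then show ?thesis by (elim tdeg_eq_0_imp_Const that)
qed

text \<open>Differentiation strictly lowers the total degree, whereas a nonzero multiple of
  \<open>p\<close> has at least the degree of \<open>p\<close>.\<close>

lemma dvd_pderivative_imp_zero:
  assumes "p dvd pderivative i p"
  shows "pderivative i p = 0"
proof (rule ccontr)
  assume nz: "pderivative i p \<noteq> 0"
  then obtain q where q: "pderivative i p = p * q" "p \<noteq> 0" "q \<noteq> 0"
    using assms by (auto elim!: dvdE)
  have "poly.coeff (hom_parts (pderivative i p)) (tdeg (pderivative i p)) \<noteq> 0"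
    using nz by (simp add: tdeg_def)
  then have "poly.coeff (hom_parts p) (Suc (tdeg (pderivative i p))) \<noteq> 0"
    by (auto simp: hom_part_pderivative)
  then have "Suc (tdeg (pderivative i p)) \<le> tdeg p"
    unfolding tdeg_def by (rule le_degree)
  with tdeg_mult[OF q(2,3)] q(1) show False by simp
qed

section \<open>Factoriality through iterated univariate polynomials\<close>

definition extend_hom :: "('a \<Rightarrow> 'b) \<Rightarrow> 'b \<Rightarrow> 'a::comm_ring_1 poly \<Rightarrow> 'b::comm_ring_1" where
  "extend_hom h x p = poly (map_poly h p) x"

context
  fixes h :: "'a::comm_ring_1 \<Rightarrow> 'b::comm_ring_1" and x :: 'b
  assumes h: "is_ring_hom h"
begin

lemma extend_hom_pCons [simp]: "extend_hom h x (pCons a p) = h a + x * extend_hom h x p"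
  by (cases "a = 0 \<and> p = 0") (auto simp: extend_hom_def map_poly_pCons ring_hom_zero[OF h])

lemma extend_hom_0 [simp]: "extend_hom h x 0 = 0"
  by (simp add: extend_hom_def)

lemma extend_hom_add: "extend_hom h x (p + q) = extend_hom h x p + extend_hom h x q"
  by (induction p q rule: poly_induct2) (simp_all add: ring_hom_add[OF h] algebra_simps)

lemma extend_hom_smult: "extend_hom h x (smult a p) = h a * extend_hom h x p"
  by (induction p) (simp_all add: ring_hom_mult[OF h] algebra_simps)

lemma extend_hom_mult: "extend_hom h x (p * q) = extend_hom h x p * extend_hom h x q"
  by (induction p)
    (simp_all add: extend_hom_add extend_hom_smult ring_hom_zero[OF h] algebra_simps)

lemma ring_hom_extend_hom: "is_ring_hom (extend_hom h x)"
  by (simp add: is_ring_hom_def extend_hom_add extend_hom_mult one_pCons ring_hom_one[OF h])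

end

text \<open>
  The isomorphism with the iterated polynomial ring, through which the library's
  factoriality of polynomial rings becomes available.
\<close>

definition to_iterated :: "tpoly \<Rightarrow> complex poly poly poly" where
  "to_iterated = tsubst (\<lambda>c. [:[:[:c:]:]:])
     (\<lambda>i. if i = 1 then [:[:[:0, 1:]:]:] else if i = 2 then [:[:0, 1:]:] else [:0, 1:])"

definition of_iterated :: "complex poly poly poly \<Rightarrow> tpoly" where
  "of_iterated = extend_hom (extend_hom (extend_hom Const (Var 1)) (Var 2)) (Var 3)"

lemma ring_hom_pConst: "is_ring_hom (\<lambda>c::'a::comm_ring_1. [:c:])"
  by (simp add: is_ring_hom_def one_pCons)

lemma ring_hom_iterated_const: "is_ring_hom (\<lambda>c. [:[:[:c::complex:]:]:])"
  by (intro ring_hom_comp[OF ring_hom_pConst] ring_hom_pConst)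

lemma ring_hom_to_iterated: "is_ring_hom to_iterated"
  unfolding to_iterated_def by (rule ring_hom_tsubst[OF ring_hom_iterated_const])

lemma ring_hom_of_iterated: "is_ring_hom of_iterated"
  unfolding of_iterated_def by (intro ring_hom_extend_hom ring_hom_Const)

lemma to_iterated_Const: "to_iterated (Const c) = [:[:[:c:]:]:]"
  and to_iterated_Var: "to_iterated (Var i) =
    (if i = 1 then [:[:[:0, 1:]:]:] else if i = 2 then [:[:0, 1:]:] else [:0, 1:])"
  by (simp_all add: to_iterated_def ring_hom_iterated_const)

lemma of_to_iterated: "of_iterated (to_iterated p) = p"
proof (rule ring_hom_tpoly_eqI[OF ring_hom_comp[OF ring_hom_of_iterated ring_hom_to_iterated] ring_hom_id])
  have e1: "is_ring_hom (extend_hom Const (Var 1))"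
    and e2: "is_ring_hom (extend_hom (extend_hom Const (Var 1)) (Var 2))"
    by (intro ring_hom_extend_hom ring_hom_Const)+
  show "of_iterated (to_iterated (Const c)) = Const c" for c
    by (simp add: to_iterated_Const of_iterated_def ring_hom_Const e1 e2)
  show "of_iterated (to_iterated (Var i)) = Var i" for i
    using exhaust_3[of i]
    by (auto simp: to_iterated_Var of_iterated_def ring_hom_Const e1 e2 Const_simps
        ring_hom_one[OF e1] ring_hom_one[OF e2])
qed

lemma to_of_iterated: "to_iterated (of_iterated p) = p"
proof -
  note h = ring_hom_add[OF ring_hom_to_iterated] ring_hom_mult[OF ring_hom_to_iterated]
    ring_hom_zero[OF ring_hom_to_iterated]
  have e1: "is_ring_hom (extend_hom Const (Var 1))"
    and e2: "is_ring_hom (extend_hom (extend_hom Const (Var 1)) (Var 2))"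
    by (intro ring_hom_extend_hom ring_hom_Const)+
  have 1: "to_iterated (extend_hom Const (Var 1) r) = [:[:r:]:]" for r
    by (induction r) (simp_all add: h ring_hom_Const to_iterated_Const to_iterated_Var)
  have 2: "to_iterated (extend_hom (extend_hom Const (Var 1)) (Var 2) r) = [:r:]" for r
    by (induction r) (simp_all add: h e1 1 to_iterated_Var)
  show ?thesis
    unfolding of_iterated_def
    by (induction p) (simp_all add: h e2 2 to_iterated_Var)
qed

lemma to_iterated_eq_0_iff [simp]: "to_iterated p = 0 \<longleftrightarrow> p = 0"
  by (metis of_to_iterated ring_hom_zero[OF ring_hom_to_iterated])

lemma to_iterated_dvd_iff [simp]: "to_iterated p dvd to_iterated q \<longleftrightarrow> p dvd q"
  unfolding dvd_def
  by (metis of_to_iterated to_of_iterated ring_hom_mult[OF ring_hom_to_iterated])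

lemma to_iterated_unit_iff [simp]: "to_iterated p dvd 1 \<longleftrightarrow> p dvd 1"
  by (metis to_iterated_dvd_iff ring_hom_one[OF ring_hom_to_iterated])

lemma prime_elem_to_iterated: "prime_elem (to_iterated p) \<Longrightarrow> prime_elem p"
  unfolding prime_elem_def
  by (metis to_iterated_eq_0_iff to_iterated_dvd_iff to_iterated_unit_iff ring_hom_mult[OF ring_hom_to_iterated])

lemma prime_factor_exists:
  fixes p :: tpoly
  assumes "p \<noteq> 0" "\<not> p dvd 1"
  obtains q where "prime_elem q" "q dvd p"
proof -
  obtain r where r: "prime r" "r dvd to_iterated p"
    using prime_divisor_exists[of "to_iterated p"] assms by auto
  show ?thesis
  proof (rule that)
    show "prime_elem (of_iterated r)"
      using r(1) by (intro prime_elem_to_iterated) (simp add: to_of_iterated)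
    show "of_iterated r dvd p"
      using r(2) by (simp add: to_of_iterated flip: to_iterated_dvd_iff)
  qed
qed

text \<open>The greatest common divisor is formed in the iterated polynomial ring and carried back.
  Coprimality is expressed through prime elements, as this is what the removal of poles
  uses.\<close>

lemma coprime_parts:
  fixes g h :: tpoly
  assumes "h \<noteq> 0"
  obtains e g' h' where "g = e * g'" "h = e * h'" "e \<noteq> 0"
    "\<And>q. prime_elem q \<Longrightarrow> q dvd g' \<Longrightarrow> \<not> q dvd h'"
proof -
  let ?G = "to_iterated g" and ?H = "to_iterated h"
  obtain G H where GH: "?G = G * gcd ?G ?H" "?H = H * gcd ?G ?H" "coprime G H"
    using assms gcd_coprime_exists[of ?G ?H] by auto
  note mult = ring_hom_mult[OF ring_hom_of_iterated]
  show ?thesis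
  proof (rule that)
    show "g = of_iterated (gcd ?G ?H) * of_iterated G"
      using GH(1) by (metis of_to_iterated mult mult.commute)
    show *: "h = of_iterated (gcd ?G ?H) * of_iterated H"
      using GH(2) by (metis of_to_iterated mult mult.commute)
    then show "of_iterated (gcd ?G ?H) \<noteq> 0"
      using assms by auto
    fix q assume q: "prime_elem q" "q dvd of_iterated G"
    show "\<not> q dvd of_iterated H"
    proof
      assume "q dvd of_iterated H"
      with q have "to_iterated q dvd G" "to_iterated q dvd H"
        by (simp_all flip: to_iterated_dvd_iff add: to_of_iterated)
      with GH(3) have "to_iterated q dvd 1"
        by (meson coprime_common_divisor)
      with q(1) show False by (simp add: prime_elem_def)
    qed
  qed
qed

lemma eval_to_iterated:
  "eval p v = poly (poly (poly (to_iterated p) [:[:v $ 3:]:]) [:v $ 2:]) (v $ 1)"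
proof -
  have "is_ring_hom (\<lambda>p. poly (poly (poly (to_iterated p) [:[:v $ 3:]:]) [:v $ 2:]) (v $ 1))"
    using ring_hom_to_iterated by (simp add: is_ring_hom_def)
  then show ?thesis
  proof (rule ring_hom_tpoly_eqI[OF ring_hom_eval])
    show "eval (Const c) v = poly (poly (poly (to_iterated (Const c)) [:[:v $ 3:]:]) [:v $ 2:]) (v $ 1)" for c
      by (simp add: to_iterated_Const)
    show "eval (Var i) v = poly (poly (poly (to_iterated (Var i)) [:[:v $ 3:]:]) [:v $ 2:]) (v $ 1)" for i
      using exhaust_3[of i] by (auto simp: to_iterated_Var)
  qed
qed

section \<open>Polynomials as functions\<close>

lemma poly_nonroot_in_infinite:
  fixes p :: "'a::idom poly"
  assumes "p \<noteq> 0" "infinite A"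
  obtains a where "a \<in> A" "poly p a \<noteq> 0"
  using assms poly_roots_finite[of p] finite_subset[of A "{x. poly p x = 0}"] by blast

lemma eval_nonzero:
  assumes "p \<noteq> 0"
  obtains v where "v \<noteq> 0" "eval p v \<noteq> 0"
proof -
  \<comment> \<open>The factor \<open>Var 1\<close> makes the first coordinate of the point found
    nonzero, so that the point is not the origin.\<close>
  have "to_iterated (Var 1 * p) \<noteq> 0"
    using assms by (simp add: Var_def)
      (metis lookup_single_eq lookup_zero one_neq_zero)
  \<comment> \<open>The variables are specialised from the outermost inwards: z, then y, then x.
    Each time infinitely many constants compete with finitely many roots.\<close>
  then obtain c where c: "poly (to_iterated (Var 1 * p)) [:[:c:]:] \<noteq> 0"
    using poly_nonroot_in_infinite[of _ "range (\<lambda>c. [:[:c:]:])"]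
    by (metis (no_types, lifting) finite_imageD infinite_UNIV_char_0 injI pCons_eq_iff rangeE)
  then obtain b where b: "poly (poly (to_iterated (Var 1 * p)) [:[:c:]:]) [:b:] \<noteq> 0"
    using poly_nonroot_in_infinite[of _ "range (\<lambda>b. [:b:])"]
    by (metis (no_types, lifting) finite_imageD infinite_UNIV_char_0 injI pCons_eq_iff rangeE)
  then obtain a where a: "poly (poly (poly (to_iterated (Var 1 * p)) [:[:c:]:]) [:b:]) a \<noteq> 0"
    using poly_nonroot_in_infinite[of _ UNIV] infinite_UNIV_char_0 by metis
  define v :: "complex ^ 3" where "v = (\<chi> i. if i = 1 then a else if i = 2 then b else c)"
  have "eval (Var 1 * p) v \<noteq> 0"
    using a by (simp add: eval_to_iterated v_def)
  then have "v $ 1 \<noteq> 0" "eval p v \<noteq> 0" by auto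
  moreover from this(1) have "v \<noteq> 0" by (metis zero_index)
  ultimately show ?thesis by (intro that)
qed

lemma tpoly_eqI:
  assumes "\<And>v. v \<noteq> 0 \<Longrightarrow> eval p v = eval q v"
  shows "p = q"
  using eval_nonzero[of "p - q"] assms by auto

section \<open>Nullstellensatz and removable poles\<close>

lemma proj_point_eq_iff:
  assumes "v \<noteq> 0"
  shows "proj_point v = proj_point w \<longleftrightarrow> (\<exists>c. c \<noteq> 0 \<and> w = c *s v)"
proof
  assume "proj_point v = proj_point w"
  moreover have "w \<in> proj_point w"
    unfolding proj_point_def by (auto intro!: exI[of _ 1])
  ultimately show "\<exists>c. c \<noteq> 0 \<and> w = c *s v"
    unfolding proj_point_def by auto
next
  assume "\<exists>c. c \<noteq> 0 \<and> w = c *s v"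
  then obtain c where c: "c \<noteq> 0" "w = c *s v" by auto
  have "\<exists>k. a *s v = k *s w \<and> k \<noteq> 0" if "a \<noteq> 0" for a
    using c that by (intro exI[of _ "a / c"]) (simp add: vector_smult_assoc)
  then show "proj_point v = proj_point w"
    using c by (auto simp: proj_point_def vector_smult_assoc)
qed

lemma self_in_proj_point: "v \<in> proj_point v"
  unfolding proj_point_def by (auto intro!: exI[of _ 1])

lemma P2_memD:
  assumes "P \<in> P2" "v \<in> P"
  shows "v \<noteq> 0" "P = proj_point v"
proof -
  obtain w c where w: "w \<noteq> 0" "P = proj_point w" "v = c *s w" "c \<noteq> 0"
    using assms by (auto simp: P2_def proj_point_def)
  then show "v \<noteq> 0" by (simp add: vec_eq_iff)
  show "P = proj_point v"
    using w proj_point_eq_iff[of w v] by auto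
qed

lemma proj_point_in_P2: "v \<noteq> 0 \<Longrightarrow> proj_point v \<in> P2"
  by (simp add: P2_def)

lemma P2_nonempty_point:
  assumes "P \<in> P2"
  obtains v where "v \<noteq> 0" "P = proj_point v"
  using assms by (auto simp: P2_def)

lemma eval_zero_scale:
  assumes "homogeneous k p" "c \<noteq> 0"
  shows "eval p (c *s v) = 0 \<longleftrightarrow> eval p v = 0"
proof (cases "p = 0")
  case False
  then obtain n where "k = int n"
    using homogeneous_nat[OF assms(1)] by blast
  with assms show ?thesis by (simp add: homogeneous_scale)
qed simp

lemma eval_zero_proj_point:
  assumes "homogeneous k p" "w \<in> proj_point v"
  shows "eval p w = 0 \<longleftrightarrow> eval p v = 0"
  using assms by (auto simp: proj_point_def eval_zero_scale)

section \<open>Ideals and their common zeros\<close>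

definition poly_ideal :: "tpoly set \<Rightarrow> bool" where
  "poly_ideal A \<longleftrightarrow> 0 \<in> A \<and> (\<forall>a\<in>A. \<forall>b\<in>A. a + b \<in> A) \<and> (\<forall>a\<in>A. \<forall>s. s * a \<in> A)"

lemma ideal_zero: "poly_ideal A \<Longrightarrow> 0 \<in> A"
  and ideal_add: "poly_ideal A \<Longrightarrow> a \<in> A \<Longrightarrow> b \<in> A \<Longrightarrow> a + b \<in> A"
  and ideal_mult: "poly_ideal A \<Longrightarrow> a \<in> A \<Longrightarrow> s * a \<in> A"
  by (simp_all add: poly_ideal_def)

lemma ideal_uminus: "poly_ideal A \<Longrightarrow> a \<in> A \<Longrightarrow> - a \<in> A"
  using ideal_mult[of A a "- 1"] by simp

lemma ideal_diff: "poly_ideal A \<Longrightarrow> a \<in> A \<Longrightarrow> b \<in> A \<Longrightarrow> a - b \<in> A"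
  using ideal_add[of A a "- b"] ideal_uminus[of A b] by simp

lemma ideal_sum: "poly_ideal A \<Longrightarrow> (\<And>i. i \<in> I \<Longrightarrow> f i \<in> A) \<Longrightarrow> sum f I \<in> A"
  by (induction I rule: infinite_finite_induct) (simp_all add: ideal_zero ideal_add)

lemma ideal_unit: "poly_ideal A \<Longrightarrow> Const c \<in> A \<Longrightarrow> c \<noteq> 0 \<Longrightarrow> 1 \<in> A"
  using ideal_mult[of A "Const c" "Const (1 / c)"] by (simp flip: Const_simps)

definition ideal_adjoin :: "tpoly set \<Rightarrow> tpoly \<Rightarrow> tpoly set" where
  "ideal_adjoin A p = {a + b * p | a b. a \<in> A}"

lemma ideal_adjoin:
  assumes "poly_ideal A"
  shows "poly_ideal (ideal_adjoin A p)" "A \<subseteq> ideal_adjoin A p" "p \<in> ideal_adjoin A p"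
proof -
  show "A \<subseteq> ideal_adjoin A p"
    by (auto simp: ideal_adjoin_def) (metis add_0_right mult_zero_left)
  show "p \<in> ideal_adjoin A p"
    using ideal_zero[OF assms] by (auto simp: ideal_adjoin_def) (metis add_0 mult_1)
  have "\<exists>a b. a0 + b0 * p + (a1 + b1 * p) = a + b * p \<and> a \<in> A" if "a0 \<in> A" "a1 \<in> A" for a0 a1 b0 b1
    using that ideal_add[OF assms] by (intro exI[of _ "a0 + a1"] exI[of _ "b0 + b1"]) (simp add: algebra_simps)
  moreover have "\<exists>a b. s * (a0 + b0 * p) = a + b * p \<and> a \<in> A" if "a0 \<in> A" for a0 b0 s
    using that ideal_mult[OF assms] by (intro exI[of _ "s * a0"] exI[of _ "s * b0"]) (simp add: algebra_simps)
  moreover have "\<exists>a b. 0 = a + b * p \<and> a \<in> A"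
    using ideal_zero[OF assms] by (intro exI[of _ 0]) simp
  ultimately show "poly_ideal (ideal_adjoin A p)"
    unfolding poly_ideal_def ideal_adjoin_def by blast
qed

text \<open>Modulo \<open>A\<close> both sides are homomorphisms with the same values on the
  variables. Constant \<open>y i\<close> give the value at a point; \<open>y i\<close> proportional
  to one variable give the restriction to a line through the origin.\<close>

lemma ideal_tsubst_cong:
  assumes "poly_ideal A" "\<And>i. Var i - y i \<in> A"
  shows "p - tsubst Const y p \<in> A"
proof (induction p rule: tpoly_induct)
  case (Const c)
  then show ?case by (simp add: ring_hom_Const ideal_zero assms)
next
  case (add p q)
  then have "(p - tsubst Const y p) + (q - tsubst Const y q) \<in> A"
    by (rule ideal_add[OF assms(1)])
  then show ?case by (simp add: tsubst_add ring_hom_Const algebra_simps)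
next
  case (Var i p)
  have "p * (Var i - y i) + y i * (p - tsubst Const y p) \<in> A"
    by (intro ideal_add ideal_mult assms Var)
  then show ?case by (simp add: tsubst_mult ring_hom_Const algebra_simps)
qed

lemma tsubst_Const_eval: "tsubst Const (\<lambda>i. Const (v $ i)) p = Const (eval p v)"
  by (rule ring_hom_tpoly_eqI)
    (simp_all add: ring_hom_tsubst ring_hom_comp[OF ring_hom_Const ring_hom_eval] ring_hom_Const)

text \<open>Over the complex numbers \<open>q\<close> splits into linear factors. Each is invertible
  modulo \<open>A\<close>, with inverse \<open>b z\<close>, so the factors can be removed one by one
  until a nonzero constant is left in \<open>A\<close>.\<close>

lemma univariate_in_ideal:
  assumes A: "poly_ideal A" and b: "\<And>z. 1 - b z * (Var i - Const z) \<in> A"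
    and "q \<noteq> 0" "extend_hom Const (Var i) q \<in> A"
  shows "1 \<in> A"
  using assms(3,4)
proof (induction "degree q" arbitrary: q)
  case 0
  then obtain c where "q = [:c:]" "c \<noteq> 0"
    by (metis degree_eq_zeroE pCons_eq_0_iff)
  with 0 show ?case
    using ideal_unit[OF A, of c] by (simp add: ring_hom_Const)
next
  case (Suc n)
  then obtain z where "poly q z = 0"
    using fundamental_theorem_of_algebra_alt[of q] by (metis degree_pCons_0 nat.distinct(1))
  then obtain r where r: "q = [:- z, 1:] * r"
    by (auto simp: poly_eq_0_iff_dvd)
  let ?h = "extend_hom Const (Var i)"
  have hq: "?h q = (Var i - Const z) * ?h r"
    unfolding r extend_hom_mult[OF ring_hom_Const] by (simp add: ring_hom_Const Const_simps)
  have "?h r = ?h r * (1 - b z * (Var i - Const z)) + b z * ?h q"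
    unfolding hq by (simp add: algebra_simps)
  also have "\<dots> \<in> A"
    by (intro ideal_add ideal_mult A b Suc)
  finally have "?h r \<in> A" .
  moreover have "r \<noteq> 0"
    using Suc r by auto
  moreover from this have "degree q = Suc (degree r)"
    unfolding r by (subst degree_mult_eq) auto
  then have "degree r = n"
    using Suc(2) by simp
  ultimately show ?case using Suc(1) by metis
qed

text \<open>
  The usual argument over an uncountable field: if all \<open>x - z\<close> were invertible modulo \<open>A\<close>, their
  inverses would be linearly dependent, and a linear relation yields a univariate polynomial in \<open>A\<close>.
\<close>

lemma ideal_adjoin_proper:
  assumes A: "poly_ideal A" and "1 \<notin> A"
  obtains z where "1 \<notin> ideal_adjoin A (Var i - Const z)"
proof (rule ccontr)
  assume "\<not> thesis"
  with that have "\<forall>z. \<exists>b. 1 - b * (Var i - Const z) \<in> A"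
    by (auto simp: ideal_adjoin_def) (metis add_diff_cancel_right')
  then obtain b where b: "\<And>z. 1 - b z * (Var i - Const z) \<in> A"
    by metis
  \<comment> \<open>A common inverse of x - z and x - w gives \<open>b z * Const (z - w)\<close> in
    \<open>A\<close>, hence \<open>b z\<close> and then 1 in \<open>A\<close>.\<close>
  have "inj b"
  proof (rule injI, rule ccontr)
    fix z w assume eq: "b z = b w" and "z \<noteq> w"
    have "(1 - b z * (Var i - Const z)) - (1 - b w * (Var i - Const w)) \<in> A"
      by (intro ideal_diff A b)
    then have "b z * Const (z - w) \<in> A"
      using eq by (simp add: Const_simps algebra_simps)
    then have "Const (1 / (z - w)) * (b z * Const (z - w)) \<in> A"
      by (rule ideal_mult[OF A])
    moreover have "Const (1 / (z - w)) * (b z * Const (z - w)) = b z * Const (1 / (z - w) * (z - w))"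
      by (simp only: Const_simps ac_simps)
    ultimately have "b z \<in> A"
      using \<open>z \<noteq> w\<close> by (simp add: Const_simps(1))
    then have "(1 - b z * (Var i - Const z)) + (Var i - Const z) * b z \<in> A"
      by (intro ideal_add ideal_mult A b)
    with \<open>1 \<notin> A\<close> show False by (simp add: algebra_simps)
  qed
  \<comment> \<open>There are countably many finite supports but uncountably many z. So infinitely
    many of the distinct \<open>b z\<close> lie in the span of the finitely many monomials of one
    support \<open>K\<close>.\<close>
  have "countable (UNIV :: (3 \<Rightarrow>\<^sub>0 nat) set)"
  proof (rule countableI')
    show "inj (\<lambda>\<mu> :: 3 \<Rightarrow>\<^sub>0 nat. to_nat (Poly_Mapping.lookup \<mu>))"
      by (auto intro!: injI poly_mapping_eqI)
  qed
  then have "countable {K :: (3 \<Rightarrow>\<^sub>0 nat) set. finite K}"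
    using countable_Collect_finite_subset[of UNIV] by simp
  moreover have "z \<in> (\<Union>K\<in>{K. finite K}. {z. Poly_Mapping.keys (b z) = K})" for z
    by (rule UN_I[of "Poly_Mapping.keys (b z)"]) simp_all
  then have "UNIV = (\<Union>K\<in>{K. finite K}. {z. Poly_Mapping.keys (b z) = K})"
    by blast
  ultimately obtain K where K: "finite K" "infinite {z. Poly_Mapping.keys (b z) = K}"
    using uncountable_UNIV_complex
    by (metis (no_types, lifting) countable_UN countable_finite mem_Collect_eq)
  define Z where "Z = {z. Poly_Mapping.keys (b z) = K}"
  interpret vs: vector_space "\<lambda>c (p :: tpoly). Const c * p"
    by unfold_locales (simp_all add: Const_simps algebra_simps)
  have "b z \<in> vs.span ((\<lambda>\<mu>. Poly_Mapping.single \<mu> 1) ` K)" if "z \<in> Z" for z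
  proof -
    have "b z = (\<Sum>\<mu>\<in>K. Const (Poly_Mapping.lookup (b z) \<mu>) * Poly_Mapping.single \<mu> 1)"
      using that by (subst tpoly_sum_single) (simp add: Z_def Const_mult_single)
    also have "\<dots> \<in> vs.span ((\<lambda>\<mu>. Poly_Mapping.single \<mu> 1) ` K)"
      by (intro vs.span_sum vs.span_scale vs.span_base) auto
    finally show ?thesis .
  qed
  then have "b ` Z \<subseteq> vs.span ((\<lambda>\<mu>. Poly_Mapping.single \<mu> 1) ` K)"
    by auto
  moreover have "infinite (b ` Z)"
    using K(2) \<open>inj b\<close> by (simp add: Z_def finite_image_iff inj_on_subset)
  ultimately have "vs.dependent (b ` Z)"
    using vs.independent_span_bound[of "(\<lambda>\<mu>. Poly_Mapping.single \<mu> 1) ` K" "b ` Z"] K(1) by blast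
  then obtain t u where t: "finite t" "t \<subseteq> b ` Z" "(\<Sum>v\<in>t. Const (u v) * v) = 0" "\<exists>v\<in>t. u v \<noteq> 0"
    unfolding vs.dependent_explicit by auto
  then obtain T where T: "t = b ` T" "finite T"
    by (meson finite_subset_image)
  define c where "c = (\<lambda>z. u (b z))"
  have rel: "(\<Sum>z\<in>T. Const (c z) * b z) = 0"
    using t(3) \<open>inj b\<close> by (simp add: T(1) sum.reindex inj_on_subset c_def)
  obtain w where w: "w \<in> T" "c w \<noteq> 0"
    using t(4) by (auto simp: T(1) c_def)
  \<comment> \<open>The linear relation between the inverses of the x - z, multiplied by their
    common denominator.\<close>
  define q where "q = (\<Sum>z\<in>T. smult (c z) (\<Prod>y\<in>T - {z}. [:- y, 1:]))"
  let ?h = "extend_hom Const (Var i)"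
  have h: "is_ring_hom ?h"
    by (intro ring_hom_extend_hom ring_hom_Const)
  have prod: "(\<Prod>y\<in>T. Var i - Const y) = (Var i - Const z) * (\<Prod>y\<in>T - {z}. Var i - Const y)" if "z \<in> T" for z
    using T(2) that by (simp add: prod.remove)
  have "?h q = (\<Sum>z\<in>T. Const (c z) * (\<Prod>y\<in>T - {z}. Var i - Const y))"
    by (simp add: q_def ring_hom_sum[OF h] extend_hom_smult ring_hom_Const ring_hom_prod[OF h] Const_simps)
  also have "\<dots> = (\<Sum>z\<in>T. Const (c z) * (\<Prod>y\<in>T - {z}. Var i - Const y)) - (\<Sum>z\<in>T. Const (c z) * b z) * (\<Prod>y\<in>T. Var i - Const y)"
    by (simp add: rel)
  also have "\<dots> = (\<Sum>z\<in>T. (Const (c z) * (\<Prod>y\<in>T - {z}. Var i - Const y)) * (1 - b z * (Var i - Const z)))"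
    unfolding sum_distrib_right sum_subtractf[symmetric]
    by (intro sum.cong refl) (simp add: prod algebra_simps)
  also have "\<dots> \<in> A"
    by (intro ideal_sum ideal_mult A b)
  finally have "?h q \<in> A" .
  \<comment> \<open>At w only the summand of w survives, which shows that \<open>q\<close> is not
    zero.\<close>
  moreover have "poly q w = (\<Sum>z\<in>T. if z = w then c w * (\<Prod>y\<in>T - {w}. w - y) else 0)"
    unfolding q_def poly_sum
  proof (rule sum.cong[OF refl])
    fix z assume "z \<in> T"
    show "poly (smult (c z) (\<Prod>y\<in>T - {z}. [:- y, 1:])) w = (if z = w then c w * (\<Prod>y\<in>T - {w}. w - y) else 0)"
      using T(2) w(1) by (auto simp: poly_prod)
  qed
  then have "q \<noteq> 0"
    using T(2) w by auto
  ultimately show False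
    using univariate_in_ideal[OF A b] \<open>1 \<notin> A\<close> by blast
qed

text \<open>Adjoining x - z1, y - z2 and z - z3 in turn keeps the ideal proper, and afterwards every
  polynomial is congruent to its value at (z1, z2, z3). A nonzero value of a member of
  \<open>A\<close> would be a unit in the enlarged ideal.\<close>

lemma weak_nullstellensatz:
  assumes A: "poly_ideal A" and "1 \<notin> A"
  obtains v where "\<And>a. a \<in> A \<Longrightarrow> eval a v = 0"
proof -
  obtain z1 where z1: "1 \<notin> ideal_adjoin A (Var 1 - Const z1)" (is "1 \<notin> ?A1")
    using ideal_adjoin_proper[OF assms] .
  note A1 = ideal_adjoin[OF A, of "Var 1 - Const z1"]
  obtain z2 where z2: "1 \<notin> ideal_adjoin ?A1 (Var 2 - Const z2)" (is "1 \<notin> ?A2")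
    using ideal_adjoin_proper[OF A1(1) z1] .
  note A2 = ideal_adjoin[OF A1(1), of "Var 2 - Const z2"]
  obtain z3 where z3: "1 \<notin> ideal_adjoin ?A2 (Var 3 - Const z3)" (is "1 \<notin> ?A3")
    using ideal_adjoin_proper[OF A2(1) z2] .
  note A3 = ideal_adjoin[OF A2(1), of "Var 3 - Const z3"]
  define v :: "complex ^ 3" where "v = (\<chi> i. if i = 1 then z1 else if i = 2 then z2 else z3)"
  have "Var i - Const (v $ i) \<in> ?A3" for i
    using exhaust_3[of i] A1 A2 A3 by (auto simp: v_def)
  then have cong: "p - Const (eval p v) \<in> ?A3" for p
    using ideal_tsubst_cong[OF A3(1), of "\<lambda>i. Const (v $ i)"] by (simp add: tsubst_Const_eval)
  show ?thesis
  proof (rule that[of v], rule ccontr)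
    fix a assume "a \<in> A" "eval a v \<noteq> 0"
    then have "a - (a - Const (eval a v)) \<in> ?A3"
      using A1(2) A2(2) A3(2) by (intro ideal_diff A3 cong) auto
    then have "1 \<in> ?A3"
      using \<open>eval a v \<noteq> 0\<close> ideal_unit[OF A3(1)] by simp
    with z3 show False by simp
  qed
qed

text \<open>
  Rabinowitsch's trick in homogeneous form: \<open>1 = a + b (L - 1)\<close> is solved degree by degree.
\<close>

lemma homogeneous_nullstellensatz:
  assumes A: "poly_ideal A" and parts: "\<And>a n. a \<in> A \<Longrightarrow> poly.coeff (hom_parts a) n \<in> A"
    and L: "homogeneous (int e) L" "e > 0"
    and van: "\<And>v. (\<And>a. a \<in> A \<Longrightarrow> eval a v = 0) \<Longrightarrow> eval L v = 0"
  obtains M where "L ^ M \<in> A"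
proof -
  note A' = ideal_adjoin[OF A, of "L - 1"]
  \<comment> \<open>A common zero of \<open>A\<close> and \<open>L - 1\<close> would be a zero of
    \<open>A\<close> at which \<open>L\<close> is 1.\<close>
  have "1 \<in> ideal_adjoin A (L - 1)"
  proof (rule ccontr)
    assume "1 \<notin> ideal_adjoin A (L - 1)"
    then obtain v where v: "\<And>a. a \<in> ideal_adjoin A (L - 1) \<Longrightarrow> eval a v = 0"
      using weak_nullstellensatz[OF A'(1)] by blast
    then have "eval L v = 0"
      using A'(2) by (intro van) auto
    with v[OF A'(3)] show False by simp
  qed
  then obtain a b where ab: "1 = a + b * (L - 1)" "a \<in> A"
    by (auto simp: ideal_adjoin_def)
  define B where "B = poly.coeff (hom_parts b)"
  have "hom_parts 1 = hom_parts a + (monom L e * hom_parts b - hom_parts b)"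
    using L(1) unfolding homogeneous_iff_hom_parts
    by (subst ab(1)) (simp add: hom_parts_simps algebra_simps)
  then have "poly.coeff (hom_parts 1) n = poly.coeff (hom_parts a + (monom L e * hom_parts b - hom_parts b)) n" for n
    by (rule arg_cong)
  from this[unfolded hom_parts_simps(1)]
  have part: "(if n = 0 then 1 else 0) = poly.coeff (hom_parts a) n + ((if n < e then 0 else L * B (n - e)) - B n)" for n
    by (simp only: coeff_add coeff_diff coeff_monom_mult B_def coeff_1 of_bool_def)
  \<comment> \<open>Modulo \<open>A\<close> the part of b in degree k e is - L^k: comparing parts
    gives B 0 = - 1 and B ((k + 1) e) = L B (k e). As b has only finitely many parts, some power of
    L lies in \<open>A\<close>.\<close>
  have "B (k * e) + L ^ k \<in> A" for k
  proof (induction k)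
    case 0
    have "B 0 + 1 = poly.coeff (hom_parts a) 0"
      using part[of 0] L(2) by (simp add: algebra_simps)
    then show ?case using parts[OF ab(2)] by simp
  next
    case (Suc k)
    have "B (Suc k * e) + L ^ Suc k = poly.coeff (hom_parts a) (Suc k * e) + L * (B (k * e) + L ^ k)"
      using part[of "Suc k * e"] L(2) by (simp add: algebra_simps)
    also have "\<dots> \<in> A"
      by (intro ideal_add ideal_mult A parts ab Suc)
    finally show ?case .
  qed
  moreover have "B (Suc (tdeg b) * e) = 0"
    unfolding B_def using L(2) by (cases e) (simp_all add: tdeg_def coeff_eq_0)
  ultimately have "L ^ Suc (tdeg b) \<in> A"
    by (metis add_0)
  then show ?thesis by (rule that)
qed

section \<open>Lines and rational functions without poles\<close>

lemma linear_form_expand: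
  assumes "homogeneous 1 l"
  obtains a where "l = (\<Sum>i\<in>UNIV. Var i * Const (a i))"
proof -
  have "\<exists>c. pderivative i l = Const c" for i
    using homogeneous_pderivative[of 1 l i] assms by (auto elim: homogeneous_0_imp_Const)
  then obtain a where a: "\<And>i. pderivative i l = Const (a i)" by metis
  have "l = (\<Sum>i\<in>UNIV. Var i * Const (a i))"
    using euler[of 1 l] assms by (simp add: a)
  then show ?thesis by (rule that)
qed

lemma other_indices:
  obtains j k :: 3 where "j \<noteq> i" "k \<noteq> i" "j \<noteq> k" "UNIV = {i, j, k}"
proof -
  have "UNIV = {1, 2, 3 :: 3}" "UNIV = {2, 1, 3 :: 3}" "UNIV = {3, 1, 2 :: 3}"
    using exhaust_3 by auto
  then show ?thesis
    using that[of 2 3] that[of 1 3] that[of 1 2] exhaust_3[of i] by auto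
qed

lemma infinite_line:
  assumes "homogeneous 1 l" "l \<noteq> 0"
  shows "infinite {P \<in> P2. \<forall>v\<in>P. eval l v = 0}"
proof -
  obtain a where a: "l = (\<Sum>i\<in>UNIV. Var i * Const (a i))"
    using assms(1) by (rule linear_form_expand)
  with assms(2) obtain i where i: "a i \<noteq> 0"
    by (metis (no_types, lifting) Const_simps(2) mult_zero_right sum.neutral)
  obtain j k :: 3 where jk: "j \<noteq> i" "k \<noteq> i" "j \<noteq> k" "UNIV = {i, j, k}"
    by (rule other_indices)
  \<comment> \<open>The points of the line with x_j = a_i and x_k = t a_i, solved for x_i. Fixing
    x_j makes different t give different projective points.\<close>
  define p where "p t = (\<chi> n. if n = j then a i else if n = k then t * a i else - a j - t * a k)" for t
  have pi: "p t $ i = - a j - t * a k" and pj: "p t $ j = a i" and pk: "p t $ k = t * a i" for t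
    using jk by (auto simp: p_def)
  have "eval l (p t) = 0" for t
    using jk(1-3) by (simp add: a jk(4) pi pj pk algebra_simps)
  moreover have "p t \<noteq> 0" for t
    using pj[of t] i by (metis zero_index)
  ultimately have "range (\<lambda>t. proj_point (p t)) \<subseteq> {P \<in> P2. \<forall>v\<in>P. eval l v = 0}"
    using assms(1) by (auto simp: eval_zero_proj_point proj_point_in_P2)
  moreover have "inj (\<lambda>t. proj_point (p t))"
  proof (rule injI)
    fix t s assume "proj_point (p t) = proj_point (p s)"
    then obtain c where "p s = c *s p t"
      using proj_point_eq_iff \<open>p t \<noteq> 0\<close> by blast
    then have "p s $ j = c * p t $ j" "p s $ k = c * p t $ k" by simp_all
    with i show "t = s" by (simp add: pj pk)
  qed
  ultimately show ?thesis
    by (meson finite_subset infinite_UNIV_char_0 finite_imageD)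
qed

lemma infinite_P2: "infinite P2"
proof -
  have "Var 1 \<noteq> 0"
    by (metis Var_def single_zero inj_single lookup_single_eq lookup_zero one_neq_zero)
  from infinite_line[OF _ this] show ?thesis
    by (metis (no_types, lifting) homogeneous_Var finite_subset mem_Collect_eq subsetI)
qed

lemma Var_nonzero [simp]: "Var i \<noteq> 0"
  by (metis Var_def lookup_single_eq lookup_zero one_neq_zero)

lemma line_through_point:
  obtains l where "homogeneous 1 l" "l \<noteq> 0" "eval l v = 0"
proof (cases "v $ 1 = 0")
  case True
  then show ?thesis using that[of "Var 1"] by simp
next
  case False
  define l where "l = Const (v $ 1) * Var 2 - Const (v $ 2) * Var 1"
  have "pderivative 2 l = Const (v $ 1)"
    by (simp add: l_def pderivative_diff pderivative_Const_mult pderivative_Var)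
  then have "l \<noteq> 0" using False by auto
  moreover have "homogeneous 1 l"
    unfolding l_def by (intro homogeneous_diff homogeneous_Const_mult homogeneous_Var)
  ultimately show ?thesis using that[of l] by (simp add: l_def)
qed

lemma hom_parts_homogeneous_mult:
  assumes "homogeneous (int n) g"
  shows "hom_parts (g * s) = monom g n * hom_parts s"
  using assms by (simp add: hom_parts_simps homogeneous_iff_hom_parts)

text \<open>This makes the ideal of denominators of the fraction \<open>g\<close> / \<open>h\<close>
  homogeneous, as the homogeneous Nullstellensatz requires: multiplication by \<open>g\<close> or
  \<open>h\<close> only shifts degrees.\<close>

lemma dvd_homogeneous_mult_part:
  assumes "homogeneous (int m) h" "homogeneous (int n) g" "h dvd g * s"
  shows "h dvd g * poly.coeff (hom_parts s) k"
proof -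
  obtain r where "g * s = h * r" using assms(3) ..
  then have "monom g n * hom_parts s = monom h m * hom_parts r"
    using hom_parts_homogeneous_mult assms by metis
  then have "poly.coeff (monom g n * hom_parts s) (k + n) = poly.coeff (monom h m * hom_parts r) (k + n)"
    by simp
  then have "g * poly.coeff (hom_parts s) k = h * (if k + n < m then 0 else poly.coeff (hom_parts r) (k + n - m))"
    by (simp add: coeff_monom_mult split: if_splits)
  then show ?thesis by simp
qed

lemma prime_elem_dvd_prod_iff:
  assumes "prime_elem q" "finite A"
  shows "q dvd prod f A \<longleftrightarrow> (\<exists>x\<in>A. q dvd f x)"
  using assms(2,1)
  by (induction A rule: finite_induct) (auto simp: prime_elem_dvd_mult_iff prime_elem_not_unit)

text \<open>
  A rational function on the projective plane that is regular outside of finitely many points has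
  no poles. Otherwise a prime factor of the denominator would divide a power of any product of lines
  through these points, hence would itself define a line, but a line contains infinitely many points.
\<close>

lemma dvd_off_finite:
  assumes h: "h \<noteq> 0" "homogeneous (int m) h" and g: "homogeneous (int n) g" and Z: "finite Z"
    and loc: "\<And>v. v \<noteq> 0 \<Longrightarrow> proj_point v \<notin> Z \<Longrightarrow> \<exists>s. eval s v \<noteq> 0 \<and> h dvd g * s"
  shows "h dvd g"
proof -
  \<comment> \<open>The ideal of denominators of the fraction \<open>g\<close> / \<open>h\<close>;
    its zeros other than the origin lie over \<open>Z\<close>.\<close>
  define A where "A = {s. h dvd g * s}"
  have A: "poly_ideal A"
    by (auto simp: poly_ideal_def A_def distrib_left)
      (metis dvd_mult mult.left_commute)
  have parts: "poly.coeff (hom_parts a) k \<in> A" if "a \<in> A" for a k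
    using that dvd_homogeneous_mult_part[OF h(2) g] by (simp add: A_def)
  have "\<exists>l. homogeneous 1 l \<and> l \<noteq> 0 \<and> (\<forall>v. v \<noteq> 0 \<longrightarrow> P = proj_point v \<longrightarrow> eval l v = 0)" for P
  proof (cases "\<exists>v. v \<noteq> 0 \<and> P = proj_point v")
    case True
    then obtain v where v: "P = proj_point v" by auto
    obtain l where "homogeneous 1 l" "l \<noteq> 0" "eval l v = 0"
      by (rule line_through_point)
    then show ?thesis
      using v eval_zero_proj_point self_in_proj_point by (intro exI[of _ l]) blast
  next
    case False
    then show ?thesis by (intro exI[of _ "Var 1"]) auto
  qed
  then obtain l where l: "\<And>P. homogeneous 1 (l P)" "\<And>P. l P \<noteq> 0"
      "\<And>P v. v \<noteq> 0 \<Longrightarrow> P = proj_point v \<Longrightarrow> eval (l P) v = 0"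
    by metis
  \<comment> \<open>The factor \<open>Var 1\<close> gives \<open>L\<close> positive degree even if
    \<open>Z\<close> is empty, and makes it vanish at the origin, about which \<open>loc\<close>
    says nothing.\<close>
  define L where "L = Var 1 * (\<Prod>P\<in>Z. l P)"
  have "homogeneous (int (card Z)) (\<Prod>P\<in>Z. l P)"
    using Z
  proof (induction Z rule: finite_induct)
    case empty
    then show ?case using homogeneous_Const[of 1] by (simp add: Const_simps)
  next
    case (insert P Z)
    then show ?case using homogeneous_mult[OF l(1)[of P] insert.IH] by simp
  qed
  then have "homogeneous (int (Suc (card Z))) L"
    using homogeneous_mult[OF homogeneous_Var[of 1]] by (simp add: L_def)
  moreover have "eval L v = 0" if "\<And>a. a \<in> A \<Longrightarrow> eval a v = 0" for v
  proof (cases "v = 0")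
    case True
    then show ?thesis by (simp add: L_def)
  next
    case False
    then have "proj_point v \<in> Z"
      using loc[of v] that by (auto simp: A_def)
    then have "(\<Prod>P\<in>Z. eval (l P) v) = 0"
      using Z l(3)[OF False] by (auto simp: prod_zero_iff)
    then show ?thesis by (simp add: L_def)
  qed
  ultimately obtain M where M: "h dvd g * L ^ M"
    using homogeneous_nullstellensatz[OF A parts, of "Suc (card Z)" L] by (auto simp: A_def)
  obtain e g' h' where egh: "g = e * g'" "h = e * h'" "e \<noteq> 0"
    and cop: "\<And>q. prime_elem q \<Longrightarrow> q dvd g' \<Longrightarrow> \<not> q dvd h'"
    using coprime_parts[OF h(1)] by metis
  have cancel: "h' dvd g' * s" if "h dvd g * s" for s
    using that egh by (simp add: mult.assoc)
  show ?thesis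
  proof (cases "h' dvd 1")
    case True
    then have "h' dvd g'" using dvd_trans one_dvd by blast
    then show ?thesis unfolding egh(1,2) by (rule mult_dvd_mono[OF dvd_refl])
  next
    case False
    moreover have "h' \<noteq> 0" using h(1) egh by auto
    ultimately obtain q where q: "prime_elem q" "q dvd h'"
      using prime_factor_exists by metis
    have "\<not> q dvd g'" using cop q by blast
    have q_dvd: "q dvd s" if "h dvd g * s" for s
      using cancel[OF that] q \<open>\<not> q dvd g'\<close> by (meson dvd_trans prime_elem_dvd_multD)
    have "q dvd L"
      using q_dvd[OF M] q(1) prime_elem_dvd_power by blast
    then have "q dvd Var 1 \<or> (\<exists>P\<in>Z. q dvd l P)"
      using q(1) Z unfolding L_def
      by (metis prime_elem_dvd_mult_iff prime_elem_dvd_prod_iff)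
    then obtain r where r: "homogeneous 1 r" "r \<noteq> 0" "q dvd r"
      using l(1,2) homogeneous_Var[of 1] Var_nonzero[of 1] by metis
    then obtain u where u: "r = q * u" by (elim dvdE)
    then have "q \<noteq> 0" "u \<noteq> 0" using r by auto
    \<comment> \<open>As a nonunit factor of a linear form, \<open>q\<close> is this form up to a
      constant.\<close>
    then have "tdeg q + tdeg u = 1"
      using tdeg_mult[of q u] tdeg_homogeneous[of 1 r] r(1,2) u by simp
    moreover have "tdeg q \<noteq> 0"
      using \<open>q \<noteq> 0\<close> Const_dvd_1 prime_elem_not_unit[OF q(1)]
      by (metis Const_eq_0_iff tdeg_eq_0_imp_Const)
    ultimately have "tdeg u = 0" by linarith
    then obtain c where c: "u = Const c"
      by (rule tdeg_eq_0_imp_Const)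
    \<comment> \<open>On the line q = 0 there is a point outside \<open>Z\<close>; some denominator
      is nonzero there, although \<open>q\<close> divides every denominator.\<close>
    have "\<not> {P \<in> P2. \<forall>v\<in>P. eval r v = 0} \<subseteq> Z"
      using infinite_line[OF r(1,2)] Z finite_subset by blast
    then obtain P where P: "P \<in> P2" "\<forall>v\<in>P. eval r v = 0" "P \<notin> Z"
      by auto
    then obtain v where v: "v \<noteq> 0" "P = proj_point v" using P2_nonempty_point by blast
    then have "eval r v = 0" using P(2) self_in_proj_point by blast
    then have "eval q v = 0" using u c \<open>u \<noteq> 0\<close> by auto
    moreover obtain s where s: "eval s v \<noteq> 0" "h dvd g * s"
      using loc v P(3) by blast
    ultimately have False using q_dvd[OF s(2)] by (auto elim!: dvdE)
    then show ?thesis ..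
  qed
qed

section \<open>From the sheaf to the module of syzygies\<close>

definition basic_open :: "tpoly \<Rightarrow> point set" where
  "basic_open h = P2 - common_zeros {h}"

lemma zariski_open_basic: "homogeneous k h \<Longrightarrow> zariski_open (basic_open h)"
  unfolding zariski_open_def basic_open_def by (intro exI[of _ "{h}"]) auto

lemma Union_basic_open:
  assumes "homogeneous k h"
  shows "v \<in> \<Union>(basic_open h) \<longleftrightarrow> v \<noteq> 0 \<and> eval h v \<noteq> 0"
proof
  assume "v \<in> \<Union>(basic_open h)"
  then obtain P where P: "P \<in> P2" "v \<in> P" "P \<notin> common_zeros {h}"
    by (auto simp: basic_open_def)
  then obtain w where "w \<in> P" "eval h w \<noteq> 0"
    by (auto simp: common_zeros_def)
  with P show "v \<noteq> 0 \<and> eval h v \<noteq> 0"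
    using P2_memD[of P v] eval_zero_proj_point[OF assms] by metis
next
  assume "v \<noteq> 0 \<and> eval h v \<noteq> 0"
  then show "v \<in> \<Union>(basic_open h)"
    using self_in_proj_point[of v] proj_point_in_P2[of v]
    by (auto simp: basic_open_def common_zeros_def)
qed

lemma zariski_open_subset_P2: "zariski_open U \<Longrightarrow> U \<subseteq> P2"
  by (auto simp: zariski_open_def)

lemma zariski_open_basic_nbhd:
  assumes "zariski_open U" "P \<in> U"
  obtains h k v where "homogeneous k h" "v \<in> P" "eval h v \<noteq> 0" "basic_open h \<subseteq> U"
proof -
  obtain F where F: "\<forall>p\<in>F. \<exists>k. homogeneous k p" "U = P2 - common_zeros F"
    using assms by (auto simp: zariski_open_def)
  then obtain p v where p: "p \<in> F" "v \<in> P" "eval p v \<noteq> 0"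
    using assms(2) by (auto simp: common_zeros_def)
  moreover have "basic_open p \<subseteq> U"
    using p(1) F(2) by (auto simp: basic_open_def common_zeros_def)
  ultimately show ?thesis using F(1) that by blast
qed

lemma zariski_open_Int:
  assumes "zariski_open U" "zariski_open W"
  shows "zariski_open (U \<inter> W)"
proof -
  obtain F where F: "\<forall>p\<in>F. \<exists>k. homogeneous k p" "U = P2 - common_zeros F"
    using assms by (auto simp: zariski_open_def)
  obtain G where G: "\<forall>p\<in>G. \<exists>k. homogeneous k p" "W = P2 - common_zeros G"
    using assms by (auto simp: zariski_open_def)
  define H where "H = {p * q | p q. p \<in> F \<and> q \<in> G}"
  have "\<exists>k. homogeneous k r" if "r \<in> H" for r
    using that F(1) G(1) homogeneous_mult unfolding H_def by blast
  moreover have "common_zeros H = common_zeros F \<union> common_zeros G"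
  proof
    show "common_zeros F \<union> common_zeros G \<subseteq> common_zeros H"
      by (auto simp: common_zeros_def H_def)
    show "common_zeros H \<subseteq> common_zeros F \<union> common_zeros G"
    proof
      fix P assume P: "P \<in> common_zeros H"
      then have P2: "P \<in> P2" by (simp add: common_zeros_def)
      show "P \<in> common_zeros F \<union> common_zeros G"
      proof (rule ccontr)
        assume "P \<notin> common_zeros F \<union> common_zeros G"
        then obtain p v q w where pq: "p \<in> F" "v \<in> P" "eval p v \<noteq> 0" "q \<in> G" "w \<in> P" "eval q w \<noteq> 0"
          using P2 by (auto simp: common_zeros_def)
        then have "eval q v \<noteq> 0"
          using G(1) P2_memD(2)[OF P2] eval_zero_proj_point by metis
        moreover have "p * q \<in> H" using pq by (auto simp: H_def)
        then have "eval (p * q) v = 0"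
          using P pq(2) unfolding common_zeros_def by blast
        ultimately show False using pq(3) by simp
      qed
    qed
  qed
  ultimately show ?thesis
    unfolding zariski_open_def F(2) G(2) by (intro exI[of _ H]) auto
qed

lemma twist_sectionsI:
  assumes "zariski_open U" "homogeneous (e + k) g" "homogeneous e h"
    "\<And>v. v \<in> \<Union>U \<Longrightarrow> eval h v \<noteq> 0 \<and> s v = eval g v / eval h v" "\<And>v. v \<notin> \<Union>U \<Longrightarrow> s v = 0"
  shows "s \<in> twist_sections k U"
proof -
  have "\<exists>W g h e. zariski_open W \<and> P \<in> W \<and> W \<subseteq> U \<and> homogeneous (e + k) g \<and> homogeneous e h \<and>
      (\<forall>v\<in>\<Union>W. eval h v \<noteq> 0 \<and> s v = eval g v / eval h v)" if "P \<in> U" for P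
    by (intro exI[of _ U] exI[of _ g] exI[of _ h] exI[of _ e] conjI ballI subset_refl assms(1-3) that)
      (use assms(4) in blast)+
  then show ?thesis
    unfolding twist_sections_def mem_Collect_eq by (intro conjI allI impI ballI assms(5))
qed

lemma twist_sections_local:
  assumes "s \<in> twist_sections k U" "P \<in> U"
  obtains W g h e where "zariski_open W" "P \<in> W" "W \<subseteq> U" "homogeneous (e + k) g" "homogeneous e h"
    "\<And>v. v \<in> \<Union>W \<Longrightarrow> eval h v \<noteq> 0" "\<And>v. v \<in> \<Union>W \<Longrightarrow> s v = eval g v / eval h v"
  using assms unfolding twist_sections_def by blast

lemma twist_sections_outside: "s \<in> twist_sections k U \<Longrightarrow> v \<notin> \<Union>U \<Longrightarrow> s v = 0"
  by (simp add: twist_sections_def)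

lemma twist_sections_restrict:
  assumes "s \<in> twist_sections k U" "zariski_open W" "W \<subseteq> U"
  shows "(\<lambda>v. if v \<in> \<Union>W then s v else 0) \<in> twist_sections k W"
  unfolding twist_sections_def
proof (safe)
  fix P assume "P \<in> W"
  then have "P \<in> U" using assms(3) by blast
  obtain V g h e where V: "zariski_open V" "P \<in> V" "V \<subseteq> U" "homogeneous (e + k) g" "homogeneous e h"
    "\<And>v. v \<in> \<Union>V \<Longrightarrow> eval h v \<noteq> 0" "\<And>v. v \<in> \<Union>V \<Longrightarrow> s v = eval g v / eval h v"
    by (rule twist_sections_local[OF assms(1) \<open>P \<in> U\<close>]) (rule that; assumption)
  show "\<exists>V g h e. zariski_open V \<and> P \<in> V \<and> V \<subseteq> W \<and> homogeneous (e + k) g \<and> homogeneous e h \<and>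
      (\<forall>v\<in>\<Union>V. eval h v \<noteq> 0 \<and> (if v \<in> \<Union>W then s v else 0) = eval g v / eval h v)"
    using V \<open>P \<in> W\<close> assms(2)
    by (intro exI[of _ "V \<inter> W"] exI[of _ g] exI[of _ h] exI[of _ e]) (auto intro: zariski_open_Int)
qed auto

lemma twist_sections_mult:
  assumes "r \<in> twist_sections 0 U" "s \<in> twist_sections k U"
  shows "(\<lambda>v. r v * s v) \<in> twist_sections k U"
  unfolding twist_sections_def
proof (safe)
  fix P assume "P \<in> U"
  obtain V g h e where V: "zariski_open V" "P \<in> V" "V \<subseteq> U" "homogeneous (e + 0) g" "homogeneous e h"
    "\<And>v. v \<in> \<Union>V \<Longrightarrow> eval h v \<noteq> 0" "\<And>v. v \<in> \<Union>V \<Longrightarrow> r v = eval g v / eval h v"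
    by (rule twist_sections_local[OF assms(1) \<open>P \<in> U\<close>]) (rule that; assumption)
  obtain V' g' h' e' where V': "zariski_open V'" "P \<in> V'" "V' \<subseteq> U" "homogeneous (e' + k) g'" "homogeneous e' h'"
    "\<And>v. v \<in> \<Union>V' \<Longrightarrow> eval h' v \<noteq> 0" "\<And>v. v \<in> \<Union>V' \<Longrightarrow> s v = eval g' v / eval h' v"
    by (rule twist_sections_local[OF assms(2) \<open>P \<in> U\<close>]) (rule that; assumption)
  have "homogeneous (e + e' + k) (g * g')" "homogeneous (e + e') (h * h')"
    using homogeneous_mult[OF V(4) V'(4)] homogeneous_mult[OF V(5) V'(5)] by (simp_all add: add.assoc)
  moreover have "eval (h * h') v \<noteq> 0 \<and> r v * s v = eval (g * g') v / eval (h * h') v" if "v \<in> \<Union>(V \<inter> V')" for v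
  proof -
    from that have "v \<in> \<Union>V" "v \<in> \<Union>V'" by blast+
    then show ?thesis using V(6,7)[of v] V'(6,7)[of v] by simp
  qed
  moreover have "zariski_open (V \<inter> V')" "P \<in> V \<inter> V'" "V \<inter> V' \<subseteq> U"
    using V(1-3) V'(1-3) zariski_open_Int by auto
  ultimately show "\<exists>V g h e. zariski_open V \<and> P \<in> V \<and> V \<subseteq> U \<and> homogeneous (e + k) g \<and> homogeneous e h \<and>
      (\<forall>v\<in>\<Union>V. eval h v \<noteq> 0 \<and> r v * s v = eval g v / eval h v)"
    by blast
next
  fix v assume "v \<notin> \<Union>U"
  then show "r v * s v = 0"
    using twist_sections_outside[OF assms(1), of v] by simp
qed

lemma eval_zero_on_basic_opens:
  assumes "p \<noteq> 0" "q \<noteq> 0" "\<And>v. v \<noteq> 0 \<Longrightarrow> eval p v \<noteq> 0 \<Longrightarrow> eval q v \<noteq> 0 \<Longrightarrow> eval r v = 0"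
  shows "r = 0"
proof (rule ccontr)
  assume "r \<noteq> 0"
  then obtain v where "v \<noteq> 0" "eval (p * q * r) v \<noteq> 0"
    using assms eval_nonzero[of "p * q * r"] by auto
  then show False using assms(3)[of v] by simp
qed

text \<open>The global sections of O(k) are forms. Two local fractions agree on an intersection of
  nonempty basic open sets, hence identically, so the denominators of all local fractions are
  denominators of one fixed fraction. They have no common zero on the plane, and
  \<open>dvd_off_finite\<close> applies without exceptional points.\<close>

lemma global_section_polynomial:
  assumes "\<And>P. P \<in> P2 \<Longrightarrow> \<exists>W g h e. zariski_open W \<and> P \<in> W \<and> homogeneous (e + int k) g \<and> homogeneous e h \<and>
    (\<forall>v\<in>\<Union>W. eval h v \<noteq> 0 \<and> \<sigma> v = eval g v / eval h v)"
  obtains p where "homogeneous (int k) p" "\<And>v. v \<noteq> 0 \<Longrightarrow> \<sigma> v = eval p v"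
proof -
  obtain P0 where "P0 \<in> P2"
    using infinite_P2 by fastforce
  then obtain W0 g0 h0 e0 where 0: "zariski_open W0" "P0 \<in> W0" "homogeneous (e0 + int k) g0" "homogeneous e0 h0"
    "\<And>v. v \<in> \<Union>W0 \<Longrightarrow> eval h0 v \<noteq> 0 \<and> \<sigma> v = eval g0 v / eval h0 v"
    using assms by blast
  obtain w0 where w0: "w0 \<noteq> 0" "basic_open w0 \<subseteq> W0" "\<exists>k. homogeneous k w0"
    using zariski_open_basic_nbhd[OF 0(1,2)] eval_simps(2) by metis
  have "h0 \<noteq> 0"
    using 0(5) 0(2) zariski_open_subset_P2[OF 0(1)] P2_nonempty_point self_in_proj_point
    by (metis UnionI eval_simps(2) subsetD)
  then obtain m where m: "e0 = int m"
    using 0(4) homogeneous_nat by blast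
  have local: "\<exists>g h. eval h v \<noteq> 0 \<and> \<sigma> v = eval g v / eval h v \<and> g * h0 = g0 * h" if "v \<noteq> 0" for v
  proof -
    obtain W g h e where W: "zariski_open W" "proj_point v \<in> W" "homogeneous (e + int k) g" "homogeneous e h"
      "\<And>v. v \<in> \<Union>W \<Longrightarrow> eval h v \<noteq> 0 \<and> \<sigma> v = eval g v / eval h v"
      using assms proj_point_in_P2[OF \<open>v \<noteq> 0\<close>] by meson
    obtain w where w: "w \<noteq> 0" "basic_open w \<subseteq> W" "\<exists>k. homogeneous k w"
      using zariski_open_basic_nbhd[OF W(1,2)] eval_simps(2) by metis
    have "g * h0 - g0 * h = 0"
    proof (rule eval_zero_on_basic_opens[OF w0(1) w(1)])
      fix u assume "u \<noteq> 0" "eval w0 u \<noteq> 0" "eval w u \<noteq> 0"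
      then have "u \<in> \<Union>W0" "u \<in> \<Union>W"
        using w0 w Union_basic_open by (meson Union_mono subsetD)+
      then have "eval h0 u \<noteq> 0" "eval h u \<noteq> 0" "eval g0 u / eval h0 u = eval g u / eval h u"
        using 0(5)[of u] W(5)[of u] by auto
      then show "eval (g * h0 - g0 * h) u = 0"
        by (simp add: field_simps)
    qed
    then show ?thesis
      using W(5)[of v] W(2) self_in_proj_point[of v] by (intro exI[of _ g] exI[of _ h]) auto
  qed
  have "h0 dvd g0"
  proof (rule dvd_off_finite[of h0 m "m + k" g0 "{}"])
    fix v :: "complex ^ 3" assume "v \<noteq> 0"
    then obtain g h where "eval h v \<noteq> 0" "g * h0 = g0 * h"
      using local by blast
    then show "\<exists>s. eval s v \<noteq> 0 \<and> h0 dvd g0 * s"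
      by (intro exI[of _ h]) (simp flip: \<open>g * h0 = g0 * h\<close>)
  qed (use \<open>h0 \<noteq> 0\<close> 0 m in auto)
  then obtain p where p: "g0 = h0 * p" ..
  show ?thesis
  proof (rule that)
    show "homogeneous (int k) p"
      using homogeneous_cofactor[OF 0(4) \<open>h0 \<noteq> 0\<close>] 0(3) p by metis
    fix v :: "complex ^ 3" assume "v \<noteq> 0"
    then obtain g h where "eval h v \<noteq> 0" "\<sigma> v = eval g v / eval h v" "g * h0 = g0 * h"
      using local by blast
    moreover from this(3) have "h0 * g = h0 * (p * h)"
      by (simp add: p ac_simps)
    then have "g = p * h"
      using \<open>h0 \<noteq> 0\<close> by simp
    ultimately show "\<sigma> v = eval p v" by simp
  qed
qed

text \<open>The global sections of \<open>log_vector_fields f\<close> twisted by k - 1: the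
  untwisted triples are sections of O(1), so the twist turns their entries into forms of degree
  k.\<close>

definition syzygies :: "tpoly \<Rightarrow> nat \<Rightarrow> (3 \<Rightarrow> tpoly) set" where
  "syzygies f k = {s. (\<forall>i. homogeneous (int k) (s i)) \<and> (\<Sum>i\<in>UNIV. s i * pderivative i f) = 0}"

text \<open>
  The section over \<open>x\<^sub>i \<noteq> 0\<close> obtained from a syzygy of degree \<open>k\<close>; the factor is \<open>x\<^sub>i\<^bsup>1 - k\<^esup>\<close>, written such
  that \<open>k = 0\<close> needs no special treatment.
\<close>

definition chart_section :: "3 \<Rightarrow> nat \<Rightarrow> (3 \<Rightarrow> tpoly) \<Rightarrow> complex ^ 3 \<Rightarrow> complex ^ 3" where
  "chart_section i k s v = (if v $ i = 0 then 0 else (v $ i / (v $ i) ^ k) *s (\<chi> j. eval (s j) v))"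

section \<open>Gluing over the standard charts\<close>

abbreviation chart :: "3 \<Rightarrow> point set" where
  "chart i \<equiv> basic_open (Var i)"

abbreviation chart2 :: "3 \<Rightarrow> 3 \<Rightarrow> point set" where
  "chart2 i j \<equiv> basic_open (Var i * Var j)"

lemma Union_chart: "v \<in> \<Union>(chart i) \<longleftrightarrow> v $ i \<noteq> 0"
  unfolding Union_basic_open[OF homogeneous_Var] by auto

lemma homogeneous_Var2: "homogeneous 2 (Var i * Var j)"
  using homogeneous_mult[OF homogeneous_Var homogeneous_Var, of i j] by simp

lemma Union_chart2: "v \<in> \<Union>(chart2 i j) \<longleftrightarrow> v $ i \<noteq> 0 \<and> v $ j \<noteq> 0"
  unfolding Union_basic_open[OF homogeneous_Var2] by auto

lemma zariski_open_chart: "zariski_open (chart i)"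
  by (rule zariski_open_basic[OF homogeneous_Var])

lemma zariski_open_chart2: "zariski_open (chart2 i j)"
  by (rule zariski_open_basic[OF homogeneous_Var2])

lemma chart2_subset: "chart2 i j \<subseteq> chart i" "chart2 i j \<subseteq> chart j"
  by (auto simp: basic_open_def common_zeros_def)

lemma homogeneous_Var_power: "homogeneous (int k) (Var i ^ k)"
  using homogeneous_power[OF homogeneous_Var, of k i] by simp

lemma chart_section_in:
  assumes "s \<in> syzygies f k"
  shows "chart_section i k s \<in> log_vector_fields f (chart i)"
proof -
  have "(\<lambda>v. chart_section i k s v $ j) \<in> twist_sections 1 (chart i)" for j
  proof (rule twist_sectionsI[where g = "Var i * s j" and h = "Var i ^ k" and e = "int k"])
    show "homogeneous (int k + 1) (Var i * s j)"
      using assms homogeneous_mult[OF homogeneous_Var, of "int k" "s j" i]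
      by (simp add: syzygies_def add.commute)
  qed (simp_all add: zariski_open_chart Union_chart chart_section_def homogeneous_Var_power del: Union_iff)
  moreover have "(\<Sum>j\<in>UNIV. chart_section i k s v $ j * eval (pderivative j f) v) = 0" for v
  proof (cases "v $ i = 0")
    case False
    have "(\<Sum>j\<in>UNIV. chart_section i k s v $ j * eval (pderivative j f) v) =
        v $ i / (v $ i) ^ k * eval (\<Sum>j\<in>UNIV. s j * pderivative j f) v"
      using False by (simp add: chart_section_def sum_distrib_left mult.assoc)
    also have "(\<Sum>j\<in>UNIV. s j * pderivative j f) = 0"
      using assms by (simp add: syzygies_def)
    finally show ?thesis by simp
  qed (simp add: chart_section_def)
  ultimately show ?thesis
    by (simp add: log_vector_fields_def)
qed

lemma chart_section_eq_iff: "chart_section i k s = chart_section i k t \<longleftrightarrow> s = t"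
proof
  assume eq: "chart_section i k s = chart_section i k t"
  show "s = t"
  proof
    fix j
    have "s j - t j = 0"
    proof (rule eval_zero_on_basic_opens[of "Var i" "Var i"])
      fix v :: "complex ^ 3" assume "eval (Var i) v \<noteq> 0"
      moreover have "chart_section i k s v $ j = chart_section i k t v $ j"
        by (simp add: eq)
      ultimately show "eval (s j - t j) v = 0"
        by (simp add: chart_section_def)
    qed simp_all
    then show "s j = t j" by simp
  qed
qed simp

lemma log_vector_fields_restrict:
  assumes "s \<in> log_vector_fields f U" "zariski_open W" "W \<subseteq> U"
  shows "restrict_section W s \<in> log_vector_fields f W"
proof -
  have "(\<lambda>v. restrict_section W s v $ i) = (\<lambda>v. if v \<in> \<Union>W then s v $ i else 0)" for i
    by (auto simp: restrict_section_def)
  then show ?thesis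
    using assms twist_sections_restrict[OF _ assms(2,3)]
    by (auto simp: log_vector_fields_def restrict_section_def)
qed

lemma log_vector_fields_scale:
  assumes "s \<in> log_vector_fields f U" "r \<in> twist_sections 0 U"
  shows "(\<lambda>v. r v *s s v) \<in> log_vector_fields f U"
proof -
  have "(\<Sum>i\<in>UNIV. (r v *s s v) $ i * eval (pderivative i f) v) =
      r v * (\<Sum>i\<in>UNIV. s v $ i * eval (pderivative i f) v)" for v
    by (simp add: sum_distrib_left mult.assoc)
  then show ?thesis
    using assms twist_sections_mult[OF assms(2)]
    by (auto simp: log_vector_fields_def)
qed

lemma log_vector_fields_outside:
  assumes "s \<in> log_vector_fields f U" "v \<notin> \<Union>U"
  shows "s v = 0"
proof -
  have "s v $ i = 0" for i
    using assms(1) by (intro twist_sections_outside[where k = 1, OF _ assms(2)]) (simp add: log_vector_fields_def)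
  then show ?thesis by (simp add: vec_eq_iff)
qed

text \<open>The cocycle of the twist, x_i / x_j to the power 1 - k. It is a regular function on the
  overlap, so an isomorphism of the untwisted sheaves commutes with it; this is why such an
  isomorphism acts on every twist.\<close>

definition transition :: "nat \<Rightarrow> 3 \<Rightarrow> 3 \<Rightarrow> complex ^ 3 \<Rightarrow> complex" where
  "transition k i j v = (if v $ i = 0 \<or> v $ j = 0 then 0 else v $ i * (v $ j) ^ k / ((v $ i) ^ k * v $ j))"

lemma transition_in: "transition k i j \<in> twist_sections 0 (chart2 i j)"
proof (rule twist_sectionsI[where g = "Var i * Var j ^ k" and h = "Var i ^ k * Var j" and e = "int k + 1"])
  show "homogeneous (int k + 1) (Var i ^ k * Var j)"
    by (intro homogeneous_mult homogeneous_Var homogeneous_Var_power)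
  show "homogeneous (int k + 1 + 0) (Var i * Var j ^ k)"
    using homogeneous_mult[OF homogeneous_Var[of i] homogeneous_Var_power[of k j]] by (simp add: add.commute)
qed (auto simp: zariski_open_chart2 Union_chart2 transition_def simp del: Union_iff)

lemma chart_section_transition:
  "restrict_section (chart2 i j) (chart_section i k s) =
     (\<lambda>v. transition k i j v *s restrict_section (chart2 i j) (chart_section j k s) v)"
  by (rule ext) (simp add: restrict_section_def Union_chart2 chart_section_def transition_def
      vector_smult_assoc del: Union_iff)

text \<open>Multiplied by x_i^(k - 1), the sections \<open>S i\<close> agree on the overlaps and
  form a global triple of sections of O(k), whose components are forms by
  \<open>global_section_polynomial\<close>.\<close>

lemma glue_chart_sections:
  assumes S: "\<And>i. S i \<in> log_vector_fields f (chart i)"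
    and trans: "\<And>i j. restrict_section (chart2 i j) (S i) =
      (\<lambda>v. transition k i j v *s restrict_section (chart2 i j) (S j) v)"
  obtains s where "s \<in> syzygies f k" "\<And>i. S i = chart_section i k s"
proof -
  have overlap: "((v $ i) ^ k / v $ i) *s S i v = ((v $ j) ^ k / v $ j) *s S j v"
    if "v $ i \<noteq> 0" "v $ j \<noteq> 0" for v :: "complex ^ 3" and i j
  proof -
    have "v \<in> \<Union>(chart2 i j)"
      unfolding Union_chart2 using that by blast
    then have "S i v = transition k i j v *s S j v"
      using fun_cong[OF trans[of i j], of v] by (simp add: restrict_section_def)
    then show ?thesis
      using that by (simp add: transition_def vector_smult_assoc field_simps)
  qed
  \<comment> \<open>The choice of the nonzero coordinate does not matter, by
    \<open>overlap\<close>.\<close>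
  define \<sigma> where "\<sigma> v = (let i = SOME i. v $ i \<noteq> 0 in ((v $ i) ^ k / v $ i) *s S i v)" for v
  have \<sigma>: "\<sigma> v = ((v $ i) ^ k / v $ i) *s S i v" if "v $ i \<noteq> 0" for v :: "complex ^ 3" and i
    using overlap[OF that] someI[of "\<lambda>i. v $ i \<noteq> 0", OF that] by (simp add: \<sigma>_def Let_def)
  have "\<exists>p. homogeneous (int k) p \<and> (\<forall>v. v \<noteq> 0 \<longrightarrow> \<sigma> v $ c = eval p v)" for c
  proof (rule global_section_polynomial[of k "\<lambda>v. \<sigma> v $ c"])
    fix P assume "P \<in> P2"
    then obtain u where u: "u \<noteq> 0" "P = proj_point u"
      by (rule P2_nonempty_point)
    then obtain i where i: "u $ i \<noteq> 0"
      by (auto simp: vec_eq_iff)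
    have P_in: "P \<in> chart i"
      using i u self_in_proj_point[of u] \<open>P \<in> P2\<close> by (auto simp: basic_open_def common_zeros_def)
    have S_twist: "(\<lambda>v. S i v $ c) \<in> twist_sections 1 (chart i)"
      using S by (simp add: log_vector_fields_def)
    obtain W g h e where W: "zariski_open W" "P \<in> W" "W \<subseteq> chart i"
      "homogeneous (e + 1) g" "homogeneous e h" "\<And>v. v \<in> \<Union>W \<Longrightarrow> eval h v \<noteq> 0"
      "\<And>v. v \<in> \<Union>W \<Longrightarrow> S i v $ c = eval g v / eval h v"
      by (rule twist_sections_local[OF S_twist P_in]) (rule that; assumption)
    have "eval (Var i * h) v \<noteq> 0 \<and> \<sigma> v $ c = eval (Var i ^ k * g) v / eval (Var i * h) v" if "v \<in> \<Union>W" for v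
    proof -
      have "v $ i \<noteq> 0"
        using that W(3) Union_chart[of v i] by blast
      then show ?thesis
        using W(6,7)[OF that] by (simp add: \<sigma>)
    qed
    moreover have "homogeneous (e + 1 + int k) (Var i ^ k * g)" "homogeneous (e + 1) (Var i * h)"
      using homogeneous_mult[OF homogeneous_Var_power W(4)] homogeneous_mult[OF homogeneous_Var W(5)]
      by (simp_all add: algebra_simps)
    ultimately show "\<exists>W g h e. zariski_open W \<and> P \<in> W \<and> homogeneous (e + int k) g \<and> homogeneous e h \<and>
        (\<forall>v\<in>\<Union>W. eval h v \<noteq> 0 \<and> \<sigma> v $ c = eval g v / eval h v)"
      using W(1,2) by blast
  qed blast
  then obtain s where s: "\<And>c. homogeneous (int k) (s c)" "\<And>c v. v \<noteq> 0 \<Longrightarrow> \<sigma> v $ c = eval (s c) v"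
    by metis
  have S_eq: "S i v = (v $ i / (v $ i) ^ k) *s (\<chi> j. eval (s j) v)" if "v $ i \<noteq> 0" for i and v :: "complex ^ 3"
  proof -
    have "v \<noteq> 0" using that by auto
    then have "(\<chi> j. eval (s j) v) = \<sigma> v" by (simp add: vec_eq_iff s(2))
    then show ?thesis using that \<sigma>[OF that] by (simp add: vector_smult_assoc)
  qed
  have "(\<Sum>i\<in>UNIV. s i * pderivative i f) = 0"
  proof (rule tpoly_eqI)
    fix v :: "complex ^ 3" assume "v \<noteq> 0"
    then obtain i where i: "v $ i \<noteq> 0" by (auto simp: vec_eq_iff)
    then have "(\<Sum>j\<in>UNIV. S i v $ j * eval (pderivative j f) v) = 0"
      using S[of i] Union_chart[of v i] unfolding log_vector_fields_def by blast
    then have "v $ i / (v $ i) ^ k * (\<Sum>j\<in>UNIV. eval (s j) v * eval (pderivative j f) v) = 0"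
      by (simp add: S_eq[OF i] sum_distrib_left mult.assoc)
    then show "eval (\<Sum>i\<in>UNIV. s i * pderivative i f) v = eval 0 v"
      using i by simp
  qed
  then have "s \<in> syzygies f k"
    using s(1) by (simp add: syzygies_def)
  moreover have "S i = chart_section i k s" for i
  proof
    fix v show "S i v = chart_section i k s v"
      using S_eq[of v i] log_vector_fields_outside[OF S, of v i] Union_chart[of v i]
      by (auto simp: chart_section_def)
  qed
  ultimately show ?thesis by (rule that)
qed

text \<open>
  The relation is the graph of an isomorphism of graded modules over the polynomial ring.
\<close>

lemma sheaf_isomorphic_imp_syzygies:
  assumes "sheaf_isomorphic (log_vector_fields f') (log_vector_fields f)"
  obtains R :: "nat \<Rightarrow> (3 \<Rightarrow> tpoly) \<Rightarrow> (3 \<Rightarrow> tpoly) \<Rightarrow> bool" where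
    "\<forall>k. \<forall>s\<in>syzygies f' k. \<exists>t\<in>syzygies f k. R k s t"
    "\<forall>k. \<forall>t\<in>syzygies f k. \<exists>s\<in>syzygies f' k. R k s t"
    "\<forall>k s t s' t'. R k s t \<longrightarrow> R k s' t' \<longrightarrow> R k (\<lambda>i. s i + s' i) (\<lambda>i. t i + t' i)"
    "\<forall>k s t e c. R k s t \<longrightarrow> homogeneous (int e) c \<longrightarrow> R (k + e) (\<lambda>i. c * s i) (\<lambda>i. c * t i)"
    "\<forall>k s t. R k s t \<longrightarrow> (s = (\<lambda>_. 0) \<longleftrightarrow> t = (\<lambda>_. 0))"
proof -
  obtain \<phi> where
    bij: "\<And>U. zariski_open U \<Longrightarrow> bij_betw (\<phi> U) (log_vector_fields f' U) (log_vector_fields f U)" and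
    add: "\<And>U s t. zariski_open U \<Longrightarrow> s \<in> log_vector_fields f' U \<Longrightarrow> t \<in> log_vector_fields f' U \<Longrightarrow>
      \<phi> U (\<lambda>v. s v + t v) = (\<lambda>v. \<phi> U s v + \<phi> U t v)" and
    scale: "\<And>U r s. zariski_open U \<Longrightarrow> r \<in> twist_sections 0 U \<Longrightarrow> s \<in> log_vector_fields f' U \<Longrightarrow>
      \<phi> U (\<lambda>v. r v *s s v) = (\<lambda>v. r v *s \<phi> U s v)" and
    res: "\<And>U W s. zariski_open U \<Longrightarrow> zariski_open W \<Longrightarrow> W \<subseteq> U \<Longrightarrow> s \<in> log_vector_fields f' U \<Longrightarrow>
      \<phi> W (restrict_section W s) = restrict_section W (\<phi> U s)"
  proof -
    obtain \<phi> where \<phi>: "\<forall>U. zariski_open U \<longrightarrow>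
           bij_betw (\<phi> U) (log_vector_fields f' U) (log_vector_fields f U) \<and>
           (\<forall>s\<in>log_vector_fields f' U. \<forall>t\<in>log_vector_fields f' U. \<phi> U (\<lambda>v. s v + t v) = (\<lambda>v. \<phi> U s v + \<phi> U t v)) \<and>
           (\<forall>r\<in>twist_sections 0 U. \<forall>s\<in>log_vector_fields f' U. \<phi> U (\<lambda>v. r v *s s v) = (\<lambda>v. r v *s \<phi> U s v))"
      "\<forall>U W. zariski_open U \<longrightarrow> zariski_open W \<longrightarrow> W \<subseteq> U \<longrightarrow>
           (\<forall>s\<in>log_vector_fields f' U. \<phi> W (restrict_section W s) = restrict_section W (\<phi> U s))"
      using assms unfolding sheaf_isomorphic_def by (elim exE conjE)
    show thesis
      by (rule that[of \<phi>]) (use \<phi> in simp_all)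
  qed
  note zo = zariski_open_chart zariski_open_chart2
  have \<phi>_in: "\<phi> U s \<in> log_vector_fields f U" if "zariski_open U" "s \<in> log_vector_fields f' U" for U s
    using bij[OF that(1)] that(2) by (auto simp: bij_betw_def)
  have inj: "s = t" if "zariski_open U" "s \<in> log_vector_fields f' U" "t \<in> log_vector_fields f' U" "\<phi> U s = \<phi> U t" for U s t
    using bij[OF that(1)] that by (auto simp: bij_betw_def inj_on_def)
  have res_in: "restrict_section (chart2 i j) s \<in> log_vector_fields f' (chart2 i j)"
    if "s \<in> log_vector_fields f' (chart l)" "l = i \<or> l = j" for s i j l
    using log_vector_fields_restrict[OF that(1) zo(2)] chart2_subset that(2) by blast
  have res_\<phi>: "\<phi> (chart2 i j) (restrict_section (chart2 i j) s) = restrict_section (chart2 i j) (\<phi> (chart l) s)"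
    if "s \<in> log_vector_fields f' (chart l)" "l = i \<or> l = j" for s i j l
    using res[OF zo(1,2) _ that(1)] chart2_subset that(2) by blast
  \<comment> \<open>One chart suffices to record the relation, because a syzygy is determined by its
    section over x_1 /= 0; the other charts serve for gluing.\<close>
  define R where "R k s t \<longleftrightarrow> s \<in> syzygies f' k \<and> t \<in> syzygies f k \<and>
    \<phi> (chart 1) (chart_section 1 k s) = chart_section 1 k t" for k s t
  show ?thesis
  proof (rule that[of R]; intro allI ballI impI)
    fix k s assume s: "s \<in> syzygies f' k"
    note cs = chart_section_in[OF s]
    obtain t where "t \<in> syzygies f k" "\<And>i. \<phi> (chart i) (chart_section i k s) = chart_section i k t"
    proof (rule glue_chart_sections[of "\<lambda>i. \<phi> (chart i) (chart_section i k s)" f k])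
      show "\<phi> (chart i) (chart_section i k s) \<in> log_vector_fields f (chart i)" for i
        by (intro \<phi>_in zo cs)
      fix i j
      have "restrict_section (chart2 i j) (\<phi> (chart i) (chart_section i k s)) =
          \<phi> (chart2 i j) (restrict_section (chart2 i j) (chart_section i k s))"
        by (simp add: res_\<phi>[OF cs])
      also have "\<dots> = (\<lambda>v. transition k i j v *s \<phi> (chart2 i j) (restrict_section (chart2 i j) (chart_section j k s)) v)"
        unfolding chart_section_transition[of i j k s]
        by (intro scale zo transition_in res_in[OF cs]) simp
      also have "\<dots> = (\<lambda>v. transition k i j v *s restrict_section (chart2 i j) (\<phi> (chart j) (chart_section j k s)) v)"
        by (simp add: res_\<phi>[OF cs])
      finally show "restrict_section (chart2 i j) (\<phi> (chart i) (chart_section i k s)) = \<dots>" .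
    qed blast
    then show "\<exists>t\<in>syzygies f k. R k s t"
      using s by (auto simp: R_def)
  next
    fix k t assume t: "t \<in> syzygies f k"
    have "\<exists>S. S \<in> log_vector_fields f' (chart i) \<and> \<phi> (chart i) S = chart_section i k t" for i
      using bij[OF zo(1)] chart_section_in[OF t, of i] unfolding bij_betw_def by (metis imageE)
    then obtain S where S: "\<And>i. S i \<in> log_vector_fields f' (chart i)" "\<And>i. \<phi> (chart i) (S i) = chart_section i k t"
      by metis
    obtain s where "s \<in> syzygies f' k" "\<And>i. S i = chart_section i k s"
    proof (rule glue_chart_sections[of S f' k])
      show "S i \<in> log_vector_fields f' (chart i)" for i by (rule S)
      fix i j
      let ?r = "\<lambda>v. transition k i j v *s restrict_section (chart2 i j) (S j) v"
      have "\<phi> (chart2 i j) (restrict_section (chart2 i j) (S i)) = restrict_section (chart2 i j) (chart_section i k t)"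
        by (simp add: res_\<phi>[OF S(1)] S(2))
      also have "\<dots> = (\<lambda>v. transition k i j v *s \<phi> (chart2 i j) (restrict_section (chart2 i j) (S j)) v)"
        by (subst chart_section_transition) (simp add: res_\<phi>[OF S(1)] S(2))
      also have "\<dots> = \<phi> (chart2 i j) ?r"
        by (intro scale[symmetric] zo transition_in res_in[OF S(1)]) simp
      finally have "\<phi> (chart2 i j) (restrict_section (chart2 i j) (S i)) = \<phi> (chart2 i j) ?r" .
      moreover have "restrict_section (chart2 i j) (S i) \<in> log_vector_fields f' (chart2 i j)"
        by (rule res_in[OF S(1)]) simp
      moreover have "restrict_section (chart2 i j) (S j) \<in> log_vector_fields f' (chart2 i j)"
        by (rule res_in[OF S(1)]) simp
      \<comment> \<open>The images of both sides agree and the isomorphism is injective over the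
        overlap, so the preimages inherit the transition rule.\<close>
      ultimately show "restrict_section (chart2 i j) (S i) = ?r"
        using inj[OF zo(2)] log_vector_fields_scale[OF _ transition_in] by blast
    qed blast
    then show "\<exists>s\<in>syzygies f' k. R k s t"
      using t S(2)[of 1] by (auto simp: R_def)
  next
    fix k s t s' t' assume R: "R k s t" "R k s' t'"
    have cs_add: "chart_section 1 k (\<lambda>i. a i + b i) = (\<lambda>v. chart_section 1 k a v + chart_section 1 k b v)" for a b
      by (rule ext) (auto simp: chart_section_def vec_eq_iff distrib_left add_divide_distrib)
    have syz_add: "(\<lambda>i. a i + b i) \<in> syzygies h k" if "a \<in> syzygies h k" "b \<in> syzygies h k" for a b h
      using that by (auto simp: syzygies_def homogeneous_add distrib_right sum.distrib)
    show "R k (\<lambda>i. s i + s' i) (\<lambda>i. t i + t' i)"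
      using R add[OF zo(1) chart_section_in[of s f' k 1] chart_section_in[of s' f' k 1]]
      by (auto simp: R_def syz_add cs_add)
  next
    fix k s t e c assume R: "R k s t" and c: "homogeneous (int e) c"
    \<comment> \<open>Division by x_1^e turns the form c into a regular function on the chart, with
      which the isomorphism commutes.\<close>
    define r where "r v = (if v $ 1 = 0 then 0 else eval c v / (v $ 1) ^ e)" for v :: "complex ^ 3"
    have r: "r \<in> twist_sections 0 (chart 1)"
      by (rule twist_sectionsI[where g = c and h = "Var 1 ^ e" and e = "int e"])
        (use c in \<open>simp_all add: zo Union_chart r_def homogeneous_Var_power del: Union_iff\<close>)
    have cs: "chart_section 1 (k + e) (\<lambda>i. c * a i) = (\<lambda>v. r v *s chart_section 1 k a v)" for a
      by (rule ext) (auto simp: chart_section_def r_def vec_eq_iff power_add field_simps)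
    have syz: "(\<lambda>i. c * a i) \<in> syzygies h (k + e)" if "a \<in> syzygies h k" for a h
    proof -
      have "homogeneous (int (k + e)) (c * a i)" for i
        using that homogeneous_mult[OF c, of "int k" "a i"] by (simp add: syzygies_def add.commute)
      then show ?thesis
        using that by (simp add: syzygies_def mult.assoc flip: sum_distrib_left)
    qed
    show "R (k + e) (\<lambda>i. c * s i) (\<lambda>i. c * t i)"
      using R scale[OF zo(1) r chart_section_in, of s k]
      by (auto simp: R_def syz cs)
  next
    fix k s t assume R: "R k s t"
    have syz0: "(\<lambda>_. 0) \<in> syzygies h k" for h
      by (simp add: syzygies_def)
    have cs0: "chart_section 1 k (\<lambda>_. 0) = (\<lambda>v. 0)"
      by (rule ext) (simp add: chart_section_def vec_eq_iff)
    have "\<phi> (chart 1) (\<lambda>v. 0 + 0) = (\<lambda>v. \<phi> (chart 1) (\<lambda>v. 0) v + \<phi> (chart 1) (\<lambda>v. 0) v)"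
      by (intro add zo) (use chart_section_in[OF syz0, where i = 1] cs0 in simp_all)
    then have \<phi>0: "\<phi> (chart 1) (\<lambda>v. 0) = (\<lambda>v. 0)"
      by (simp add: fun_eq_iff)
    show "s = (\<lambda>_. 0) \<longleftrightarrow> t = (\<lambda>_. 0)"
    proof
      assume "s = (\<lambda>_. 0)"
      then have "chart_section 1 k t = chart_section 1 k (\<lambda>_. 0)"
        using R \<phi>0 by (simp add: R_def cs0)
      then show "t = (\<lambda>_. 0)" by (simp only: chart_section_eq_iff)
    next
      assume "t = (\<lambda>_. 0)"
      then have "\<phi> (chart 1) (chart_section 1 k s) = \<phi> (chart 1) (chart_section 1 k (\<lambda>_. 0))"
        using R \<phi>0 by (simp add: R_def cs0)
      then have "chart_section 1 k s = chart_section 1 k (\<lambda>_. 0)"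
        using R inj[OF zo(1) chart_section_in[of s f' k 1] chart_section_in[OF syz0, of 1]]
        by (simp add: R_def)
      then show "s = (\<lambda>_. 0)" by (simp only: chart_section_eq_iff)
    qed
  qed
qed

section \<open>Syzygies of a nodal curve\<close>

definition cross :: "(3 \<Rightarrow> 'a::comm_ring_1) \<Rightarrow> (3 \<Rightarrow> 'a) \<Rightarrow> 3 \<Rightarrow> 'a" where
  "cross a b i = (if i = 1 then a 2 * b 3 - a 3 * b 2
     else if i = 2 then a 3 * b 1 - a 1 * b 3 else a 1 * b 2 - a 2 * b 1)"

text \<open>The Grassmann identity. If \<open>b\<close> is a syzygy of \<open>c\<close>, only
  \<open>b\<close> times the scalar product of \<open>a\<close> and \<open>c\<close> remains; this
  turns a representation of a form in the Jacobian ideal into a Koszul representation of its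
  multiple of \<open>b\<close>.\<close>

lemma cross_cross:
  "cross (cross a b) c i = b i * (\<Sum>j\<in>UNIV. a j * c j) - a i * (\<Sum>j\<in>UNIV. b j * c j)"
  using exhaust_3[of i] by (auto simp: cross_def sum_3 algebra_simps)

lemma cross_diff_scaled:
  "cross (\<lambda>j. r * a j - s * b j) c i = r * cross a c i - s * cross b c i"
  by (simp add: cross_def algebra_simps)

lemma cross_scaled: "cross (\<lambda>j. r * a j) c i = r * cross a c i"
  by (simp add: cross_def algebra_simps)

lemma cross_eq_0D:
  assumes "\<And>i. cross a b i = 0"
  shows "a i * b j = a j * b i"
proof -
  have "cross a b 1 = 0" "cross a b 2 = 0" "cross a b 3 = 0"
    by (rule assms)+
  then show ?thesis
    using exhaust_3[of i] exhaust_3[of j] by (auto simp: cross_def algebra_simps)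
qed

definition finite_zeros :: "(3 \<Rightarrow> tpoly) \<Rightarrow> bool" where
  "finite_zeros F \<longleftrightarrow> finite {P \<in> P2. \<forall>v\<in>P. \<forall>j. eval (F j) v = 0}"

lemma finite_zeros_nonzero:
  assumes "finite_zeros F"
  obtains k where "F k \<noteq> 0"
proof (rule ccontr)
  assume "\<not> thesis"
  then have "F k = 0" for k
    using that by blast
  then have "{P \<in> P2. \<forall>v\<in>P. \<forall>j. eval (F j) v = 0} = P2"
    by simp
  with assms infinite_P2 show False
    unfolding finite_zeros_def by simp
qed

text \<open>A vanishing cross product means N k F j = N j F k, so every F j is a denominator of the
  fraction N k / F k. The fraction is regular outside the finitely many common zeros of
  \<open>F\<close>, hence a form. This is exactness of the Koszul complex for a triple without a
  common curve.\<close>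

lemma cross_zero_imp_proportional:
  assumes F: "\<And>j. homogeneous (int e) (F j)" "finite_zeros F"
    and N: "\<And>j. homogeneous (int n) (N j)" and zero: "\<And>i. cross N F i = 0"
  obtains c where "homogeneous (int n - int e) c" "\<And>i. N i = c * F i"
proof -
  let ?Z = "{P \<in> P2. \<forall>v\<in>P. \<forall>j. eval (F j) v = 0}"
  have nz: "\<exists>j. eval (F j) v \<noteq> 0" if "v \<noteq> 0" "proj_point v \<notin> ?Z" for v
    using that proj_point_in_P2[OF that(1)] eval_zero_proj_point[OF F(1)] by blast
  obtain k where k: "F k \<noteq> 0"
    using F(2) by (rule finite_zeros_nonzero)
  have "F k dvd N k"
  proof (rule dvd_off_finite[of "F k" e n "N k" ?Z])
    fix v :: "complex ^ 3" assume "v \<noteq> 0" "proj_point v \<notin> ?Z"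
    then obtain j where j: "eval (F j) v \<noteq> 0"
      using nz by blast
    then show "\<exists>s. eval s v \<noteq> 0 \<and> F k dvd N k * s"
      using cross_eq_0D[of N F k j, OF zero] by (metis dvd_triv_right)
  qed (use F N k in \<open>simp_all add: finite_zeros_def\<close>)
  then obtain c where c: "N k = F k * c" ..
  have "homogeneous (int n - int e) c"
    by (rule homogeneous_cofactor[OF F(1) k]) (use N[of k] c in simp)
  moreover have "N i = c * F i" for i
  proof -
    have "F k * N i = F k * (c * F i)"
      using cross_eq_0D[of N F i k, OF zero] c by (simp add: ac_simps)
    then show ?thesis using k by simp
  qed
  ultimately show ?thesis by (rule that)
qed

section \<open>Gluing solutions of a cross product equation\<close>

lemma prime_power_dvd_cancel:
  fixes q :: "'a::idom"
  assumes "prime_elem q" "\<not> q dvd a" "q ^ M dvd a * p"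
  shows "q ^ M dvd p"
  using assms(3)
proof (induction M arbitrary: p)
  case (Suc M)
  then have "q dvd a * p"
    by (metis dvd_mult_left power_Suc)
  then have "q dvd p"
    using assms prime_elem_dvd_mult_iff by blast
  then obtain r where r: "p = q * r" ..
  obtain t where "a * p = q ^ Suc M * t"
    using Suc.prems ..
  then have "q * (a * r) = q * (q ^ M * t)"
    by (simp add: r ac_simps)
  moreover have "q \<noteq> 0"
    using assms(1) by auto
  ultimately have "q ^ M dvd a * r"
    by (metis dvd_triv_left mult_left_cancel)
  then have "q ^ M dvd r" by (rule Suc.IH)
  then show ?case by (simp add: r)
qed simp

text \<open>A prime factor exists by factoriality; since the degree is one, its cofactor is constant
  and the variable is associated to it.\<close>

lemma prime_Var: "prime_elem (Var i)"
proof -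
  have t1: "tdeg (Var i) = 1"
    using tdeg_homogeneous[of 1 "Var i"] by simp
  have nonunit: "\<not> Var i dvd 1"
  proof
    assume "Var i dvd 1"
    then obtain c where "Var i = Const c"
      unfolding is_unit_tpoly_iff by blast
    with t1 show False by (simp add: tdeg_def)
  qed
  obtain q where q: "prime_elem q" "q dvd Var i"
    by (rule prime_factor_exists[OF Var_nonzero nonunit])
  from q(2) obtain u where u: "Var i = q * u" ..
  then have nz: "q \<noteq> 0" "u \<noteq> 0" by (metis Var_nonzero mult_zero_left mult_zero_right)+
  have "tdeg q \<noteq> 0"
    using nz(1) Const_dvd_1 prime_elem_not_unit[OF q(1)] by (metis Const_eq_0_iff tdeg_eq_0_imp_Const)
  then have "tdeg u = 0"
    using tdeg_mult[OF nz] t1 u by simp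
  then obtain c where "u = Const c" by (rule tdeg_eq_0_imp_Const)
  then have "u dvd 1" using nz(2) Const_dvd_1 by simp
  then have "q * u dvd q * 1" by (rule mult_dvd_mono[OF dvd_refl])
  then have "Var i dvd q" by (simp add: u)
  then show ?thesis
    using q Var_nonzero nonunit unfolding prime_elem_def by (meson dvd_trans)
qed

lemma Var_not_dvd_Var_power:
  assumes "i \<noteq> j"
  shows "\<not> Var i dvd Var j ^ M"
proof
  assume "Var i dvd Var j ^ M"
  then obtain r where "Var j ^ M = Var i * r" ..
  then have "eval (Var j ^ M) (\<chi> k. if k = i then 0 else 1) = eval (Var i * r) (\<chi> k. if k = i then 0 else 1)"
    by simp
  with assms show False by simp
qed

text \<open>
  The variable \<open>z\<close> is the outermost one of the iterated polynomial ring, and the equation is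
  shifted by \<open>M\<close> there.
\<close>

lemma Var_powers_regular:
  assumes "Var 3 ^ M * c = Var 1 ^ M * p + Var 2 ^ M * q"
  obtains a b where "c = Var 1 ^ M * a + Var 2 ^ M * b"
proof -
  note h = ring_hom_mult[OF ring_hom_to_iterated] ring_hom_add[OF ring_hom_to_iterated]
    ring_hom_power[OF ring_hom_to_iterated]
  note oh = ring_hom_mult[OF ring_hom_of_iterated] ring_hom_add[OF ring_hom_of_iterated]
  have const: "to_iterated (Var 1 ^ M) = [:[:[:0, 1:]:] ^ M:]" "to_iterated (Var 2 ^ M) = [:[:0, 1:] ^ M:]"
    by (simp_all add: h to_iterated_Var poly_const_pow)
  have "monom 1 M * to_iterated c = to_iterated (Var 3 ^ M * c)"
    by (simp add: h to_iterated_Var monom_altdef)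
  also have "\<dots> = [:[:[:0, 1:]:] ^ M:] * to_iterated p + [:[:0, 1:] ^ M:] * to_iterated q"
    unfolding assms h(1,2) const ..
  finally have eq: "monom 1 M * to_iterated c = smult ([:[:0, 1:]:] ^ M) (to_iterated p) + smult ([:0, 1:] ^ M) (to_iterated q)"
    by simp
  \<comment> \<open>Coefficients of index \<open>n + M\<close> are compared. The powers of x and y
    are constants with respect to the outermost variable, so division by z^M becomes
    \<open>poly_shift M\<close> on p and q.\<close>
  have "to_iterated c = [:[:[:0, 1:]:] ^ M:] * poly_shift M (to_iterated p) + [:[:0, 1:] ^ M:] * poly_shift M (to_iterated q)"
  proof (rule poly_eqI)
    fix n
    have "poly.coeff (to_iterated c) n = poly.coeff (monom 1 M * to_iterated c) (n + M)"
      by (simp add: coeff_monom_mult)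
    then show "poly.coeff (to_iterated c) n = poly.coeff ([:[:[:0, 1:]:] ^ M:] * poly_shift M (to_iterated p) + [:[:0, 1:] ^ M:] * poly_shift M (to_iterated q)) n"
      by (simp add: eq coeff_poly_shift)
  qed
  then have "of_iterated (to_iterated c) = of_iterated (to_iterated (Var 1 ^ M) * poly_shift M (to_iterated p) + to_iterated (Var 2 ^ M) * poly_shift M (to_iterated q))"
    by (simp only: const)
  then have "c = Var 1 ^ M * of_iterated (poly_shift M (to_iterated p)) + Var 2 ^ M * of_iterated (poly_shift M (to_iterated q))"
    by (simp only: oh of_to_iterated)
  then show ?thesis by (rule that)
qed

text \<open>
  The vanishing of the first cohomology of line bundles on the projective plane: local solutions \<open>N\<close>
  of \<open>u = N \<times> F\<close> on the three charts differ by multiples of \<open>F\<close>, and this cocycle is a coboundary.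
\<close>

lemma glue_cross:
  assumes F: "\<And>j. homogeneous (int e) (F j)" "finite_zeros F"
    and u: "\<And>j. homogeneous (int (m + e)) (u j)"
    and N: "\<And>i j. homogeneous (int n) (N i j)" "\<And>i j. Var i ^ M * u j = cross (N i) F j"
  obtains N0 where "\<And>j. homogeneous (int m) (N0 j)" "\<And>j. u j = cross N0 F j"
proof -
  \<comment> \<open>Both terms have the cross product \<open>x_i^M x_j^M u\<close> with
    \<open>F\<close>, so the cross product of their difference is zero.\<close>
  have ex: "\<exists>c. \<forall>l. Var j ^ M * N i l - Var i ^ M * N j l = c * F l" for i j
  proof -
    let ?D = "\<lambda>l. Var j ^ M * N i l - Var i ^ M * N j l"
    have "homogeneous (int (M + n)) (?D l)" for l
      using homogeneous_mult[OF homogeneous_Var_power N(1)] by (simp add: homogeneous_diff)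
    moreover have "cross ?D F l = 0" for l
      unfolding cross_diff_scaled N(2)[symmetric] by (simp add: ac_simps)
    ultimately show ?thesis
      using cross_zero_imp_proportional[OF F, of "M + n" ?D] by metis
  qed
  define c where "c i j = (SOME c. \<forall>l. Var j ^ M * N i l - Var i ^ M * N j l = c * F l)" for i j
  have c: "Var j ^ M * N i l - Var i ^ M * N j l = c i j * F l" for i j l
    using someI_ex[OF ex[of j i]] unfolding c_def by (rule spec)
  obtain k where k: "F k \<noteq> 0"
    using F(2) by (rule finite_zeros_nonzero)
  \<comment> \<open>The cocycle condition: after multiplication by \<open>F k\<close> the six terms
    cancel in pairs.\<close>
  have "(Var 3 ^ M * c 1 2 + Var 1 ^ M * c 2 3 + Var 2 ^ M * c 3 1) * F k = 0"
    unfolding distrib_right mult.assoc c[symmetric] by (simp add: algebra_simps)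
  then have "Var 3 ^ M * c 1 2 + Var 1 ^ M * c 2 3 + Var 2 ^ M * c 3 1 = 0"
    using k by (metis mult_eq_0_iff)
  then have "Var 3 ^ M * c 1 2 = Var 1 ^ M * (- c 2 3) + Var 2 ^ M * (- c 3 1)"
    by (simp add: algebra_simps add_eq_0_iff)
  then obtain a b where ab: "c 1 2 = Var 1 ^ M * a + Var 2 ^ M * b"
    by (rule Var_powers_regular)
  \<comment> \<open>Subtracting \<open>b * F l\<close> keeps the cross product with
    \<open>F\<close>, and y^M (N 1 - b F) = x^M (N 2 + a F) makes the corrected solution divisible
    by x^M.\<close>
  have "Var 1 ^ M dvd N 1 l - b * F l" for l
  proof (rule prime_power_dvd_cancel[OF prime_Var])
    show "\<not> Var 1 dvd Var 2 ^ M" by (rule Var_not_dvd_Var_power) simp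
    have "Var 2 ^ M * (N 1 l - b * F l) = Var 1 ^ M * (N 2 l + a * F l)"
      using c[of 2 1 l] by (simp add: ab algebra_simps)
    then show "Var 1 ^ M dvd Var 2 ^ M * (N 1 l - b * F l)" by simp
  qed
  then obtain N' where N': "\<And>l. N 1 l - b * F l = Var 1 ^ M * N' l"
    unfolding dvd_def by metis
  have uN': "u j = cross N' F j" for j
  proof -
    have "Var 1 ^ M * cross N' F j = cross (\<lambda>l. 1 * N 1 l - b * F l) F j"
      by (simp only: cross_scaled[symmetric] N'[symmetric] mult_1)
    also have "\<dots> = cross (N 1) F j"
      unfolding cross_diff_scaled by (simp add: cross_def algebra_simps)
    finally have "Var 1 ^ M * cross N' F j = Var 1 ^ M * u j"
      using N(2) by simp
    then show ?thesis by simp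
  qed
  \<comment> \<open>\<open>N'\<close> is not known to be homogeneous; its part of degree m still
    solves the equation because \<open>u\<close> and \<open>F\<close> are homogeneous.\<close>
  define N0 where "N0 j = poly.coeff (hom_parts (N' j)) m" for j
  have part: "poly.coeff (hom_parts (N' i * F j)) (m + e) = N0 i * F j" for i j
    by (simp only: mult.commute[of _ "F j"] hom_parts_homogeneous_mult[OF F(1)] coeff_monom_mult)
      (simp add: N0_def)
  have "u j = cross N0 F j" for j
  proof -
    have "u j = poly.coeff (hom_parts (u j)) (m + e)"
      using u[of j] by (simp only: homogeneous_iff_hom_parts coeff_monom) simp
    also have "\<dots> = cross N0 F j"
      unfolding uN' by (simp add: cross_def hom_parts_simps(6) part)
    finally show ?thesis .
  qed
  moreover have "homogeneous (int m) (N0 j)" for j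
    unfolding N0_def by (rule homogeneous_hom_part)
  ultimately show ?thesis using that by blast
qed

section \<open>The Jacobian ideal at a node\<close>

definition lin_ideal :: "(3 \<Rightarrow> tpoly) \<Rightarrow> tpoly set" where
  "lin_ideal F = {\<Sum>j\<in>UNIV. c j * F j | c. True}"

lemma poly_ideal_lin_ideal: "poly_ideal (lin_ideal F)"
proof -
  have "0 \<in> lin_ideal F"
    by (auto simp: lin_ideal_def intro!: exI[of _ "\<lambda>_. 0"])
  moreover have "(\<Sum>j\<in>UNIV. a j * F j) + (\<Sum>j\<in>UNIV. b j * F j) \<in> lin_ideal F" for a b
    unfolding lin_ideal_def
    by (auto intro!: exI[of _ "\<lambda>j. a j + b j"] simp: distrib_right sum.distrib)
  moreover have "s * (\<Sum>j\<in>UNIV. a j * F j) \<in> lin_ideal F" for a s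
    unfolding lin_ideal_def
    by (auto intro!: exI[of _ "\<lambda>j. s * a j"] simp: mult.assoc sum_distrib_left)
  ultimately show ?thesis
    unfolding poly_ideal_def by (auto simp: lin_ideal_def)
qed

lemma lin_ideal_base: "F j \<in> lin_ideal F"
proof -
  have "F j = (\<Sum>i\<in>UNIV. (if i = j then 1 else 0) * F i)"
    by (simp add: if_distrib[of "\<lambda>x. x * _"] cong: if_cong)
  then show ?thesis
    unfolding lin_ideal_def by (intro CollectI exI[of _ "\<lambda>i. if i = j then 1 else 0"] conjI TrueI)
qed

lemma tsubst_point_times_Var:
  assumes "homogeneous (int n) p"
  shows "tsubst Const (\<lambda>i. Const (v $ i) * Var k) p = Const (eval p v) * Var k ^ n"
proof -
  let ?h = "\<lambda>q. Const (eval q v)"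
  have h: "is_ring_hom ?h"
    by (rule ring_hom_comp[OF ring_hom_Const ring_hom_eval])
  have "tsubst Const (\<lambda>i. Const (v $ i) * Var k) p = extend_hom ?h (Var k) (hom_parts p)"
    by (rule ring_hom_tpoly_eqI[OF ring_hom_tsubst[OF ring_hom_Const]
          ring_hom_comp[OF ring_hom_extend_hom[OF h] ring_hom_hom_parts]])
      (simp_all add: ring_hom_Const extend_hom_pCons[OF h] extend_hom_0[OF h],
       simp add: extend_hom_def map_poly_monom poly_monom)
  also have "hom_parts p = monom p n"
    using assms by (simp add: homogeneous_iff_hom_parts)
  finally show ?thesis
    by (simp add: extend_hom_def map_poly_monom poly_monom Const_simps)
qed

text \<open>Modulo the linear forms x_i - v_i x_k, the form \<open>p\<close> becomes its value at
  x_k v, that is p(v) x_k^n, which is zero.\<close>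

lemma vanishing_form_in_point_ideal:
  assumes "homogeneous (int n) p" "eval p v = 0"
  shows "p \<in> lin_ideal (\<lambda>i. Var i - Const (v $ i) * Var k)"
  using ideal_tsubst_cong[OF poly_ideal_lin_ideal lin_ideal_base[of "\<lambda>i. Var i - Const (v $ i) * Var k"], of p]
  by (simp add: tsubst_point_times_Var[OF assms(1)] assms(2) Const_simps)

abbreviation hess :: "tpoly \<Rightarrow> complex ^ 3 \<Rightarrow> 3 \<Rightarrow> 3 \<Rightarrow> complex" where
  "hess f v i j \<equiv> eval (pderivative i (pderivative j f)) v"

text \<open>
  At a node the partial derivatives generate the maximal ideal of the local ring, by Cramer's rule.
\<close>

lemma node_jacobian_local:
  fixes v :: "complex ^ 3"
  assumes f: "\<And>j. homogeneous (int e) (pderivative j f)" "\<And>j. eval (pderivative j f) v = 0"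
    and vk: "v $ k = 1"
    and ker: "\<forall>u. (\<forall>i. (\<Sum>j\<in>UNIV. hess f v i j * u $ j) = 0) \<longrightarrow> (\<exists>c. u = c *s v)"
    and g: "homogeneous (int n) g" "eval g v = 0"
  obtains s where "eval s v \<noteq> 0" "s * g \<in> lin_ideal (\<lambda>j. pderivative j f)"
proof -
  obtain p q where pq: "p \<noteq> k" "q \<noteq> k" "p \<noteq> q" "UNIV = {k, p, q}"
    by (rule other_indices)
  \<comment> \<open>Linear forms vanishing at v. The one with index k is zero since v_k = 1, so two
    of them generate all forms vanishing at v.\<close>
  define l where "l i = Var i - Const (v $ i) * Var k" for i
  have lk: "l k = 0" by (simp add: l_def vk Const_simps)
  have sum3: "(\<Sum>i\<in>UNIV. h i) = h k + h p + h q" for h :: "3 \<Rightarrow> 'a::comm_monoid_add"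
    using pq(1-3) by (simp add: pq(4) add.assoc eq_commute)
  have in_l: "r \<in> lin_ideal l" if "homogeneous (int j) r" "eval r v = 0" for j r
    using vanishing_form_in_point_ideal[OF that, of k] by (simp add: l_def[abs_def])
  have "\<exists>a b. r = a * l p + b * l q" if "homogeneous (int j) r" "eval r v = 0" for j r
    using in_l[OF that] unfolding lin_ideal_def by (auto simp: sum3 lk)
  then have dec: "\<exists>a b. r = a * l p + b * l q" if "homogeneous (int j) r" "eval r v = 0" for j r
    using that by blast
  obtain A B where AB: "\<And>j. pderivative j f = A j * l p + B j * l q"
    using dec[OF f] by metis
  obtain a b where g_eq: "g = a * l p + b * l q"
    using dec[OF g] by blast
  have l0: "eval (l i) v = 0" for i
    by (simp add: l_def vk)
  have dl: "pderivative i (l j) = (if i = j then 1 else 0)" if "i \<noteq> k" for i j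
    using that by (simp add: l_def pderivative_diff pderivative_Const_mult pderivative_Var)
  \<comment> \<open>The \<open>l i\<close> vanish at v, so only their derivatives contribute: the
    values of A and B are the rows p and q of the Hessian matrix.\<close>
  have Hp: "hess f v p j = eval (A j) v" and Hq: "hess f v q j = eval (B j) v" for j
    using pq(1-3) by (simp_all add: AB pderivative_add pderivative_mult dl l0)
  \<comment> \<open>If all minors vanish, a nontrivial combination of the rows p and q is zero. It
    yields a nonzero kernel vector with k-th entry 0, which is no multiple of v since v_k =
    1.\<close>
  have "\<exists>i j. eval (A i * B j - A j * B i) v \<noteq> 0"
  proof (rule ccontr)
    assume "\<not> ?thesis"
    then have minors: "eval (A i) v * eval (B j) v = eval (A j) v * eval (B i) v" for i j
      by simp
    obtain x y where xy: "x \<noteq> 0 \<or> y \<noteq> 0" "\<And>j. x * eval (A j) v + y * eval (B j) v = 0"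
    proof (cases "\<forall>j. eval (A j) v = 0")
      case True
      then show ?thesis using that[of 1 0] by simp
    next
      case False
      then obtain i where i: "eval (A i) v \<noteq> 0" by blast
      have "eval (B i) v * eval (A j) v + - eval (A i) v * eval (B j) v = 0" for j
        using minors[of i j] by (simp add: mult.commute)
      with i show ?thesis using that[of "eval (B i) v" "- eval (A i) v"] by simp
    qed
    define u :: "complex ^ 3" where "u = (\<chi> i. if i = p then x else if i = q then y else 0)"
    have "(\<Sum>j\<in>UNIV. hess f v i j * u $ j) = 0" for i
      using xy(2)[of i] pq(1-3) Hp[of i] Hq[of i]
      by (simp add: sum3 u_def pderivative_commute[of i] mult.commute)
    then obtain c where c: "u = c *s v" using ker by blast
    have "u $ k = 0" using pq(1,2) by (auto simp: u_def)
    then have "c = 0" using c vk by simp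
    then have "u = 0" using c by simp
    then have "u $ p = 0" "u $ q = 0" by simp_all
    then show False using xy(1) pq(3) by (auto simp: u_def)
  qed
  then obtain i j where s: "eval (A i * B j - A j * B i) v \<noteq> 0" by blast
  have "(A i * B j - A j * B i) * g =
      (a * B j - b * A j) * pderivative i f + (b * A i - a * B i) * pderivative j f"
    unfolding g_eq AB by (simp add: algebra_simps)
  also have "\<dots> \<in> lin_ideal (\<lambda>j. pderivative j f)"
    by (intro ideal_add ideal_mult poly_ideal_lin_ideal lin_ideal_base[of "\<lambda>j. pderivative j f"])
  finally show ?thesis using s that by blast
qed

text \<open>The vector v lies in the kernel by Euler's identity for the partial derivatives. On the
  complement w_k = 0 the Hessian form is twice the product of two independent linear forms, which is
  nondegenerate.\<close>

lemma node_hessian_kernel: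
  assumes f: "homogeneous (int d) f" "d \<ge> 2" and node: "is_node f P"
  obtains v :: "complex ^ 3" and k where "v \<in> P" "v $ k = 1"
    "\<forall>u. (\<forall>i. (\<Sum>j\<in>UNIV. hess f v i j * u $ j) = 0) \<longrightarrow> (\<exists>c. u = c *s v)"
proof -
  obtain v :: "complex ^ 3" and k a b where v: "v \<in> P" "v $ k = 1"
    and ab: "\<And>w :: complex ^ 3. w $ k = 0 \<Longrightarrow> quadratic_part f v w = linear_form a w * linear_form b w"
    and indep: "\<And>w :: complex ^ 3. w $ k = 0 \<Longrightarrow> linear_form a w = 0 \<Longrightarrow> linear_form b w = 0 \<Longrightarrow> w = 0"
    and sing: "P \<in> singular_points f"
    using node unfolding is_node_def by blast
  have lf_add: "linear_form c (x + y) = linear_form c x + linear_form c y" for c x y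
    by (simp add: linear_form_def distrib_left sum.distrib)
  have lf_scale: "linear_form c (t *s x) = t * linear_form c x" for c x t
    by (simp add: linear_form_def sum_distrib_left ac_simps)
  have hess_v: "(\<Sum>j\<in>UNIV. hess f v i j * v $ j) = 0" for i
  proof -
    obtain n where n: "int d - 1 = int n" using f(2) by (metis Suc_diff_1 int_ops(4) diff_add_cancel gr0I le_zero_eq nat_int of_nat_Suc one_add_one add_diff_cancel_left' plus_1_eq_Suc zero_neq_numeral)
    have "(\<Sum>j\<in>UNIV. v $ j * hess f v j i) = of_nat n * eval (pderivative i f) v"
      using euler_eval[of n "pderivative i f" v] homogeneous_pderivative[OF f(1)] n by simp
    then show ?thesis
      using sing v(1) by (simp add: singular_points_def pderivative_commute[of i] mult.commute)
  qed
  have quad: "2 * quadratic_part f v w = (\<Sum>i\<in>UNIV. \<Sum>j\<in>UNIV. hess f v i j * w $ i * w $ j)" for w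
    by (simp add: quadratic_part_def)
  have "\<exists>c. u = c *s v" if u: "\<And>i. (\<Sum>j\<in>UNIV. hess f v i j * u $ j) = 0" for u
  proof -
    define y where "y = u - u $ k *s v"
    have yk: "y $ k = 0" by (simp add: y_def v(2))
    have Hy: "(\<Sum>j\<in>UNIV. hess f v i j * y $ j) = 0" for i
    proof -
      have "(\<Sum>j\<in>UNIV. hess f v i j * y $ j) =
          (\<Sum>j\<in>UNIV. hess f v i j * u $ j) - u $ k * (\<Sum>j\<in>UNIV. hess f v i j * v $ j)"
        by (simp add: y_def sum_subtractf sum_distrib_left algebra_simps)
      then show ?thesis by (simp add: u hess_v)
    qed
    \<comment> \<open>The polarised quadratic part at w and y; it vanishes because y is in the
      kernel.\<close>
    have bilin: "linear_form a w * linear_form b y + linear_form a y * linear_form b w = 0" if "w $ k = 0" for w :: "complex ^ 3"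
    proof -
      have row: "(\<Sum>i\<in>UNIV. \<Sum>j\<in>UNIV. hess f v i j * x i * y $ j) = 0" for x :: "3 \<Rightarrow> complex"
      proof -
        have "(\<Sum>i\<in>UNIV. \<Sum>j\<in>UNIV. hess f v i j * x i * y $ j) = (\<Sum>i\<in>UNIV. x i * (\<Sum>j\<in>UNIV. hess f v i j * y $ j))"
          by (simp add: sum_distrib_left ac_simps)
        then show ?thesis by (simp add: Hy)
      qed
      have row': "(\<Sum>i\<in>UNIV. \<Sum>j\<in>UNIV. hess f v i j * y $ i * w $ j) = 0"
        using row[of "\<lambda>i. w $ i"] by (subst sum.swap) (simp add: pderivative_commute ac_simps)
      have "2 * quadratic_part f v (w + y) - 2 * quadratic_part f v w - 2 * quadratic_part f v y = 0"
        unfolding quad using row[of "\<lambda>i. w $ i"] row'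
        by (simp add: distrib_left distrib_right sum.distrib)
      then have "2 * (linear_form a w * linear_form b y + linear_form a y * linear_form b w) = 0"
        using ab[of "w + y"] ab[of w] ab[of y] that yk
        by (simp add: lf_add algebra_simps)
      then show ?thesis by (simp only: mult_eq_0_iff) simp
    qed
    have "linear_form a y * linear_form b y = 0"
      using bilin[OF yk] by simp
    \<comment> \<open>On a plane every linear form has a nonzero zero. Where one of the two forms
      vanishes, the other does not, by \<open>indep\<close>; inserting such a w in
      \<open>bilin\<close> isolates one factor.\<close>
    have nontrivial: "\<exists>w :: complex ^ 3. w $ k = 0 \<and> w \<noteq> 0 \<and> linear_form c w = 0" for c
    proof -
      obtain i j where ij: "i \<noteq> k" "j \<noteq> k" "i \<noteq> j"
        by (rule other_indices[of k])
      define x y where "x = (\<chi> l. if l = i then 1 :: complex else 0)" and "y = (\<chi> l. if l = j then 1 :: complex else 0)"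
      show ?thesis
      proof (cases "linear_form c x = 0")
        case True
        moreover have "x $ k = 0" "x $ i = 1" using ij by (auto simp: x_def)
        ultimately show ?thesis by (metis zero_index zero_neq_one)
      next
        case False
        define w where "w = (- linear_form c y) *s x + linear_form c x *s y"
        have "linear_form c w = 0"
          by (simp only: w_def lf_add lf_scale) simp
        moreover have "w $ k = 0" "w $ j = linear_form c x"
          using ij by (auto simp: w_def x_def y_def)
        ultimately show ?thesis using False by (metis zero_index)
      qed
    qed
    have "linear_form a y = 0 \<and> linear_form b y = 0"
    proof (cases "linear_form a y = 0")
      case True
      obtain w where w: "w $ k = 0" "w \<noteq> 0" "linear_form b w = 0" using nontrivial by blast
      then have "linear_form a w \<noteq> 0" using indep by blast
      then show ?thesis using bilin[OF w(1)] True by simp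
    next
      case False
      then have "linear_form b y = 0" using \<open>linear_form a y * linear_form b y = 0\<close> by simp
      obtain w where w: "w $ k = 0" "w \<noteq> 0" "linear_form a w = 0" using nontrivial by blast
      then have "linear_form b w \<noteq> 0" using indep by blast
      then show ?thesis using bilin[OF w(1)] \<open>linear_form b y = 0\<close> by simp
    qed
    then have "y = 0" using indep yk by blast
    then show ?thesis unfolding y_def by (metis eq_iff_diff_eq_0)
  qed
  then show ?thesis using that v by blast
qed

lemma eval_hom_parts_nonzero:
  assumes "eval p v \<noteq> 0"
  obtains n where "eval (poly.coeff (hom_parts p) n) v \<noteq> 0"
proof -
  have "p = (\<Sum>n\<le>degree (hom_parts p). poly.coeff (hom_parts p) n)"
    using poly_hom_parts_1[of p] by (simp add: poly_altdef)
  then have "eval p v = (\<Sum>n\<le>degree (hom_parts p). eval (poly.coeff (hom_parts p) n) v)"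
    using eval_simps(8) by metis
  with assms show ?thesis
    using that by (metis sum.neutral)
qed

text \<open>The ideal of all s with s g in the Jacobian ideal has no zero except the origin: away
  from the singular points a partial derivative is such an s, and at a node
  \<open>node_jacobian_local\<close> supplies one. The Nullstellensatz then gives the power.\<close>

lemma form_through_nodes_power_jacobian:
  assumes f: "homogeneous (int d) f" "d \<ge> 2" and nodal: "\<forall>P\<in>singular_points f. is_node f P"
    and g: "g \<in> forms_through_nodes (int m) f"
  obtains M where "Var i ^ M * g \<in> lin_ideal (\<lambda>j. pderivative j f)"
proof -
  define e where "e = d - 1"
  have e: "int d - 1 = int e" using f(2) by (simp add: e_def)
  have hf: "homogeneous (int e) (pderivative j f)" for j
    using homogeneous_pderivative[OF f(1)] e by simp
  have hg: "homogeneous (int m) g"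
    using g by (simp add: forms_through_nodes_def)
  let ?J = "lin_ideal (\<lambda>j. pderivative j f)"
  define A where "A = {s. s * g \<in> ?J}"
  have A: "poly_ideal A"
    unfolding poly_ideal_def A_def
    by (auto simp: ideal_zero[OF poly_ideal_lin_ideal] distrib_right mult.assoc
        intro: ideal_add[OF poly_ideal_lin_ideal] ideal_mult[OF poly_ideal_lin_ideal])
  have parts: "poly.coeff (hom_parts s) n \<in> A" if s: "s \<in> A" for s n
  proof -
    obtain c where "s * g = (\<Sum>j\<in>UNIV. c j * pderivative j f)"
      using s unfolding A_def lin_ideal_def by blast
    then have "hom_parts (g * s) = (\<Sum>j\<in>UNIV. hom_parts (pderivative j f * c j))"
      by (simp add: hom_parts_simps mult.commute)
    then have "poly.coeff (monom g m * hom_parts s) (n + m) = poly.coeff (\<Sum>j\<in>UNIV. monom (pderivative j f) e * hom_parts (c j)) (n + m)"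
      by (simp only: hom_parts_homogeneous_mult[OF hg] hom_parts_homogeneous_mult[OF hf])
    then have "g * poly.coeff (hom_parts s) n =
        (\<Sum>j\<in>UNIV. pderivative j f * (if n + m < e then 0 else poly.coeff (hom_parts (c j)) (n + m - e)))"
      by (cases "n + m < e") (simp_all add: coeff_sum coeff_monom_mult)
    then have "poly.coeff (hom_parts s) n * g =
        (\<Sum>j\<in>UNIV. (if n + m < e then 0 else poly.coeff (hom_parts (c j)) (n + m - e)) * pderivative j f)"
      by (simp only: mult.commute)
    then show ?thesis
      unfolding A_def lin_ideal_def mem_Collect_eq by (intro exI conjI TrueI)
  qed
  have "v = 0" if v: "\<And>s. s \<in> A \<Longrightarrow> eval s v = 0" for v
  proof (rule ccontr)
    assume "v \<noteq> 0"
    have "pderivative j f \<in> A" for j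
      using ideal_mult[OF poly_ideal_lin_ideal lin_ideal_base[of "\<lambda>j. pderivative j f"], of g]
      by (simp add: A_def mult.commute)
    then have crit: "eval (pderivative j f) v = 0" for j
      by (rule v)
    have crit': "eval (pderivative j f) w = 0" if "w \<in> proj_point v" for j w
      using that crit eval_zero_proj_point[OF hf] by blast
    moreover have "eval f w = 0" if "w \<in> proj_point v" for w
      using euler_eval[OF f(1), of w] f(2) crit'[OF that] by simp
    ultimately have sing: "proj_point v \<in> singular_points f"
      using proj_point_in_P2[OF \<open>v \<noteq> 0\<close>] by (auto simp: singular_points_def curve_points_def common_zeros_def)
    then have node: "is_node f (proj_point v)" using nodal by blast
    obtain w :: "complex ^ 3" and k where w: "w \<in> proj_point v" "w $ k = 1"
      and ker: "\<forall>u. (\<forall>i. (\<Sum>j\<in>UNIV. hess f w i j * u $ j) = 0) \<longrightarrow> (\<exists>c. u = c *s w)"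
      by (rule node_hessian_kernel[OF f node])
    have "eval g w = 0"
      using g node w(1) by (auto simp: forms_through_nodes_def nodes_def)
    then obtain s where s: "eval s w \<noteq> 0" "s * g \<in> ?J"
      using node_jacobian_local[OF hf crit'[OF w(1)] w(2) ker hg] by blast
    \<comment> \<open>Nonvanishing of the inhomogeneous s at w need not pass to the representative v
      of the same point; for a homogeneous part it does.\<close>
    obtain n where n: "eval (poly.coeff (hom_parts s) n) w \<noteq> 0"
      using s(1) by (rule eval_hom_parts_nonzero)
    have "eval (poly.coeff (hom_parts s) n) v = 0"
      using s(2) by (intro v parts) (simp add: A_def)
    then show False
      using n eval_zero_proj_point[OF homogeneous_hom_part w(1)] by blast
  qed
  then have "\<And>v. (\<And>s. s \<in> A \<Longrightarrow> eval s v = 0) \<Longrightarrow> eval (Var i) v = 0"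
    by fastforce
  then obtain M where "Var i ^ M \<in> A"
    using homogeneous_nullstellensatz[OF A parts, of 1 "Var i"] by auto
  then show ?thesis using that by (simp add: A_def)
qed

text \<open>By Euler's identity a common zero of the partial derivatives lies on the curve, hence is
  a node, and every node is a base point.\<close>

lemma finite_base_locus_finite_zeros:
  assumes f: "homogeneous (int d) f" "d \<ge> 2" and nodal: "\<forall>P\<in>singular_points f. is_node f P"
    and fin: "finite (base_locus m f)"
  shows "finite_zeros (\<lambda>j. pderivative j f)"
proof -
  have "{P \<in> P2. \<forall>v\<in>P. \<forall>j. eval (pderivative j f) v = 0} \<subseteq> base_locus m f"
  proof
    fix P assume P: "P \<in> {P \<in> P2. \<forall>v\<in>P. \<forall>j. eval (pderivative j f) v = 0}"
    have "eval f v = 0" if "v \<in> P" for v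
      using euler_eval[OF f(1), of v] f(2) P that by simp
    then have "P \<in> singular_points f"
      using P by (auto simp: singular_points_def curve_points_def common_zeros_def)
    then have "is_node f P" using nodal by blast
    then show "P \<in> base_locus m f"
      using P by (auto simp: base_locus_def common_zeros_def forms_through_nodes_def nodes_def)
  qed
  then show ?thesis
    unfolding finite_zeros_def using fin finite_subset by blast
qed

text \<open>Let x_i^M g be the scalar product of a triple c_i with the gradient. As \<open>w\<close>
  is orthogonal to the gradient, \<open>cross_cross\<close> shows that the cross product of c_i and
  \<open>w\<close> solves the equation for x_i^M g w. The three solutions are glued by
  \<open>glue_cross\<close>.\<close>

lemma form_through_nodes_times_syzygy:
  assumes f: "homogeneous (int d) f" "d \<ge> 2" and nodal: "\<forall>P\<in>singular_points f. is_node f P"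
    and fin: "finite_zeros (\<lambda>j. pderivative j f)"
    and g: "g \<in> forms_through_nodes (int m) f" and w: "w \<in> syzygies f (d - 1)"
  obtains N where "\<And>j. homogeneous (int m) (N j)" "\<And>j. g * w j = cross N (\<lambda>j. pderivative j f) j"
proof -
  let ?F = "\<lambda>j. pderivative j f"
  let ?e = "d - 1"
  have hf: "homogeneous (int ?e) (?F j)" for j
    using homogeneous_pderivative[OF f(1), of j] f(2) by (simp add: of_nat_diff)
  have hg: "homogeneous (int m) g"
    using g by (simp add: forms_through_nodes_def)
  have hw: "homogeneous (int ?e) (w j)" for j
    using w by (simp add: syzygies_def)
  have w_syz: "(\<Sum>j\<in>UNIV. w j * ?F j) = 0"
    using w by (simp add: syzygies_def)
  have "\<exists>M. Var i ^ M * g \<in> lin_ideal ?F" for i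
    using form_through_nodes_power_jacobian[OF f nodal g] by metis
  then obtain K where K: "\<And>i. Var i ^ K i * g \<in> lin_ideal ?F"
    by metis
  \<comment> \<open>One exponent for all three variables. The summand \<open>?e\<close> guarantees M
    + m >= d - 1, so that the truncated difference \<open>M + m - ?e\<close> is exact.\<close>
  define M where "M = K 1 + K 2 + K 3 + ?e"
  have "Var i ^ M * g \<in> lin_ideal ?F" for i
  proof -
    have "M = (M - K i) + K i"
      using exhaust_3[of i] by (auto simp: M_def)
    then have "Var i ^ M * g = Var i ^ (M - K i) * (Var i ^ K i * g)"
      by (metis mult.assoc power_add)
    then show ?thesis using ideal_mult[OF poly_ideal_lin_ideal K] by metis
  qed
  then have "\<exists>c. Var i ^ M * g = (\<Sum>j\<in>UNIV. c j * ?F j)" for i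
    unfolding lin_ideal_def by blast
  then obtain C where C: "\<And>i. Var i ^ M * g = (\<Sum>j\<in>UNIV. C i j * ?F j)"
    by metis
  define c where "c i j = poly.coeff (hom_parts (C i j)) (M + m - ?e)" for i j
  have hc: "homogeneous (int (M + m - ?e)) (c i j)" for i j
    unfolding c_def by (rule homogeneous_hom_part)
  have c: "Var i ^ M * g = (\<Sum>j\<in>UNIV. c i j * ?F j)" for i
  proof -
    have "homogeneous (int (M + m)) (Var i ^ M * g)"
      using homogeneous_mult[OF homogeneous_Var_power hg] by simp
    then have "Var i ^ M * g = poly.coeff (hom_parts (Var i ^ M * g)) (M + m)"
      by (simp only: homogeneous_iff_hom_parts coeff_monom) simp
    also have "\<dots> = (\<Sum>j\<in>UNIV. poly.coeff (hom_parts (?F j * C i j)) (M + m))"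
      unfolding C hom_parts_simps(8) coeff_sum by (simp add: mult.commute)
    also have "\<dots> = (\<Sum>j\<in>UNIV. ?F j * c i j)"
    proof (rule sum.cong[OF refl])
      have "\<not> M + m < ?e" by (simp add: M_def)
      then show "poly.coeff (hom_parts (?F j * C i j)) (M + m) = ?F j * c i j" for j
        unfolding hom_parts_homogeneous_mult[OF hf] by (simp add: coeff_monom_mult c_def)
    qed
    finally show ?thesis by (simp only: mult.commute)
  qed
  show ?thesis
  proof (rule glue_cross[of ?e ?F m "\<lambda>j. g * w j" "M + m" "\<lambda>i. cross (c i) w" M])
    show "homogeneous (int (m + ?e)) (g * w j)" for j
      using homogeneous_mult[OF hg hw] by simp
    show "homogeneous (int (M + m)) (cross (c i) w j)" for i j
    proof -
      have "homogeneous (int (M + m)) (c i a * w b)" for a b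
        using homogeneous_mult[OF hc hw, of i a b] by (simp add: M_def algebra_simps)
      then show ?thesis by (simp add: cross_def homogeneous_diff)
    qed
    show "Var i ^ M * (g * w j) = cross (cross (c i) w) ?F j" for i j
      unfolding cross_cross w_syz c[symmetric] by (simp add: ac_simps)
  qed (use hf fin that in auto)
qed

text \<open>
  The degree bound \<open>2 m < d - 1\<close> excludes corrections by multiples of the gradient, such that the
  triples of the previous lemma are proportional to \<open>g\<close>.
\<close>

lemma syzygies_koszul:
  assumes f: "homogeneous (int d) f" "d \<ge> 2" and nodal: "\<forall>P\<in>singular_points f. is_node f P"
    and m: "2 * m < d - 1" and fin: "finite (base_locus (int m) f)" and w: "w \<in> syzygies f (d - 1)"
  obtains a where "\<And>j. w j = cross (\<lambda>j. Const (a j)) (\<lambda>j. pderivative j f) j"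
proof -
  let ?F = "\<lambda>j. pderivative j f"
  let ?I = "forms_through_nodes (int m) f"
  note finF = finite_base_locus_finite_zeros[OF f nodal fin]
  have hf: "homogeneous (int (d - 1)) (?F j)" for j
    using homogeneous_pderivative[OF f(1), of j] f(2) by (simp add: of_nat_diff)
  have hom: "homogeneous (int m) g" if "g \<in> ?I" for g
    using that by (simp add: forms_through_nodes_def)
  have "\<exists>N. (\<forall>j. homogeneous (int m) (N j)) \<and> (\<forall>j. g * w j = cross N ?F j)" if "g \<in> ?I" for g
    using form_through_nodes_times_syzygy[OF f nodal finF that w] by metis
  then obtain N where N: "\<And>g j. g \<in> ?I \<Longrightarrow> homogeneous (int m) (N g j)"
      "\<And>g j. g \<in> ?I \<Longrightarrow> g * w j = cross (N g) ?F j"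
    by metis
  have proportional: "h * N g j = g * N h j" if "g \<in> ?I" "h \<in> ?I" for g h j
  proof -
    let ?D = "\<lambda>j. h * N g j - g * N h j"
    have "homogeneous (int (2 * m)) (?D j)" for j
    proof -
      have "int (2 * m) = int m + int m" by simp
      then show ?thesis
        by (simp only:) (rule homogeneous_diff[OF homogeneous_mult[OF hom[OF that(2)] N(1)[OF that(1)]]
          homogeneous_mult[OF hom[OF that(1)] N(1)[OF that(2)]]])
    qed
    moreover have "cross ?D ?F j = 0" for j
      unfolding cross_diff_scaled N(2)[OF that(1), symmetric] N(2)[OF that(2), symmetric]
      by (simp add: ac_simps)
    ultimately obtain c where c: "homogeneous (int (2 * m) - int (d - 1)) c" "\<And>j. ?D j = c * ?F j"
      by (rule cross_zero_imp_proportional[OF hf finF]) blast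
    have "c = 0"
      by (rule homogeneous_negative[OF c(1)]) (use m in linarith)
    with c(2)[of j] show ?thesis by simp
  qed
  have dense: "\<exists>h\<in>?I. eval h v \<noteq> 0" if "v \<noteq> 0" "proj_point v \<notin> base_locus (int m) f" for v
    using that proj_point_in_P2[OF that(1)] eval_zero_proj_point[OF hom]
    unfolding base_locus_def common_zeros_def by blast
  have "\<not> P2 \<subseteq> base_locus (int m) f"
    using infinite_P2 fin finite_subset by blast
  then obtain P where "P \<in> P2" "P \<notin> base_locus (int m) f"
    by blast
  then obtain g where g: "g \<in> ?I" "g \<noteq> 0"
    using dense by (metis P2_nonempty_point eval_simps(2))
  \<comment> \<open>By proportionality every h in the system is a denominator of the fraction N g /
    g, so poles could only lie in the base locus.\<close>
  have "g dvd N g j" for j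
  proof (rule dvd_off_finite[OF g(2) hom[OF g(1)] N(1)[OF g(1)] fin])
    fix v :: "complex ^ 3" assume "v \<noteq> 0" "proj_point v \<notin> base_locus (int m) f"
    then obtain h where h: "h \<in> ?I" "eval h v \<noteq> 0" using dense by blast
    have "N g j * h = g * N h j"
      using proportional[OF g(1) h(1), of j] by (simp only: mult.commute)
    then have "g dvd N g j * h" by (rule dvdI)
    with h(2) show "\<exists>s. eval s v \<noteq> 0 \<and> g dvd N g j * s" by blast
  qed
  then obtain M where M: "\<And>j. N g j = g * M j"
    unfolding dvd_def by metis
  have "homogeneous 0 (M j)" for j
    using homogeneous_cofactor[OF hom[OF g(1)] g(2), of 0 "M j"] N(1)[OF g(1), of j] by (simp add: M)
  then have "\<exists>c. M j = Const c" for j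
    by (rule homogeneous_0_imp_Const[of "M j"]) blast
  then obtain a where a: "\<And>j. M j = Const (a j)"
    by metis
  show ?thesis
  proof (rule that)
    fix j
    have "N g = (\<lambda>j. g * Const (a j))" using M a by auto
    then have "g * w j = g * cross (\<lambda>j. Const (a j)) ?F j"
      using N(2)[OF g(1), of j] by (simp only: cross_scaled)
    then show "w j = cross (\<lambda>j. Const (a j)) ?F j"
      using g(2) by simp
  qed
qed

section \<open>Reconstruction of the curve\<close>

lemma hess_times_point:
  assumes "homogeneous (int d) f" "d \<ge> 1"
  shows "(\<Sum>j\<in>UNIV. hess f v i j * v $ j) = of_nat (d - 1) * eval (pderivative i f) v"
proof -
  have "homogeneous (int (d - 1)) (pderivative i f)"
    using homogeneous_pderivative[OF assms(1), of i] assms(2) by (simp add: of_nat_diff)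
  from euler_eval[OF this, of v] show ?thesis
    by (simp add: pderivative_commute[of i] mult.commute)
qed

lemma homogeneous_pderivative_nat:
  assumes "homogeneous (int (Suc n)) p"
  shows "homogeneous (int n) (pderivative i p)"
  using homogeneous_pderivative[OF assms, of i] by simp

text \<open>Euler's identity at \<open>w\<close> itself: the derivative in the direction
  \<open>w\<close>, evaluated at \<open>w\<close>, is n p(w).\<close>

lemma directional_derivative_zero:
  assumes p: "homogeneous (int n) p" "n > 0"
    and zero: "(\<Sum>i\<in>UNIV. Const (w $ i) * pderivative i p) = 0"
  shows "eval p w = 0"
proof -
  have "of_nat n * eval p w = (\<Sum>i\<in>UNIV. w $ i * eval (pderivative i p) w)"
    using euler_eval[OF p(1)] by simp
  also have "\<dots> = eval (\<Sum>i\<in>UNIV. Const (w $ i) * pderivative i p) w"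
    by simp
  also have "\<dots> = 0"
    unfolding zero by simp
  finally show ?thesis using p(2) by simp
qed

lemma directional_derivative_pderivative:
  assumes "(\<Sum>i\<in>UNIV. Const (w $ i) * pderivative i p) = 0"
  shows "(\<Sum>i\<in>UNIV. Const (w $ i) * pderivative i (pderivative c p)) = 0"
proof -
  have "pderivative c (\<Sum>i\<in>UNIV. Const (w $ i) * pderivative i p) = 0"
    by (simp add: assms)
  then show ?thesis
    by (simp add: pderivative_sum pderivative_Const_mult pderivative_commute[of c])
qed

text \<open>
  If the gradients of \<open>f\<close> and \<open>f'\<close> span the same space, \<open>\<nabla>f' = A \<nabla>f\<close> with constant \<open>A\<close>, then a node \<open>w\<close>
  of \<open>f\<close> is an eigenvector of the transpose of \<open>A\<close>, because \<open>A Hess f(w)\<close> is symmetric. After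
  subtracting a multiple of \<open>f\<close> from \<open>f'\<close> the eigenvalue is zero, so \<open>f'\<close> is a cone with vertex \<open>w\<close>;
  in degree at least four, this forces \<open>A = 0\<close>.
\<close>

lemma gradient_determines_nodal_curve:
  fixes w :: "complex ^ 3"
  assumes f: "homogeneous (int d) f" and f': "homogeneous (int d) f'" and d: "d \<ge> 4"
    and A: "\<And>i. pderivative i f' = (\<Sum>j\<in>UNIV. Const (A i j) * pderivative j f)"
    and crit: "\<And>j. eval (pderivative j f) w = 0"
    and ker: "\<forall>u. (\<forall>i. (\<Sum>j\<in>UNIV. hess f w i j * u $ j) = 0) \<longrightarrow> (\<exists>c. u = c *s w)"
  obtains c where "f' = Const c * f"
proof -
  have hf: "homogeneous (int (d - 1)) (pderivative i f)"
    and hff: "homogeneous (int (d - 2)) (pderivative i (pderivative j f))" for i j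
  proof -
    have "d = Suc (d - 1)" "d - 1 = Suc (d - 2)" using d by simp_all
    then show "homogeneous (int (d - 1)) (pderivative i f)"
      "homogeneous (int (d - 2)) (pderivative i (pderivative j f))"
      using f homogeneous_pderivative_nat by metis+
  qed
  have Hw: "(\<Sum>j\<in>UNIV. hess f w i j * w $ j) = 0" for i
    using hess_times_point[OF f, where v = w and i = i] d crit by simp
  have sym: "(\<Sum>j\<in>UNIV. A i j * hess f w k j) = (\<Sum>j\<in>UNIV. A k j * hess f w i j)" for i k
  proof -
    have "eval (pderivative k (pderivative i f')) w = eval (pderivative i (pderivative k f')) w"
      by (simp add: pderivative_commute)
    then show ?thesis
      by (simp add: A pderivative_sum pderivative_Const_mult)
  qed
  define u :: "complex ^ 3" where "u = (\<chi> j. \<Sum>i\<in>UNIV. A i j * w $ i)"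
  \<comment> \<open>With H the Hessian matrix of f at w and A^T the transpose of A,
    \<open>sym\<close> says H A^T = A H; hence H u = H A^T w = A H w = 0.\<close>
  have "(\<Sum>j\<in>UNIV. hess f w k j * u $ j) = 0" for k
  proof -
    have "(\<Sum>j\<in>UNIV. hess f w k j * u $ j) = (\<Sum>j\<in>UNIV. \<Sum>i\<in>UNIV. w $ i * (A i j * hess f w k j))"
      by (simp add: u_def sum_distrib_left ac_simps)
    also have "\<dots> = (\<Sum>i\<in>UNIV. w $ i * (\<Sum>j\<in>UNIV. A i j * hess f w k j))"
      by (subst sum.swap) (simp add: sum_distrib_left)
    also have "\<dots> = (\<Sum>i\<in>UNIV. \<Sum>j\<in>UNIV. A k j * (hess f w j i * w $ i))"
      unfolding sym[of _ k] by (simp add: sum_distrib_left pderivative_commute ac_simps)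
    also have "\<dots> = (\<Sum>j\<in>UNIV. A k j * (\<Sum>i\<in>UNIV. hess f w j i * w $ i))"
      by (subst sum.swap) (simp add: sum_distrib_left)
    finally show ?thesis by (simp add: Hw)
  qed
  then obtain ev where ev: "u = ev *s w" using ker by blast
  define D where "D i j = A i j - (if i = j then ev else 0)" for i j
  define g where "g = f' - Const ev * f"
  have g_hom: "homogeneous (int d) g"
    unfolding g_def by (intro homogeneous_diff homogeneous_Const_mult f f')
  have gi: "pderivative i g = (\<Sum>j\<in>UNIV. Const (D i j) * pderivative j f)" for i
  proof -
    have "(\<Sum>j\<in>UNIV. Const (D i j) * pderivative j f) =
        (\<Sum>j\<in>UNIV. Const (A i j) * pderivative j f) - (\<Sum>j\<in>UNIV. if i = j then Const ev * pderivative j f else 0)"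
      unfolding sum_subtractf[symmetric]
      by (intro sum.cong refl) (auto simp: D_def Const_simps algebra_simps)
    then show ?thesis
      by (simp add: g_def pderivative_diff pderivative_Const_mult A)
  qed
  have Dw: "(\<Sum>i\<in>UNIV. D i j * w $ i) = 0" for j
  proof -
    have "(\<Sum>i\<in>UNIV. D i j * w $ i) = (\<Sum>i\<in>UNIV. A i j * w $ i) - (\<Sum>i\<in>UNIV. if i = j then ev * w $ i else 0)"
      unfolding sum_subtractf[symmetric]
      by (intro sum.cong refl) (auto simp: D_def algebra_simps)
    also have "(\<Sum>i\<in>UNIV. A i j * w $ i) = u $ j" by (simp add: u_def)
    finally show ?thesis by (simp add: ev)
  qed
  have "(\<Sum>i\<in>UNIV. Const (w $ i) * pderivative i g) =
      (\<Sum>j\<in>UNIV. \<Sum>i\<in>UNIV. Const (D i j * w $ i) * pderivative j f)"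
    unfolding gi sum_distrib_left by (subst sum.swap) (simp add: Const_simps ac_simps)
  also have "\<dots> = (\<Sum>j\<in>UNIV. Const (\<Sum>i\<in>UNIV. D i j * w $ i) * pderivative j f)"
    by (simp only: Const_simps(8) sum_distrib_right)
  finally have wg: "(\<Sum>i\<in>UNIV. Const (w $ i) * pderivative i g) = 0"
    unfolding Dw by (simp add: Const_simps)
  \<comment> \<open>The second derivatives of the cone g vanish at its vertex w, since their degree
    d - 2 is positive. So the rows of D lie in the kernel of the Hessian matrix of f.\<close>
  have "\<exists>b. (\<chi> j. D k j) = b *s w" for k
  proof -
    have "(\<Sum>j\<in>UNIV. hess f w c j * (\<chi> j. D k j) $ j) = 0" for c
    proof -
      have "eval (pderivative c (pderivative k g)) w = 0"
      proof (rule directional_derivative_zero)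
        have "homogeneous (int (d - 1)) (pderivative k g)"
          unfolding gi by (intro homogeneous_sum homogeneous_Const_mult hf)
        moreover have "d - 1 = Suc (d - 2)" using d by simp
        ultimately show "homogeneous (int (d - 2)) (pderivative c (pderivative k g))"
          using homogeneous_pderivative_nat by metis
        show "d - 2 > 0" using d by simp
      qed (intro directional_derivative_pderivative wg)
      then have "(\<Sum>j\<in>UNIV. D k j * hess f w c j) = 0"
        by (simp add: gi pderivative_sum pderivative_Const_mult)
      then show ?thesis by (simp add: mult.commute)
    qed
    then show ?thesis using ker by blast
  qed
  then obtain b where b: "\<And>k. (\<chi> j. D k j) = b k *s w"
    by metis
  have D_eq: "D k j = b k * w $ j" for k j
    using arg_cong[OF b[of k], of "\<lambda>v. v $ j"] by simp
  have "b k = 0" for k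
  proof (rule ccontr)
    assume "b k \<noteq> 0"
    \<comment> \<open>The derivative of f in the direction w. It is proportional to a partial
      derivative of the cone g, so its own derivative in the direction w vanishes.\<close>
    define E where "E = (\<Sum>j\<in>UNIV. Const (w $ j) * pderivative j f)"
    have "pderivative k g = Const (b k) * E"
      by (simp add: gi D_eq E_def Const_simps sum_distrib_left mult.assoc)
    moreover have "(\<Sum>i\<in>UNIV. Const (w $ i) * pderivative i (pderivative k g)) = 0"
      by (rule directional_derivative_pderivative[OF wg])
    ultimately have "Const (b k) * (\<Sum>i\<in>UNIV. Const (w $ i) * pderivative i E) = 0"
      by (simp add: pderivative_Const_mult sum_distrib_left mult.left_commute)
    then have wE: "(\<Sum>i\<in>UNIV. Const (w $ i) * pderivative i E) = 0"
      using \<open>b k \<noteq> 0\<close> by (simp only: mult_eq_0_iff Const_eq_0_iff) simp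
    \<comment> \<open>Euler's identity is used twice at w: the second derivatives of E vanish there,
      as their degree d - 3 is positive by d >= 4, and they equal d - 2 times the Hessian entries of
      f.\<close>
    have H0: "hess f w a c = 0" for a c
    proof -
      have E_ac: "pderivative a (pderivative c E) = (\<Sum>j\<in>UNIV. Const (w $ j) * pderivative j (pderivative a (pderivative c f)))"
      proof -
        have "pderivative a (pderivative c (pderivative j f)) = pderivative j (pderivative a (pderivative c f))" for j
          unfolding pderivative_commute[of c j] by (rule pderivative_commute)
        then show ?thesis
          by (simp add: E_def pderivative_sum pderivative_Const_mult)
      qed
      have dn: "d - 2 = Suc (d - 3)" using d by simp
      have "homogeneous (int (d - 3)) (pderivative j (pderivative a (pderivative c f)))" for j
        using hff[of a c] homogeneous_pderivative_nat unfolding dn by blast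
      then have "homogeneous (int (d - 3)) (pderivative a (pderivative c E))"
        unfolding E_ac by (intro homogeneous_sum homogeneous_Const_mult)
      then have "eval (pderivative a (pderivative c E)) w = 0"
        by (rule directional_derivative_zero)
          (use d in \<open>simp_all add: directional_derivative_pderivative wE\<close>)
      then have "(\<Sum>j\<in>UNIV. w $ j * eval (pderivative j (pderivative a (pderivative c f))) w) = 0"
        by (simp add: E_ac)
      then have "of_nat (d - 2) * hess f w a c = 0"
        using euler_eval[OF hff[of a c], of w] by (simp only:)
      moreover have "(of_nat (d - 2) :: complex) \<noteq> 0"
        unfolding of_nat_eq_0_iff using d by simp
      ultimately show ?thesis
        by (metis mult_eq_0_iff)
    qed
    then have "\<exists>c. u = c *s w" for u
      using ker by simp
    then obtain c c' where c: "axis 1 1 = c *s w" "axis 2 1 = c' *s w"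
      by metis
    have "axis 1 (1 :: complex) $ (1 :: 3) = c * w $ 1" "axis 1 (1 :: complex) $ (2 :: 3) = c * w $ 2"
      "axis 2 (1 :: complex) $ (2 :: 3) = c' * w $ 2"
      unfolding c by simp_all
    then show False by (auto simp: axis_def)
  qed
  then have "pderivative i g = 0" for i
    by (simp add: gi D_eq Const_simps)
  then have "of_nat d * g = 0"
    using euler[OF g_hom] by simp
  then have "g = 0"
    using d by (simp add: of_nat_eq_Const)
  then show ?thesis
    using that[of ev] by (simp add: g_def)
qed

text \<open>Euler's identity gives f = q r, where q does not divide r. Then q divides its own
  partial derivatives, so they vanish and q is constant.\<close>

lemma prime_dvd_gradient_not_squarefree:
  assumes f: "homogeneous (int d) f" "d \<ge> 1" "squarefree f"
    and q: "prime_elem q" "\<And>i. q dvd pderivative i f"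
  shows False
proof -
  have "q dvd (\<Sum>i\<in>UNIV. Var i * pderivative i f)"
    by (intro dvd_sum dvd_mult q)
  then have "q dvd Const (of_nat d) * f"
    by (simp add: euler[OF f(1)] of_nat_eq_Const)
  moreover have "\<not> q dvd Const (of_nat d)"
  proof
    assume "q dvd Const (of_nat d)"
    also have "Const (of_nat d) dvd 1"
      by (rule Const_dvd_1) (use f(2) in simp)
    finally show False using prime_elem_not_unit[OF q(1)] by simp
  qed
  ultimately have "q dvd f"
    using prime_elem_dvd_mult_iff[OF q(1)] by blast
  then obtain r where r: "f = q * r" ..
  have not_q: "\<not> q dvd r"
  proof
    assume "q dvd r"
    then have "q ^ 2 dvd f"
      by (simp add: r power2_eq_square)
    then show False
      using f(3) prime_elem_not_unit[OF q(1)] by (auto simp: squarefree_def)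
  qed
  have "pderivative i q = 0" for i
  proof (rule dvd_pderivative_imp_zero)
    have "q dvd pderivative i q * r + q * pderivative i r"
      using q(2)[of i] by (simp add: r pderivative_mult)
    then have "q dvd pderivative i q * r"
      using dvd_add_left_iff[of q "q * pderivative i r"] by simp
    then show "q dvd pderivative i q"
      using prime_elem_dvd_mult_iff[OF q(1)] not_q by blast
  qed
  then obtain c where "q = Const c"
    by (rule pderivatives_zero_imp_Const)
  then show False
    using q(1) Const_dvd_1[of c] by (auto simp: prime_elem_def)
qed

section \<open>The isomorphism as a constant matrix\<close>

definition basis_vec :: "3 \<Rightarrow> 3 \<Rightarrow> tpoly" where
  "basis_vec a j = (if j = a then 1 else 0)"

lemma cross_expand: "cross u b i = (\<Sum>a\<in>UNIV. u a * cross (basis_vec a) b i)"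
  using exhaust_3[of i] by (auto simp: cross_def sum_3 basis_vec_def)

text \<open>The scalar triple product is alternating. Orthogonality of \<open>u\<close> to the three
  Koszul syzygies of \<open>b\<close> thus means that the cross product of \<open>u\<close> and
  \<open>b\<close> is zero.\<close>

lemma cross_transpose: "cross u b a = - (\<Sum>j\<in>UNIV. u j * cross (basis_vec a) b j)"
  using exhaust_3[of a] by (auto simp: cross_def sum_3 basis_vec_def)

lemma cross_orthogonal: "(\<Sum>i\<in>UNIV. cross a b i * b i) = 0"
  by (simp add: cross_def sum_3 algebra_simps)

lemma cross_self: "cross b b i = 0"
  by (simp add: cross_def)

lemma homogeneous_cross:
  assumes "\<And>j. homogeneous k (u j)" "\<And>j. homogeneous l (b j)"
  shows "homogeneous (k + l) (cross u b i)"
  unfolding cross_def by (simp add: homogeneous_diff homogeneous_mult assms)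

lemma homogeneous_basis_vec: "homogeneous 0 (basis_vec a j)"
  using homogeneous_Const[of 1] by (simp add: basis_vec_def Const_simps)

lemma koszul_syzygy:
  assumes "homogeneous (int d) f" "d \<ge> 1"
  shows "cross (basis_vec a) (\<lambda>j. pderivative j f) \<in> syzygies f (d - 1)"
proof -
  have "homogeneous (int (d - 1)) (pderivative j f)" for j
    using homogeneous_pderivative[OF assms(1), of j] assms(2) by (simp add: of_nat_diff)
  then have "homogeneous (int (d - 1)) (cross (basis_vec a) (\<lambda>j. pderivative j f) i)" for i
    using homogeneous_cross[of 0 "basis_vec a" "int (d - 1)" "\<lambda>j. pderivative j f" i, OF homogeneous_basis_vec] by simp
  then show ?thesis
    by (simp add: syzygies_def cross_orthogonal)
qed

definition mat_apply :: "(3 \<Rightarrow> 3 \<Rightarrow> complex) \<Rightarrow> (3 \<Rightarrow> tpoly) \<Rightarrow> 3 \<Rightarrow> tpoly" where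
  "mat_apply b s i = (\<Sum>j\<in>UNIV. Const (b i j) * s j)"

text \<open>
  Since every syzygy of degree \<open>d - 1\<close> is a constant combination of the Koszul syzygies, so are the
  components of their images, which makes the isomorphism of syzygy modules a constant matrix.
\<close>

lemma syzygy_isomorphism_constant:
  assumes f: "homogeneous (int d) f" "d \<ge> 1" "pderivative l f \<noteq> 0"
    and koszul: "\<And>w. w \<in> syzygies f (d - 1) \<Longrightarrow> \<exists>a. \<forall>j. w j = cross (\<lambda>j. Const (a j)) (\<lambda>j. pderivative j f) j"
    and iso: "sheaf_isomorphic (log_vector_fields f') (log_vector_fields f)"
  obtains b where "\<forall>k. \<forall>s\<in>syzygies f k. mat_apply b s \<in> syzygies f' k"
    "\<forall>k. \<forall>t\<in>syzygies f' k. \<exists>s\<in>syzygies f k. t = mat_apply b s"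
proof -
  obtain R :: "nat \<Rightarrow> (3 \<Rightarrow> tpoly) \<Rightarrow> (3 \<Rightarrow> tpoly) \<Rightarrow> bool" where
    R: "\<forall>k. \<forall>s\<in>syzygies f' k. \<exists>t\<in>syzygies f k. R k s t"
      "\<forall>k. \<forall>t\<in>syzygies f k. \<exists>s\<in>syzygies f' k. R k s t"
      "\<forall>k s t s' t'. R k s t \<longrightarrow> R k s' t' \<longrightarrow> R k (\<lambda>i. s i + s' i) (\<lambda>i. t i + t' i)"
      "\<forall>k s t e c. R k s t \<longrightarrow> homogeneous (int e) c \<longrightarrow> R (k + e) (\<lambda>i. c * s i) (\<lambda>i. c * t i)"
      "\<forall>k s t. R k s t \<longrightarrow> (s = (\<lambda>_. 0) \<longleftrightarrow> t = (\<lambda>_. 0))"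
    by (rule sheaf_isomorphic_imp_syzygies[OF iso])
  note R1 = R(1)[rule_format] and R2 = R(2)[rule_format] and R_add = R(3)[rule_format]
    and R_mult = R(4)[rule_format] and R_zero = R(5)[rule_format]
  let ?F = "\<lambda>j. pderivative j f"
  have hF: "homogeneous (int (d - 1)) (?F j)" for j
    using homogeneous_pderivative[OF f(1), of j] f(2) by (simp add: of_nat_diff)
  define K where "K a = cross (basis_vec a) ?F" for a
  have "\<exists>t\<in>syzygies f' (d - 1). R (d - 1) t (K a)" for a
    unfolding K_def by (rule R2[OF koszul_syzygy[OF f(1,2)]])
  then obtain T where T: "\<And>a. T a \<in> syzygies f' (d - 1)" "\<And>a. R (d - 1) (T a) (K a)"
    by metis
  have R_sum: "R (k + e) (\<lambda>i. \<Sum>a\<in>UNIV. c a * s a i) (\<lambda>i. \<Sum>a\<in>UNIV. c a * t a i)"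
    if "\<And>a. R k (s a) (t a)" "\<And>a. homogeneous (int e) (c a)" for k e c and s t :: "3 \<Rightarrow> 3 \<Rightarrow> tpoly"
    unfolding sum_3 by (intro R_add R_mult that)
  have R_unique: "s = s'" if "R k s t" "R k s' t" for k s s' t
  proof -
    have "R (k + 0) (\<lambda>i. Const (- 1) * s' i) (\<lambda>i. Const (- 1) * t i)"
      using that(2) by (rule R_mult) simp
    then have "R k (\<lambda>i. s i + Const (- 1) * s' i) (\<lambda>i. t i + Const (- 1) * t i)"
      using R_add[OF that(1)] by simp
    then have "(\<lambda>i. s i + Const (- 1) * s' i) = (\<lambda>_. 0)"
      using R_zero by (simp add: Const_simps)
    then show ?thesis by (simp add: Const_simps fun_eq_iff)
  qed
  have "(\<Sum>a\<in>UNIV. ?F a * T a i) = 0" for i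
  proof -
    have "R (d - 1 + (d - 1)) (\<lambda>i. \<Sum>a\<in>UNIV. ?F a * T a i) (\<lambda>i. \<Sum>a\<in>UNIV. ?F a * K a i)"
      by (intro R_sum T hF)
    moreover have "(\<Sum>a\<in>UNIV. ?F a * K a i) = 0" for i
      unfolding K_def cross_expand[symmetric] by (rule cross_self)
    ultimately have "(\<lambda>i. \<Sum>a\<in>UNIV. ?F a * T a i) = (\<lambda>_. 0)"
      using R_zero by (metis (mono_tags, lifting) ext)
    then show ?thesis by (rule fun_cong)
  qed
  then have "(\<lambda>a. T a i) \<in> syzygies f (d - 1)" for i
    using T(1) by (simp add: syzygies_def mult.commute)
  then have "\<exists>a. \<forall>j. T j i = cross (\<lambda>j. Const (a j)) ?F j" for i
    using koszul by blast
  then obtain M where M: "\<And>i a. T a i = cross (\<lambda>j. Const (M i j)) ?F a"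
    by metis
  \<comment> \<open>The sign compensates that of \<open>cross_transpose\<close>.\<close>
  define b where "b i j = - M i j" for i j
  have TK: "T a i = mat_apply b (K a) i" for a i
    unfolding M cross_transpose[of _ _ a] mat_apply_def K_def b_def
    by (simp add: Const_simps sum_negf)
  have main: "t = mat_apply b s" if s: "s \<in> syzygies f k" and R: "R k t s" for k s t
  proof
    fix i
    \<comment> \<open>As \<open>s\<close> is orthogonal to the gradient, the cross product of
      \<open>u\<close> with it is \<open>?F l\<close> times \<open>s\<close>. So this multiple of
      \<open>s\<close> is a combination of Koszul syzygies, whose images are known, and
      \<open>?F l\<close> is cancelled at the end.\<close>
    define u where "u = cross (basis_vec l) s"
    have "homogeneous (int k) (u a)" for a
      using homogeneous_cross[of 0 "basis_vec l" "int k" s a, OF homogeneous_basis_vec] s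
      by (simp add: u_def syzygies_def)
    then have "R (d - 1 + k) (\<lambda>i. \<Sum>a\<in>UNIV. u a * T a i) (\<lambda>i. \<Sum>a\<in>UNIV. u a * K a i)"
      by (intro R_sum T)
    moreover have uK: "(\<Sum>a\<in>UNIV. u a * K a i) = ?F l * s i" for i
    proof -
      have "(\<Sum>j\<in>UNIV. s j * ?F j) = 0"
        using s by (simp add: syzygies_def)
      moreover have "(\<Sum>j\<in>UNIV. basis_vec l j * ?F j) = ?F l"
        by (simp add: basis_vec_def if_distrib[of "\<lambda>x. x * _"] cong: if_cong)
      ultimately show ?thesis
        unfolding K_def cross_expand[symmetric] u_def cross_cross by (simp add: mult.commute)
    qed
    moreover have "R (d - 1 + k) (\<lambda>i. ?F l * t i) (\<lambda>i. ?F l * s i)"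
      using R_mult[OF R hF[of l]] by (simp add: add.commute)
    ultimately have "(\<lambda>i. ?F l * t i) = (\<lambda>i. \<Sum>a\<in>UNIV. u a * T a i)"
      using R_unique by simp
    then have "?F l * t i = (\<Sum>a\<in>UNIV. u a * T a i)"
      by (rule fun_cong)
    also have "\<dots> = (\<Sum>j\<in>UNIV. Const (b i j) * (\<Sum>a\<in>UNIV. u a * K a j))"
      unfolding TK mat_apply_def sum_distrib_left by (subst sum.swap) (simp add: ac_simps)
    also have "\<dots> = ?F l * mat_apply b s i"
      unfolding uK mat_apply_def sum_distrib_left by (simp add: ac_simps)
    finally show "t i = mat_apply b s i" using f(3) by simp
  qed
  show ?thesis
  proof (rule that[of b])
    show "\<forall>k. \<forall>s\<in>syzygies f k. mat_apply b s \<in> syzygies f' k"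
      using R2 main by metis
    show "\<forall>k. \<forall>t\<in>syzygies f' k. \<exists>s\<in>syzygies f k. t = mat_apply b s"
      using R1 main by metis
  qed
qed

text \<open>Differentiating the relation puts a constant syzygy into the kernel of the Hessian
  matrix at \<open>w\<close>; so the constant syzygies form at most a line.\<close>

lemma constant_syzygy_at_node:
  fixes w :: "complex ^ 3"
  assumes "s \<in> syzygies f 0"
    and ker: "\<forall>u. (\<forall>i. (\<Sum>j\<in>UNIV. hess f w i j * u $ j) = 0) \<longrightarrow> (\<exists>c. u = c *s w)"
  obtains c where "\<And>j. s j = Const (c * w $ j)"
proof -
  have s0: "homogeneous 0 (s j)" for j
    using assms(1) by (simp add: syzygies_def)
  have "\<exists>c. s j = Const c" for j
    by (rule homogeneous_0_imp_Const[OF s0]) blast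
  then obtain x where x: "\<And>j. s j = Const (x j)" by metis
  have "(\<Sum>j\<in>UNIV. hess f w i j * (\<chi> j. x j) $ j) = 0" for i
  proof -
    have "pderivative i (\<Sum>j\<in>UNIV. Const (x j) * pderivative j f) = 0"
      using assms(1) by (simp add: syzygies_def x)
    then have "(\<Sum>j\<in>UNIV. Const (x j) * pderivative i (pderivative j f)) = 0"
      by (simp add: pderivative_sum pderivative_Const_mult)
    then have "eval (\<Sum>j\<in>UNIV. Const (x j) * pderivative i (pderivative j f)) w = 0"
      by (simp only: eval_simps(2))
    then show ?thesis by (simp add: mult.commute)
  qed
  then obtain c where "(\<chi> j. x j) = c *s w" using ker by blast
  then have "x j = c * w $ j" for j
    by (metis vec_lambda_beta vector_smult_component)
  then show ?thesis using that[of c] by (simp add: x)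
qed

text \<open>
  If \<open>u\<^sup>T b = 0\<close> then the gradient of \<open>f'\<close> is proportional to \<open>u\<close>, and the constant syzygies orthogonal
  to \<open>u\<close> would come from two independent constant syzygies of \<open>f\<close>.
\<close>

lemma syzygy_matrix_injective:
  fixes w :: "complex ^ 3"
  assumes f': "homogeneous (int d') f'" "d' \<ge> 1"
    and b: "\<forall>k. \<forall>t\<in>syzygies f' k. \<exists>s\<in>syzygies f k. t = mat_apply b s"
    and ker: "\<forall>u. (\<forall>i. (\<Sum>j\<in>UNIV. hess f w i j * u $ j) = 0) \<longrightarrow> (\<exists>c. u = c *s w)"
    and u: "\<And>j. (\<Sum>i\<in>UNIV. u i * b i j) = 0"
  shows "u i = 0"
proof (rule ccontr)
  assume ui: "u i \<noteq> 0"
  let ?F = "\<lambda>j. pderivative j f'"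
  have ub: "(\<Sum>i\<in>UNIV. Const (u i) * mat_apply b s i) = 0" for s
  proof -
    have "(\<Sum>i\<in>UNIV. Const (u i) * mat_apply b s i) = (\<Sum>j\<in>UNIV. Const (\<Sum>i\<in>UNIV. u i * b i j) * s j)"
      unfolding mat_apply_def sum_distrib_left Const_simps(8) sum_distrib_right
      by (subst sum.swap) (simp add: Const_simps ac_simps)
    then show ?thesis by (simp add: u Const_simps)
  qed
  \<comment> \<open>\<open>u\<close> annihilates the image of \<open>mat_apply b\<close>, which
    contains the Koszul syzygies of f'.\<close>
  have "cross (\<lambda>j. Const (u j)) ?F a = 0" for a
  proof -
    obtain s where "cross (basis_vec a) ?F = mat_apply b s"
      using b koszul_syzygy[OF f'] by blast
    then show ?thesis
      unfolding cross_transpose[of _ _ a] by (simp add: ub)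
  qed
  then have prop_u: "Const (u i) * ?F j = Const (u j) * ?F i" for j
    by (rule cross_eq_0D)
  have image: "\<exists>c. \<forall>l. v l = c * (\<Sum>j\<in>UNIV. b l j * w $ j)" if v: "(\<Sum>l\<in>UNIV. v l * u l) = 0" for v
  proof -
    have "Const (u i) * (\<Sum>l\<in>UNIV. Const (v l) * ?F l) = (\<Sum>l\<in>UNIV. Const (v l) * (Const (u i) * ?F l))"
      by (simp add: sum_distrib_left mult.left_commute)
    also have "\<dots> = Const (\<Sum>l\<in>UNIV. v l * u l) * ?F i"
      unfolding prop_u Const_simps(8) sum_distrib_right by (simp add: Const_simps mult.assoc)
    finally have "(\<Sum>l\<in>UNIV. Const (v l) * ?F l) = 0"
      using ui v by (simp add: Const_simps(2))
    then have "(\<lambda>l. Const (v l)) \<in> syzygies f' 0"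
      by (simp add: syzygies_def)
    then obtain s where s: "s \<in> syzygies f 0" "(\<lambda>l. Const (v l)) = mat_apply b s"
      using b by blast
    obtain c where c: "\<And>j. s j = Const (c * w $ j)"
      by (rule constant_syzygy_at_node[OF s(1) ker]) blast
    have "v l = c * (\<Sum>j\<in>UNIV. b l j * w $ j)" for l
    proof -
      have "Const (v l) = Const (\<Sum>j\<in>UNIV. b l j * (c * w $ j))"
        using fun_cong[OF s(2), of l] by (simp add: mat_apply_def c Const_simps)
      then have "v l = (\<Sum>j\<in>UNIV. b l j * (c * w $ j))" by (simp only: Const_eq_iff)
      then show ?thesis by (simp add: sum_distrib_left ac_simps)
    qed
    then show ?thesis by blast
  qed
  obtain j k :: 3 where jk: "j \<noteq> i" "k \<noteq> i" "j \<noteq> k" "UNIV = {i, j, k}"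
    by (rule other_indices)
  have sum3: "(\<Sum>l\<in>UNIV. h l) = h i + h j + h k" for h :: "3 \<Rightarrow> complex"
    using jk(1-3) by (simp add: jk(4) add.assoc eq_commute)
  define z where "z l = (\<Sum>j\<in>UNIV. b l j * w $ j)" for l
  \<comment> \<open>The vectors with entries (- u_j, u_i, 0) and (- u_k, 0, u_i) at i, j, k are
    independent and orthogonal to u, yet both would be multiples of z.\<close>
  have "\<exists>c. \<forall>l. (if l = i then - u j else if l = j then u i else 0) = c * z l"
    unfolding z_def by (rule image) (use jk(1-3) in \<open>simp add: sum3 mult.commute\<close>)
  then obtain c where "\<forall>l. (if l = i then - u j else if l = j then u i else 0) = c * z l" by blast
  then have "u i = c * z j" using jk(1) by (metis (full_types))
  have "\<exists>c. \<forall>l. (if l = i then - u k else if l = k then u i else 0) = c * z l"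
    unfolding z_def by (rule image) (use jk(1-3) in \<open>simp add: sum3 mult.commute\<close>)
  then obtain c' where c': "\<forall>l. (if l = i then - u k else if l = k then u i else 0) = c' * z l" by blast
  then have "0 = c' * z j" "u i = c' * z k"
    using jk(1-3) by (metis (full_types))+
  then show False
    using ui \<open>u i = c * z j\<close> by auto
qed

text \<open>The transposed matrix maps the gradient of f' to a triple orthogonal to the Koszul
  syzygies of f, hence to c times the gradient of f. As the matrix is invertible, c divides the
  gradient of f', so c is constant because f' is squarefree. Its degree d' - d is therefore
  zero.\<close>

lemma gradients_constant_multiple:
  fixes w :: "complex ^ 3"
  assumes f: "homogeneous (int d) f" "d \<ge> 1" "finite_zeros (\<lambda>j. pderivative j f)"
    and f': "homogeneous (int d') f'" "d' \<ge> 1" "f' \<noteq> 0" "squarefree f'"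
    and b: "\<forall>k. \<forall>s\<in>syzygies f k. mat_apply b s \<in> syzygies f' k"
    and inj: "\<forall>u. (\<forall>j. (\<Sum>i\<in>UNIV. u i * b i j) = 0) \<longrightarrow> (\<forall>i. u i = 0)"
  obtains A where "d' = d" "\<And>i. pderivative i f' = (\<Sum>j\<in>UNIV. Const (A i j) * pderivative j f)"
proof -
  let ?F = "\<lambda>j. pderivative j f" and ?F' = "\<lambda>j. pderivative j f'"
  define G where "G j = (\<Sum>i\<in>UNIV. Const (b i j) * ?F' i)" for j
  have hF: "homogeneous (int (d - 1)) (?F j)" for j
    using homogeneous_pderivative[OF f(1), of j] f(2) by (simp add: of_nat_diff)
  have hF': "homogeneous (int (d' - 1)) (?F' j)" for j
    using homogeneous_pderivative[OF f'(1), of j] f'(2) by (simp add: of_nat_diff)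
  have hG: "homogeneous (int (d' - 1)) (G j)" for j
    unfolding G_def by (intro homogeneous_sum homogeneous_Const_mult hF')
  have "cross G ?F a = 0" for a
  proof -
    have "mat_apply b (cross (basis_vec a) ?F) \<in> syzygies f' (d - 1)"
      using b koszul_syzygy[OF f(1,2)] by blast
    then have "(\<Sum>i\<in>UNIV. mat_apply b (cross (basis_vec a) ?F) i * ?F' i) = 0"
      by (simp add: syzygies_def)
    also have "(\<Sum>i\<in>UNIV. mat_apply b (cross (basis_vec a) ?F) i * ?F' i) =
        (\<Sum>j\<in>UNIV. G j * cross (basis_vec a) ?F j)"
      unfolding mat_apply_def G_def sum_distrib_right by (subst sum.swap) (simp add: ac_simps)
    finally show ?thesis
      unfolding cross_transpose[of _ _ a] by simp
  qed
  then obtain c where c: "homogeneous (int (d' - 1) - int (d - 1)) c" "\<And>j. G j = c * ?F j"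
    by (rule cross_zero_imp_proportional[OF hF f(3) hG]) blast
  \<comment> \<open>The transpose of \<open>b\<close>, which is injective by
    \<open>inj\<close>.\<close>
  define B :: "complex ^ 3 ^ 3" where "B = (\<chi> j i. b i j)"
  have "\<forall>x. B *v x = 0 \<longrightarrow> x = 0"
  proof (intro allI impI)
    fix x :: "complex ^ 3" assume "B *v x = 0"
    then have "(\<Sum>i\<in>UNIV. x $ i * b i j) = 0" for j
      by (simp add: matrix_vector_mult_def B_def vec_eq_iff mult.commute)
    then have "x $ i = 0" for i
      using inj by (metis (full_types))
    then show "x = 0" by (simp add: vec_eq_iff)
  qed
  then obtain B' where B': "B' ** B = mat 1"
    using matrix_left_invertible_ker by blast
  have entry: "(\<Sum>j\<in>UNIV. B' $ l $ j * B $ j $ i) = (if l = i then 1 else 0)" for l i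
    using arg_cong[OF B', of "\<lambda>A. A $ l $ i"] by (simp add: matrix_matrix_mult_def mat_def)
  have F'_eq: "?F' l = (\<Sum>j\<in>UNIV. Const (B' $ l $ j) * G j)" for l
  proof -
    have "(\<Sum>j\<in>UNIV. Const (B' $ l $ j) * G j) = (\<Sum>i\<in>UNIV. Const (\<Sum>j\<in>UNIV. B' $ l $ j * B $ j $ i) * ?F' i)"
      unfolding G_def sum_distrib_left Const_simps(8) sum_distrib_right
      by (subst sum.swap) (simp add: B_def Const_simps mult.assoc)
    also have "\<dots> = ?F' l"
      unfolding entry by (simp add: if_distrib[of Const] if_distrib[of "\<lambda>x. x * _"] Const_simps cong: if_cong)
    finally show ?thesis ..
  qed
  have "c \<noteq> 0"
  proof
    assume "c = 0"
    then have "?F' l = 0" for l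
      by (simp add: F'_eq c(2))
    then have "of_nat d' * f' = 0"
      using euler[OF f'(1)] by simp
    then show False using f'(2,3) by (simp add: of_nat_eq_Const)
  qed
  have "c dvd 1"
  proof (rule ccontr)
    assume "\<not> c dvd 1"
    then obtain q where q: "prime_elem q" "q dvd c"
      using prime_factor_exists[OF \<open>c \<noteq> 0\<close>] by blast
    have "q dvd ?F' l" for l
      unfolding F'_eq c(2) using q(2) by (intro dvd_sum dvd_mult dvd_mult2)
    then show False
      using prime_dvd_gradient_not_squarefree[OF f'(1,2,4) q(1)] by blast
  qed
  then obtain a where a: "c = Const a" "a \<noteq> 0"
    unfolding is_unit_tpoly_iff by blast
  have "int (d' - 1) - int (d - 1) = 0"
    using homogeneous_degree_unique[OF c(1) _ \<open>c \<noteq> 0\<close>, of 0] by (simp add: a(1))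
  then have "d' = d" using f(2) f'(2) by simp
  moreover have "?F' i = (\<Sum>j\<in>UNIV. Const (B' $ i $ j * a) * ?F j)" for i
    by (simp only: F'_eq c(2) a(1) Const_simps mult.assoc)
  ultimately show ?thesis by (rule that)
qed

lemma curve_points_Const_mult:
  assumes "c \<noteq> 0"
  shows "curve_points (Const c * f) = curve_points f"
  using assms by (simp add: curve_points_def common_zeros_def)

theorem theorem5p8:
  fixes f :: tpoly and d :: nat
  assumes "nodal_curve f d"
    and "d \<ge> 4"
    and "\<exists>m :: int.
           (if irreducible f then 2 * m < int d - 1 else 2 * m < int d - 2) \<and>
           zero_dimensional (base_locus m f)"
  shows "torelli f"
  unfolding torelli_def
proof (intro allI impI)
  fix f' d'
  assume f': "reduced_curve f' d'" and iso: "sheaf_isomorphic (log_vector_fields f') (log_vector_fields f)"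
  have f: "homogeneous (int d) f" and nodal: "\<forall>P\<in>singular_points f. is_node f P"
    using assms(1) by (auto simp: nodal_curve_def reduced_curve_def)
  obtain m' :: int where "if irreducible f then 2 * m' < int d - 1 else 2 * m' < int d - 2"
    and zd: "zero_dimensional (base_locus m' f)"
    using assms(3) by blast
  then have "2 * m' < int d - 1"
    by (cases "irreducible f") simp_all
  with zd have m': "2 * m' < int d - 1" "finite (base_locus m' f)" "base_locus m' f \<noteq> {}"
    by (simp_all add: zero_dimensional_def)
  \<comment> \<open>In negative degree only the zero form exists, and every point of the plane would
    be a base point.\<close>
  have "\<not> m' < 0"
  proof
    assume "m' < 0"
    then have "eval g v = 0" if "g \<in> forms_through_nodes m' f" for g v
      using that homogeneous_negative[OF _ \<open>m' < 0\<close>, of g] by (simp add: forms_through_nodes_def)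
    then have "base_locus m' f = P2"
      by (auto simp: base_locus_def common_zeros_def)
    then show False using m'(2) infinite_P2 by simp
  qed
  then obtain m where m: "m' = int m"
    by (metis linorder_not_less zero_le_imp_eq_int)
  have fin: "finite (base_locus (int m) f)" and m_bound: "2 * m < d - 1"
    using m' assms(2) unfolding m by linarith+
  \<comment> \<open>Without nodes all \<open>Var i ^ m\<close> belong to the linear system; they
    have no common zero, whereas the base locus is nonempty.\<close>
  obtain P where P: "is_node f P"
  proof (rule ccontr)
    assume "\<not> thesis"
    then have no_nodes: "nodes f = {}" using that by (auto simp: nodes_def)
    obtain Q where Q: "Q \<in> base_locus m' f" using m'(3) by blast
    then have "Q \<in> P2" by (simp add: base_locus_def common_zeros_def)
    then obtain v where "v \<noteq> 0" "Q = proj_point v" by (rule P2_nonempty_point)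
    with Q have v: "v \<noteq> 0" "proj_point v \<in> base_locus m' f" by simp_all
    have "Var i ^ m \<in> forms_through_nodes m' f" for i
      by (simp add: forms_through_nodes_def no_nodes m homogeneous_Var_power)
    then have "eval (Var i ^ m) v = 0" for i
      using v(2) self_in_proj_point[of v] unfolding base_locus_def common_zeros_def by blast
    then have "v $ i = 0" for i by simp
    then show False using v(1) by (simp add: vec_eq_iff)
  qed
  have d2: "d \<ge> 2" and d1: "d \<ge> 1" using assms(2) by simp_all
  obtain w :: "complex ^ 3" and k where w: "w \<in> P" "w $ k = 1"
    and ker: "\<forall>u. (\<forall>i. (\<Sum>j\<in>UNIV. hess f w i j * u $ j) = 0) \<longrightarrow> (\<exists>c. u = c *s w)"
    by (rule node_hessian_kernel[OF f d2 P])
  have crit: "eval (pderivative j f) w = 0" for j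
    using P w(1) by (auto simp: is_node_def singular_points_def)
  have fz: "finite_zeros (\<lambda>j. pderivative j f)"
    by (rule finite_base_locus_finite_zeros[OF f d2 nodal fin])
  obtain l where l: "pderivative l f \<noteq> 0"
    using fz by (rule finite_zeros_nonzero)
  have koszul: "\<exists>a. \<forall>j. s j = cross (\<lambda>j. Const (a j)) (\<lambda>j. pderivative j f) j"
    if "s \<in> syzygies f (d - 1)" for s
    by (rule syzygies_koszul[OF f d2 nodal m_bound fin that]) blast
  obtain b where b: "\<forall>k. \<forall>s\<in>syzygies f k. mat_apply b s \<in> syzygies f' k"
    "\<forall>k. \<forall>t\<in>syzygies f' k. \<exists>s\<in>syzygies f k. t = mat_apply b s"
    by (rule syzygy_isomorphism_constant[OF f d1 l koszul iso])
  have f'_facts: "homogeneous (int d') f'" "d' \<ge> 1" "f' \<noteq> 0" "squarefree f'"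
    using f' by (simp_all add: reduced_curve_def)
  have "\<forall>u. (\<forall>j. (\<Sum>i\<in>UNIV. u i * b i j) = 0) \<longrightarrow> (\<forall>i. u i = 0)"
    using syzygy_matrix_injective[OF f'_facts(1,2) b(2) ker] by blast
  then obtain A where A: "d' = d" "\<And>i. pderivative i f' = (\<Sum>j\<in>UNIV. Const (A i j) * pderivative j f)"
    by (rule gradients_constant_multiple[OF f d1 fz f'_facts b(1)]) blast
  obtain c where c: "f' = Const c * f"
    using gradient_determines_nodal_curve[OF f _ assms(2) A(2) crit ker] f'_facts(1) A(1) by blast
  then have "c \<noteq> 0" using f'_facts(3) by (auto simp: Const_simps)
  then show "curve_points f' = curve_points f"
    unfolding c by (rule curve_points_Const_mult)
qed

end
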